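(* Let $V$ be a generic (in the sense defined in the context) real trigonometric polynomial of degree $k$ on $\mathbb T^2$, and let $H=-\partial_x^2-\partial_y^2+V$ on $L^2([-\pi,\pi]^2)$ with periodic boundary conditions. Then the $L^2$-normalized eigenfunctions $\phi$ of $H$ have bounded $L^p$ norms for all $p>0$: for every $p>0$ there is a constant $C_p$ such that for every $L^2$-normalized eigenfunction $\phi$ of $H$, $$\|\phi\|_{L^p(\mathbb T^2)}<C_p .$$
   Context: $V$ is a real trigonometric polynomial of degree $k$, $2\pi\times2\pi$ periodic, with Fourier coefficients $\hat V(a,b)$, $(a,b)\in\mathbb Z^2$, vanishing unless $|a|,|b|\le k$. $\operatorname{supp}\hat V$ is the set of $(a,b)$ with $\hat V(a,b)\ne0$. The geometric support of $\hat V$ is $$\operatorname{gsupp}\hat V=\{(a,b)\in\mathbb Z^2\setminus\{0\} : \exists\, s\ge1 \text{ such that } (sa,sb)\in\operatorname{supp}\hat V\}.$$ For $(a,b),(c,d)\in\operatorname{gsupp}\hat V$ put $$v_{a,b}=\sum_{1\le s\le k}|\hat V(sa,sb)|^2(a^2+b^2),$$ $$g_{a,b;c,d}=\sum_{-k\le s,s'\le k,\ s,s'\ne0}\frac{\hat V(sa,sb)\,\hat V(s'c-sa,s'd-sb)\,\hat V(s'c,s'd)}{4s^2s'}.$$ Consider the two rational functions of $x$: $$f=(1+x^2)\Big(\sum_{(a,b)}v_{a,b}\frac{ax-b}{(a+bx)^3}+\sum_{(a,b),(c,d)}g_{a,b;c,d}\frac{ax-b}{(a+bx)^2(c+dx)}\Big)\quad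 (a+bx\ne0,\ c+dx\neq 0),$$ $$f=(1+x^2)\Big(\sum_{(a,b)}v_{a,b}\frac{a-bx}{(ax+b)^3}+\sum_{(a,b),(c,d)}g_{a,b;c,d}\frac{a-bx}{(ax+b)^2(cx+d)}\Big)\quad (ax+b\ne0,\ cx+d\neq 0),$$ the sums being over $(a,b),(c,d)\in\operatorname{gsupp}\hat V$. Each $f$ is written as $f=P_1/P_2$ with $P_1,P_2$ polynomials in $x$ (in lowest terms) of degrees at most $O(k^4)$, whose coefficients depend only on $\hat V$ and $\operatorname{supp}\hat V$. $V$ is called generic if: (i) for every $(a,b)\in\operatorname{gsupp}\hat V$, $$\sum_{1\le s\le k}|\hat V(sa,sb)|^2(a^2+b^2)-\sum_{1\le|s|,|s'|\le k}\frac{\hat V(sa,sb)\,\hat V(s'a,s'b)\,\hat V((s-s')a,(s-s')b)}{4s^2s'}\ne0;$$ (ii) $\operatorname{Resultant}(P_1,P_1')\ne0$ for both polynomials $P_1$ obtained from the two functions $f$ above. *)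

theory Defs
  imports
    "HOL-Analysis.Analysis"
    "HOL-Computational_Algebra.Field_as_Ring"
    "HOL-Computational_Algebra.Polynomial_Factorial"
    "HOL-Computational_Algebra.Normalized_Fraction"
    "Subresultants.Resultant_Prelim"
begin

section \<open>Function spaces on the torus\<close>

abbreviation T2 :: "(real \<times> real) measure" where
  "T2 \<equiv> lebesgue_on ({-pi..pi} \<times> {-pi..pi})"

definition in_Lp :: "real \<Rightarrow> (real \<times> real \<Rightarrow> complex) \<Rightarrow> bool" where
  "in_Lp p f \<longleftrightarrow> f \<in> borel_measurable T2 \<and> integrable T2 (\<lambda>z. cmod (f z) powr p)"

text \<open>Meaningful only together with \<^const>\<open>in_Lp\<close>, because a non-integrable
  function has Bochner integral \<open>0\<close>.\<close>

definition Lp_norm :: "real \<Rightarrow> (real \<times> real \<Rightarrow> complex) \<Rightarrow> real" where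
  "Lp_norm p f = (LINT z|T2. cmod (f z) powr p) powr (1 / p)"

definition fourier_coeff :: "(real \<times> real \<Rightarrow> complex) \<Rightarrow> int \<times> int \<Rightarrow> complex" where
  "fourier_coeff f = (\<lambda>(a, b).
     (LINT (x, y)|T2. f (x, y) * cis (- (of_int a * x + of_int b * y))) / (2 * pi)\<^sup>2)"

definition real_trig_polynomial :: "nat \<Rightarrow> (real \<times> real \<Rightarrow> real) \<Rightarrow> bool" where
  "real_trig_polynomial k V \<longleftrightarrow> (\<exists>c :: int \<times> int \<Rightarrow> complex. \<forall>x y.
     complex_of_real (V (x, y)) =
       (\<Sum>a\<in>{- int k..int k}. \<Sum>b\<in>{- int k..int k}. c (a, b) * cis (of_int a * x + of_int b * y)))"


section \<open>The operator \<open>-\<partial>\<^sub>x\<^sup>2 - \<partial>\<^sub>y\<^sup>2 + V\<close> with periodic boundary conditions\<close>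

definition periodic2 :: "(real \<times> real \<Rightarrow> complex) \<Rightarrow> bool" where
  "periodic2 f \<longleftrightarrow> (\<forall>x y. f (x + 2 * pi, y) = f (x, y) \<and> f (x, y + 2 * pi) = f (x, y))"

text \<open>Weak derivative in direction \<open>e\<close> on the torus. The test functions are periodic and
  not required to vanish on the boundary of the square; this is what imposes the
  periodic boundary conditions.\<close>

definition has_weak_derivative ::
  "real \<times> real \<Rightarrow> (real \<times> real \<Rightarrow> complex) \<Rightarrow> (real \<times> real \<Rightarrow> complex) \<Rightarrow> bool" where
  "has_weak_derivative e f g \<longleftrightarrow> in_Lp 2 f \<and> in_Lp 2 g \<and>
     (\<forall>\<eta> \<eta>'. periodic2 \<eta> \<and> continuous_on UNIV \<eta> \<and> continuous_on UNIV \<eta>' \<and>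
        (\<forall>z. ((\<lambda>t. \<eta> (z + t *\<^sub>R e)) has_vector_derivative \<eta>' z) (at 0)) \<longrightarrow>
        (LINT z|T2. f z * \<eta>' z) = - (LINT z|T2. g z * \<eta> z))"

text \<open>\<open>\<phi>\<close> lies in the domain of \<open>H\<close> (the periodic Sobolev space \<open>H\<^sup>2\<close>) and \<open>H \<phi> = \<psi>\<close>
  as elements of \<open>L\<^sup>2\<close>.\<close>

definition schroedinger ::
  "(real \<times> real \<Rightarrow> real) \<Rightarrow> (real \<times> real \<Rightarrow> complex) \<Rightarrow> (real \<times> real \<Rightarrow> complex) \<Rightarrow> bool" where
  "schroedinger V \<phi> \<psi> \<longleftrightarrow> in_Lp 2 \<psi> \<and>
     (\<exists>\<phi>x \<phi>xx \<phi>y \<phi>yy.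
        has_weak_derivative (1, 0) \<phi> \<phi>x \<and> has_weak_derivative (1, 0) \<phi>x \<phi>xx \<and>
        has_weak_derivative (0, 1) \<phi> \<phi>y \<and> has_weak_derivative (0, 1) \<phi>y \<phi>yy \<and>
        (AE z in T2. \<psi> z = - \<phi>xx z - \<phi>yy z + of_real (V z) * \<phi> z))"

definition eigenfunction ::
  "(real \<times> real \<Rightarrow> real) \<Rightarrow> (real \<times> real \<Rightarrow> complex) \<Rightarrow> bool" where
  "eigenfunction V \<phi> \<longleftrightarrow> in_Lp 2 \<phi> \<and> \<not> (AE z in T2. \<phi> z = 0) \<and>
     (\<exists>E :: complex. schroedinger V \<phi> (\<lambda>z. E * \<phi> z))"


section \<open>Genericity\<close>

text \<open>Below, \<open>W\<close> is the family of Fourier coefficients of the potential.\<close>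

definition supp :: "(int \<times> int \<Rightarrow> complex) \<Rightarrow> (int \<times> int) set" where
  "supp W = {n. W n \<noteq> 0}"

definition gsupp :: "(int \<times> int \<Rightarrow> complex) \<Rightarrow> (int \<times> int) set" where
  "gsupp W = {(a, b). (a, b) \<noteq> (0, 0) \<and> (\<exists>s\<ge>1. (s * a, s * b) \<in> supp W)}"

definition v_coeff :: "nat \<Rightarrow> (int \<times> int \<Rightarrow> complex) \<Rightarrow> int \<Rightarrow> int \<Rightarrow> complex" where
  "v_coeff k W a b =
     of_real (\<Sum>s\<in>{1..int k}. (cmod (W (s * a, s * b)))\<^sup>2 * of_int (a\<^sup>2 + b\<^sup>2))"

definition g_coeff ::
  "nat \<Rightarrow> (int \<times> int \<Rightarrow> complex) \<Rightarrow> int \<Rightarrow> int \<Rightarrow> int \<Rightarrow> int \<Rightarrow> complex" where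
  "g_coeff k W a b c d =
     (\<Sum>s\<in>{- int k..int k} - {0}. \<Sum>s'\<in>{- int k..int k} - {0}.
        W (s * a, s * b) * W (s' * c - s * a, s' * d - s * b) * W (s' * c, s' * d)
          / of_int (4 * s\<^sup>2 * s'))"

text \<open>The two functions \<open>f\<close> as elements of the field of rational functions over the
  complex numbers, with \<open>X\<close> the indeterminate.\<close>

abbreviation X :: "complex poly fract" where
  "X \<equiv> to_fract [:0, 1:]"

abbreviation const_fract :: "complex \<Rightarrow> complex poly fract" where
  "const_fract c \<equiv> to_fract [:c:]"

definition f_first :: "nat \<Rightarrow> (int \<times> int \<Rightarrow> complex) \<Rightarrow> complex poly fract" where
  "f_first k W = (1 + X\<^sup>2) *
     ((\<Sum>(a, b)\<in>gsupp W. const_fract (v_coeff k W a b) *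
          ((of_int a * X - of_int b) / (of_int a + of_int b * X) ^ 3)) +
      (\<Sum>(a, b)\<in>gsupp W. \<Sum>(c, d)\<in>gsupp W. const_fract (g_coeff k W a b c d) *
          ((of_int a * X - of_int b) /
             ((of_int a + of_int b * X)\<^sup>2 * (of_int c + of_int d * X)))))"

definition f_second :: "nat \<Rightarrow> (int \<times> int \<Rightarrow> complex) \<Rightarrow> complex poly fract" where
  "f_second k W = (1 + X\<^sup>2) *
     ((\<Sum>(a, b)\<in>gsupp W. const_fract (v_coeff k W a b) *
          ((of_int a - of_int b * X) / (of_int a * X + of_int b) ^ 3)) +
      (\<Sum>(a, b)\<in>gsupp W. \<Sum>(c, d)\<in>gsupp W. const_fract (g_coeff k W a b c d) *
          ((of_int a - of_int b * X) /
             ((of_int a * X + of_int b)\<^sup>2 * (of_int c * X + of_int d)))))"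

text \<open>Numerator in lowest terms. It is determined up to a nonzero constant factor, on which
  the non-vanishing of the resultant does not depend.\<close>

definition numerator :: "complex poly fract \<Rightarrow> complex poly" where
  "numerator f = fst (quot_of_fract f)"

text \<open>The Sylvester matrix of \<open>(0, 0)\<close> is empty, so \<^const>\<open>resultant\<close> takes the value \<open>1\<close>
  there. The zero polynomial is excluded explicitly: the condition says that \<open>P\<close> has
  no repeated roots.\<close>

definition resultant_condition :: "complex poly \<Rightarrow> bool" where
  "resultant_condition P \<longleftrightarrow> P \<noteq> 0 \<and> resultant P (pderiv P) \<noteq> 0"

definition generic_coeffs :: "nat \<Rightarrow> (int \<times> int \<Rightarrow> complex) \<Rightarrow> bool" where
  "generic_coeffs k W \<longleftrightarrow>
     (\<forall>(a, b)\<in>gsupp W.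
        v_coeff k W a b -
        (\<Sum>s\<in>{- int k..int k} - {0}. \<Sum>s'\<in>{- int k..int k} - {0}.
           W (s * a, s * b) * W (s' * a, s' * b) * W ((s - s') * a, (s - s') * b)
             / of_int (4 * s\<^sup>2 * s')) \<noteq> 0) \<and>
     resultant_condition (numerator (f_first k W)) \<and>
     resultant_condition (numerator (f_second k W))"

definition generic :: "nat \<Rightarrow> (real \<times> real \<Rightarrow> real) \<Rightarrow> bool" where
  "generic k V \<longleftrightarrow> generic_coeffs k (fourier_coeff (\<lambda>z. of_real (V z)))"

end

(* A plane wave exp(i n.z) that is not nearly in resonance with V is turned into an approximate
   eigenfunction exp(i n.z + w(z)), where the trigonometric polynomial w solves
   2 i n.grad w + Laplace w + grad w . grad w = V - const up to a small error. Its energy is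
   |n|^2 + S(n) + error with S(n) = sum_m |V_m|^2 |m|^2 / (4 (n.m)^2). Pairing an exact eigenfunction
   of energy E with these quasimodes shows that its Fourier coefficient at n is O(X^-2),
   X = min |n.m| over a fixed finite set of m, unless n is resonant (|n.m| bounded for one of these m)
   or the energy of the quasimode is very close to E. On the annulus ||n|^2 - E| <= K the sum of X^-2
   and the number of resonant n are bounded uniformly in E. The n with quasimode energy close to E lie on
   one circle and on a thin level set of S^(-1/2), which is superadditive on every cone where the signs
   of n.m are fixed; strict convexity of the circle then bounds their number. Outside the annulus the
   coefficients are controlled by those inside, so the Fourier coefficients are summable with a uniform
   bound and the eigenfunction is bounded. *)

theory Submission
  imports Defs
begin

section \<open>Lattice points on a circle and a level set\<close>

text \<open>The counting dictates the accuracy of the quasimodes. An energy known up to O(S^2) is a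
  value of S^(-1/2) known up to O(S^(1/2)). For a point a u + b u' of the circle of radius R between
  u and u', superadditivity then leaves a + b - 1 = O(S), so a b |u - u'|^2 = ((a + b)^2 - 1) R^2 is
  bounded as long as R^2 S is. Where R^2 S is large, curvature does not suffice; the comparison is
  then with the point of the circle on a fixed ray of the cone, where S^(-1/2) is proportional to R
  and far larger.

  Let Y be the minimum of |n.m| over the frequencies m of V alone. Then S is at least of order Y^-2,
  so an energy error O(Y^-4) is allowed. This forces three terms in the phase: their sizes are 1/Y,
  1/(X Y^2), 1/(X^2 Y^3), and the products left over are O(X^-2 Y^-4). Divided by an energy gap Y^-4
  they leave the summable X^-2, whereas two terms would leave an error of order 1/(X Y^3).

  Boundedness follows from the summable coefficients by duality: the pairing with trigonometric
  polynomials is bounded in terms of their L^1 norm, and this extends to indicators of compact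
  sets.\<close>

definition rvec :: "int \<times> int \<Rightarrow> real \<times> real" where
  "rvec n = (of_int (fst n), of_int (snd n))"

definition cross2 :: "real \<times> real \<Rightarrow> real \<times> real \<Rightarrow> real" where
  "cross2 u v = fst u * snd v - snd u * fst v"

lemma inner_prod2: "inner u v = fst u * fst v + snd u * snd v" for u v :: "real \<times> real"
  by (simp add: inner_prod_def)

text \<open>Cramer's rule: division by \<open>cross2 u w\<close> gives the coordinates of
  \<open>v\<close> in the basis \<open>u\<close>, \<open>w\<close>. This is how a vector between two
  others becomes a conic combination of them.\<close>

lemma cross2_expansion:
  "cross2 u w *\<^sub>R v = cross2 v w *\<^sub>R u + cross2 u v *\<^sub>R w"
  by (simp add: cross2_def prod_eq_iff algebra_simps)

lemma card_lattice_near: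
  assumes "finite F" "\<And>n. n \<in> F \<Longrightarrow> norm (rvec n - rvec a) \<le> D"
  shows "card F \<le> nat (2 * \<lceil>D\<rceil> + 1) ^ 2"
proof -
  let ?B = "{fst a - \<lceil>D\<rceil>..fst a + \<lceil>D\<rceil>} \<times> {snd a - \<lceil>D\<rceil>..snd a + \<lceil>D\<rceil>}"
  have "F \<subseteq> ?B"
  proof
    fix n assume n: "n \<in> F"
    have "norm (rvec n - rvec a) \<le> D" using assms(2) n by blast
    moreover have "\<bar>fst (rvec n - rvec a)\<bar> \<le> norm (rvec n - rvec a)"
      by (metis norm_fst_le real_norm_def prod.collapse)
    moreover have "\<bar>snd (rvec n - rvec a)\<bar> \<le> norm (rvec n - rvec a)"
      by (metis norm_snd_le real_norm_def prod.collapse)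
    ultimately have "\<bar>real_of_int (fst n - fst a)\<bar> \<le> D" "\<bar>real_of_int (snd n - snd a)\<bar> \<le> D"
      by (auto simp: rvec_def)
    then have "\<bar>fst n - fst a\<bar> \<le> \<lceil>D\<rceil>" "\<bar>snd n - snd a\<bar> \<le> \<lceil>D\<rceil>" by linarith+
    then show "n \<in> ?B" by (cases n) auto
  qed
  then have "card F \<le> card ?B" by (intro card_mono) auto
  also have "\<dots> = nat (2 * \<lceil>D\<rceil> + 1) ^ 2"
    by (simp add: card_cartesian_product power2_eq_square algebra_simps)
  finally show ?thesis .
qed

text \<open>Power mean inequality; the tangent line of the cube at \<open>(s + t) / (x + y)\<close> bounds
  both terms from below.\<close>

lemma cube_over_square_add:
  fixes s t x y :: real
  assumes "s > 0" "t > 0" "x * y > 0"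
  shows "(s + t) ^ 3 / (x + y)\<^sup>2 \<le> s ^ 3 / x\<^sup>2 + t ^ 3 / y\<^sup>2"
proof -
  have pos: "(s + t) ^ 3 / (x + y)\<^sup>2 \<le> s ^ 3 / x\<^sup>2 + t ^ 3 / y\<^sup>2" if "x > 0" "y > 0" for x y :: real
  proof -
    define k where "k = (s + t) / (x + y)"
    have k: "k > 0" using assms that by (simp add: k_def)
    have tangent: "3 * k\<^sup>2 * a - 2 * k ^ 3 * z \<le> a ^ 3 / z\<^sup>2" if "a > 0" "z > 0" for a z
    proof -
      have "0 \<le> (a / z - k)\<^sup>2 * (a / z + 2 * k) * z" using that k by simp
      also have "\<dots> = a ^ 3 / z\<^sup>2 - (3 * k\<^sup>2 * a - 2 * k ^ 3 * z)"
        using that by (simp add: field_simps power2_eq_square power3_eq_cube)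
      finally show ?thesis by simp
    qed
    have kr: "s + t = k * (x + y)" using that by (simp add: k_def)
    have "(s + t) ^ 3 / (x + y)\<^sup>2 = 3 * k\<^sup>2 * (s + t) - 2 * k ^ 3 * (x + y)"
      unfolding kr using that by (simp add: power_mult_distrib power2_eq_square power3_eq_cube)
    also have "\<dots> = (3 * k\<^sup>2 * s - 2 * k ^ 3 * x) + (3 * k\<^sup>2 * t - 2 * k ^ 3 * y)"
      by (simp add: algebra_simps)
    also have "\<dots> \<le> s ^ 3 / x\<^sup>2 + t ^ 3 / y\<^sup>2"
      using tangent[of s x] tangent[of t y] assms that by linarith
    finally show ?thesis .
  qed
  consider "x > 0" "y > 0" | "x < 0" "y < 0" using assms(3) by (auto simp: zero_less_mult_iff)
  then show ?thesis
  proof cases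
    case 1 then show ?thesis by (rule pos)
  next
    case 2
    have "(- x + - y)\<^sup>2 = (x + y)\<^sup>2" by (simp add: power2_eq_square algebra_simps)
    with pos[of "-x" "-y"] 2 show ?thesis by simp
  qed
qed

section \<open>Superadditivity of the inverse square root of a sum of inverse squares\<close>

locale pole_weights =
  fixes \<Lambda> :: "(int \<times> int) set" and w :: "int \<times> int \<Rightarrow> real"
  assumes finite_poles: "finite \<Lambda>" and poles_nonempty: "\<Lambda> \<noteq> {}"
    and weight_pos: "\<And>m. m \<in> \<Lambda> \<Longrightarrow> w m > 0"
begin

definition S :: "real \<times> real \<Rightarrow> real" where
  "S u = (\<Sum>m\<in>\<Lambda>. w m / (inner u (rvec m))\<^sup>2)"

text \<open>Homogeneous of degree one under positive scaling, so that values at points of one circle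
  can be compared through conic combinations.\<close>

definition \<sigma> :: "real \<times> real \<Rightarrow> real" where
  "\<sigma> u = 1 / sqrt (S u)"

definition regular :: "real \<times> real \<Rightarrow> bool" where
  "regular u \<longleftrightarrow> (\<forall>m\<in>\<Lambda>. inner u (rvec m) \<noteq> 0)"

text \<open>Both vectors lie in one open chamber of the arrangement of lines orthogonal to the
  poles; strict positivity of the products includes regularity of both.\<close>

definition same_cone :: "real \<times> real \<Rightarrow> real \<times> real \<Rightarrow> bool" where
  "same_cone u v \<longleftrightarrow> (\<forall>m\<in>\<Lambda>. inner u (rvec m) * inner v (rvec m) > 0)"

lemma S_pos: assumes "regular u" shows "S u > 0"
  unfolding S_def
proof (rule sum_pos[OF finite_poles poles_nonempty])
  fix m assume "m \<in> \<Lambda>"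
  then show "w m / (inner u (rvec m))\<^sup>2 > 0"
    using assms weight_pos by (auto simp: regular_def)
qed

lemma \<sigma>_pos: "regular u \<Longrightarrow> \<sigma> u > 0"
  using S_pos by (simp add: \<sigma>_def)

lemma \<sigma>_square: "regular u \<Longrightarrow> S u * (\<sigma> u)\<^sup>2 = 1"
  using S_pos[of u] by (simp add: \<sigma>_def power_divide)

lemma S_scale: "S (a *\<^sub>R u) = S u / a\<^sup>2"
  by (simp add: S_def sum_divide_distrib power_mult_distrib mult.commute)

lemma \<sigma>_scale: "a > 0 \<Longrightarrow> \<sigma> (a *\<^sub>R u) = a * \<sigma> u"
  by (simp add: \<sigma>_def S_scale real_sqrt_divide)

lemma same_coneD: assumes "same_cone u v" shows "regular u" "regular v"
  using assms by (auto simp: same_cone_def regular_def)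

lemma same_cone_sym: "same_cone u v \<Longrightarrow> same_cone v u"
  by (auto simp: same_cone_def mult.commute)

lemma same_cone_scale: "same_cone u v \<Longrightarrow> a > 0 \<Longrightarrow> same_cone (a *\<^sub>R u) v"
  by (simp add: same_cone_def mult.assoc)

text \<open>With \<open>s = \<sigma> u\<close> and \<open>t = \<sigma> v\<close>,
  \<open>cube_over_square_add\<close> is applied to each pole separately. Because \<open>S u\<close>
  times \<open>s^2\<close> is 1, the sum of the right-hand sides collapses to \<open>s + t\<close>,
  which leaves \<open>(s + t)^2 S (u + v) <= 1\<close>.\<close>

lemma \<sigma>_superadditive:
  assumes "same_cone u v"
  shows "\<sigma> u + \<sigma> v \<le> \<sigma> (u + v)"
proof -
  note reg = same_coneD[OF assms]
  have reg': "regular (u + v)"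
    unfolding regular_def inner_add_left
  proof
    fix m assume "m \<in> \<Lambda>"
    then have "inner u (rvec m) * inner v (rvec m) > 0" using assms by (simp add: same_cone_def)
    then show "inner u (rvec m) + inner v (rvec m) \<noteq> 0" by (auto simp: zero_less_mult_iff)
  qed
  define s t where "s = \<sigma> u" and "t = \<sigma> v"
  have st: "s > 0" "t > 0" using \<sigma>_pos reg by (auto simp: s_def t_def)
  have "(s + t) ^ 3 * S (u + v) = (\<Sum>m\<in>\<Lambda>. w m * ((s + t) ^ 3 / (inner u (rvec m) + inner v (rvec m))\<^sup>2))"
    by (simp add: S_def sum_distrib_left inner_add_left mult.commute)
  also have "\<dots> \<le> (\<Sum>m\<in>\<Lambda>. w m * (s ^ 3 / (inner u (rvec m))\<^sup>2 + t ^ 3 / (inner v (rvec m))\<^sup>2))"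
    by (intro sum_mono mult_left_mono cube_over_square_add)
      (use st assms weight_pos in \<open>auto simp: same_cone_def intro: less_imp_le\<close>)
  also have "\<dots> = s ^ 3 * S u + t ^ 3 * S v"
    by (simp add: S_def sum_distrib_left sum.distrib distrib_left mult.commute)
  also have "s ^ 3 * S u = s"
    using \<sigma>_square[OF reg(1)] by (simp add: s_def power3_eq_cube power2_eq_square mult.assoc mult.commute)
  also have "t ^ 3 * S v = t"
    using \<sigma>_square[OF reg(2)] by (simp add: t_def power3_eq_cube power2_eq_square mult.assoc mult.commute)
  finally have "(s + t) * ((s + t)\<^sup>2 * S (u + v)) \<le> (s + t) * 1"
    by (simp add: power3_eq_cube power2_eq_square mult.assoc)
  then have "(s + t)\<^sup>2 * S (u + v) \<le> 1" using st by (subst (asm) mult_le_cancel_left_pos) auto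
  also have "1 = (\<sigma> (u + v))\<^sup>2 * S (u + v)" using \<sigma>_square[OF reg'] by (simp add: mult.commute)
  finally have "(s + t)\<^sup>2 \<le> (\<sigma> (u + v))\<^sup>2" using S_pos[OF reg'] by simp
  then show ?thesis using st \<sigma>_pos[OF reg'] by (simp add: s_def t_def power2_le_iff_abs_le)
qed

lemma \<sigma>_combination:
  assumes "same_cone u v" "a \<ge> 0" "b \<ge> 0" "a + b > 0"
  shows "a * \<sigma> u + b * \<sigma> v \<le> \<sigma> (a *\<^sub>R u + b *\<^sub>R v)"
proof -
  consider "a = 0" "b > 0" | "b = 0" "a > 0" | "a > 0" "b > 0" using assms by linarith
  then show ?thesis
  proof cases
    case 3
    then have "same_cone (a *\<^sub>R u) (b *\<^sub>R v)"
      using assms(1) by (meson same_cone_scale same_cone_sym)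
    from \<sigma>_superadditive[OF this] 3 show ?thesis by (simp add: \<sigma>_scale)
  qed (simp_all add: \<sigma>_scale)
qed

text \<open>The length of a chord of the circle enters through the identities
  \<open>|v|\<^sup>2 = (a + b)\<^sup>2 R\<^sup>2 - a b |u - u'|\<^sup>2\<close> and \<open>|v - u|\<^sup>2 = (a + b - 1)\<^sup>2 R\<^sup>2 + (1 - a) b |u - u'|\<^sup>2\<close>.\<close>

lemma norm_sq_combination:
  fixes u v :: "'a::real_inner"
  assumes "norm u = R" "norm v = R"
  shows "(norm (a *\<^sub>R u + b *\<^sub>R v))\<^sup>2 = (a + b)\<^sup>2 * R\<^sup>2 - a * b * (norm (u - v))\<^sup>2"
proof -
  have 1: "inner u u = R\<^sup>2" "inner v v = R\<^sup>2" using assms by (simp_all add: power2_norm_eq_inner[symmetric])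
  show ?thesis
    unfolding power2_norm_eq_inner inner_add_left inner_add_right inner_diff_left inner_diff_right
      inner_scaleR_left inner_scaleR_right 1 inner_commute[of v u]
    by (simp add: power2_eq_square algebra_simps)
qed

section \<open>Points of a circle near one level of the superadditive function\<close>

text \<open>The triangle inequality gives \<open>a + b >= 1\<close>, superadditivity gives
  \<open>a + b - 1 <= 3 C / \<mu>^2\<close>. Strict convexity of the circle turns the small excess
  of \<open>a + b\<close> into a bound for \<open>a b |u - u'|^2\<close>; the hypothesis
  \<open>R^2 <= D \<mu>^2\<close> makes this bound independent of \<open>R\<close>.\<close>

lemma close_of_between_mid:
  assumes "same_cone u u'" "norm u = R" "norm u' = R" "norm v = R" "R > 0"
    and v: "v = a *\<^sub>R u + b *\<^sub>R u'" and ab: "a \<ge> 0" "b \<ge> 0"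
    and "\<bar>\<sigma> u - \<mu>\<bar> \<le> C / \<mu>" "\<bar>\<sigma> u' - \<mu>\<bar> \<le> C / \<mu>" "\<bar>\<sigma> v - \<mu>\<bar> \<le> C / \<mu>"
    and "\<mu> > 0" "C > 0" "4 * C \<le> \<mu>\<^sup>2" "R\<^sup>2 \<le> D * \<mu>\<^sup>2"
  shows "(norm (v - u))\<^sup>2 \<le> 20 * C * D \<or> (norm (v - u'))\<^sup>2 \<le> 20 * C * D"
proof -
  define t where "t = a + b"
  define d where "d = (norm (u - u'))\<^sup>2"
  have "R \<le> t * R"
  proof -
    have "norm v \<le> norm (a *\<^sub>R u) + norm (b *\<^sub>R u')" unfolding v by (rule norm_triangle_ineq)
    then show ?thesis using assms by (simp add: t_def distrib_right)
  qed
  then have t1: "t \<ge> 1" using \<open>R > 0\<close> by simp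
  have \<mu>2: "C / \<mu> \<le> \<mu> / 4" using assms by (simp add: field_simps power2_eq_square)
  have "t * (\<mu> - C / \<mu>) \<le> a * \<sigma> u + b * \<sigma> u'"
  proof -
    have "a * (\<mu> - C / \<mu>) \<le> a * \<sigma> u" "b * (\<mu> - C / \<mu>) \<le> b * \<sigma> u'"
      using assms by (auto intro!: mult_left_mono)
    then show ?thesis by (simp add: t_def distrib_right)
  qed
  also have "\<dots> \<le> \<sigma> v" unfolding v
    by (rule \<sigma>_combination) (use assms t1 in \<open>auto simp: t_def\<close>)
  also have "\<dots> \<le> \<mu> + C / \<mu>" using assms by linarith
  finally have "(t - 1) * (\<mu> - C / \<mu>) \<le> 2 * (C / \<mu>)" unfolding left_diff_distrib mult_1_left by linarith
  moreover have "(t - 1) * (3 / 4 * \<mu>) \<le> (t - 1) * (\<mu> - C / \<mu>)"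
    using t1 \<mu>2 by (intro mult_left_mono) auto
  ultimately have "(t - 1) * (3 / 4 * \<mu>) \<le> 2 * (C / \<mu>)" by linarith
  then have "(t - 1) * (3 / 4 * \<mu>) * \<mu> \<le> 2 * (C / \<mu>) * \<mu>"
    using \<open>\<mu> > 0\<close> by (intro mult_right_mono) auto
  moreover have "2 * (C / \<mu>) * \<mu> = 2 * C" using \<open>\<mu> > 0\<close> by simp
  moreover have "(t - 1) * \<mu>\<^sup>2 = 4 / 3 * ((t - 1) * (3 / 4 * \<mu>) * \<mu>)" by (simp add: power2_eq_square)
  ultimately have tm: "(t - 1) * \<mu>\<^sup>2 \<le> 3 * C" using \<open>C > 0\<close> by linarith
  have t2: "t - 1 \<le> 3 / 4"
  proof -
    have "(t - 1) * \<mu>\<^sup>2 \<le> 3 / 4 * \<mu>\<^sup>2" using tm assms by linarith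
    then show ?thesis using \<open>\<mu> > 0\<close> by simp
  qed
  have D: "D > 0"
  proof -
    have "0 < D * \<mu>\<^sup>2" using \<open>R > 0\<close> \<open>R\<^sup>2 \<le> D * \<mu>\<^sup>2\<close> by (meson less_le_trans zero_less_power)
    then show ?thesis using \<open>\<mu> > 0\<close> by (simp add: zero_less_mult_iff)
  qed
  have tR: "(t - 1) * R\<^sup>2 \<le> 3 * C * D"
  proof -
    have "(t - 1) * R\<^sup>2 \<le> (t - 1) * (D * \<mu>\<^sup>2)" using t1 assms by (intro mult_left_mono) auto
    also have "\<dots> = D * ((t - 1) * \<mu>\<^sup>2)" by simp
    also have "\<dots> \<le> D * (3 * C)" using tm D by (intro mult_left_mono) auto
    finally show ?thesis by (simp add: mult_ac)
  qed
  have abd: "a * b * d \<le> 9 * C * D"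
  proof -
    have "R\<^sup>2 = t\<^sup>2 * R\<^sup>2 - a * b * d"
      using norm_sq_combination[OF assms(2,3), of a b] assms(4) by (simp add: v[symmetric] t_def d_def)
    then have "a * b * d = (t + 1) * ((t - 1) * R\<^sup>2)" by (simp add: algebra_simps power2_eq_square)
    also have "\<dots> \<le> 3 * (3 * C * D)" by (rule mult_mono) (use tR t1 t2 in simp_all)
    finally show ?thesis by simp
  qed
  have sq: "(t - 1)\<^sup>2 * R\<^sup>2 \<le> 3 * C * D"
  proof -
    have "(t - 1) * ((t - 1) * R\<^sup>2) \<le> 1 * ((t - 1) * R\<^sup>2)" using t1 t2 by (intro mult_right_mono) auto
    then show ?thesis using tR by (simp add: power2_eq_square mult.assoc)
  qed
  have d0: "d \<ge> 0" by (simp add: d_def)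
  have CD: "C * D > 0" using D \<open>C > 0\<close> by simp
  \<comment> \<open>The larger coefficient decides which end is close: for \<open>a >= 1/2\<close>
    one has \<open>1 - a <= a\<close>, so the last term of \<open>|v - u|^2\<close> is at most
    \<open>a b d\<close>. In total this is \<open>3 C D + 9 C D\<close>, and 20 leaves room.\<close>
  consider "a \<ge> 1 / 2" | "b \<ge> 1 / 2" using t1 unfolding t_def by linarith
  then show ?thesis
  proof cases
    case 1
    have "v - u = (a - 1) *\<^sub>R u + b *\<^sub>R u'" by (simp add: v algebra_simps)
    then have "(norm (v - u))\<^sup>2 = (t - 1)\<^sup>2 * R\<^sup>2 + (1 - a) * (b * d)"
      using norm_sq_combination[OF assms(2,3), of "a - 1" b] by (simp add: t_def d_def algebra_simps)
    moreover have "(1 - a) * (b * d) \<le> a * (b * d)" using 1 ab d0 by (intro mult_right_mono) auto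
    moreover have "a * (b * d) = a * b * d" by simp
    ultimately have "(norm (v - u))\<^sup>2 \<le> 20 * C * D" using sq abd CD by linarith
    then show ?thesis ..
  next
    case 2
    have "v - u' = a *\<^sub>R u + (b - 1) *\<^sub>R u'" by (simp add: v algebra_simps)
    then have "(norm (v - u'))\<^sup>2 = (t - 1)\<^sup>2 * R\<^sup>2 + (1 - b) * (a * d)"
      using norm_sq_combination[OF assms(2,3), of a "b - 1"] by (simp add: t_def d_def algebra_simps)
    moreover have "(1 - b) * (a * d) \<le> b * (a * d)" using 2 ab d0 by (intro mult_right_mono) auto
    moreover have "b * (a * d) = a * b * d" by simp
    ultimately have "(norm (v - u'))\<^sup>2 \<le> 20 * C * D" using sq abd CD by linarith
    then show ?thesis ..
  qed
qed

text \<open>Here the other end \<open>u'\<close> has a much larger value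
  \<open>g R >= 2 \<mu>\<close>, so hardly any of it can enter \<open>v\<close> without pushing
  \<open>\<sigma> v\<close> off the level: \<open>b R\<close> is at most \<open>4 C / g\<close>. The
  lengths of \<open>v\<close> and \<open>u\<close> being equal, \<open>|1 - a| R <= b R\<close>
  follows, and the two contributions add up to \<open>8 C / g\<close>.\<close>

lemma close_of_between_low:
  assumes "same_cone u u'" "norm u = R" "norm u' = R" "norm v = R" "R > 0"
    and v: "v = a *\<^sub>R u + b *\<^sub>R u'" and ab: "a \<ge> 0" "b \<ge> 0"
    and "\<bar>\<sigma> u - \<mu>\<bar> \<le> C / \<mu>" "\<bar>\<sigma> v - \<mu>\<bar> \<le> C / \<mu>"
    and "\<sigma> u' \<ge> g * R" "g * R \<ge> 2 * \<mu>" "g > 0"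
    and "\<mu> \<ge> 1" "C > 0" "4 * C \<le> \<mu>\<^sup>2"
  shows "norm (v - u) \<le> 8 * C / g"
proof -
  have "R \<le> (a + b) * R"
  proof -
    have "norm v \<le> norm (a *\<^sub>R u) + norm (b *\<^sub>R u')" unfolding v by (rule norm_triangle_ineq)
    then show ?thesis using assms by (simp add: distrib_right)
  qed
  then have t1: "a + b \<ge> 1" using \<open>R > 0\<close> by simp
  have \<mu>2: "C / \<mu> \<le> \<mu> / 4" using assms by (simp add: field_simps power2_eq_square)
  have "a * (\<mu> - C / \<mu>) + b * (g * R) \<le> a * \<sigma> u + b * \<sigma> u'"
    using assms by (intro add_mono mult_left_mono) auto
  also have "\<dots> \<le> \<sigma> v" unfolding v
    by (rule \<sigma>_combination) (use assms t1 in auto)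
  also have "\<dots> \<le> \<mu> + C / \<mu>" using assms by linarith
  finally have main: "a * (\<mu> - C / \<mu>) + b * (g * R) \<le> \<mu> + C / \<mu>" .
  have b1: "b \<le> 1"
  proof (rule ccontr)
    assume "\<not> b \<le> 1"
    then have "1 * (g * R) \<le> b * (g * R)" using assms by (intro mult_right_mono) auto
    moreover have "a * (\<mu> - C / \<mu>) \<ge> 0" using ab \<mu>2 \<open>\<mu> \<ge> 1\<close> by (intro mult_nonneg_nonneg) linarith+
    ultimately have "g * R \<le> \<mu> + C / \<mu>" using main by linarith
    then show False using assms \<mu>2 by linarith
  qed
  have "(1 - b) * (\<mu> - C / \<mu>) \<le> a * (\<mu> - C / \<mu>)"
    using t1 \<mu>2 \<open>\<mu> \<ge> 1\<close> by (intro mult_right_mono) linarith+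
  then have "(1 - b) * (\<mu> - C / \<mu>) + b * (g * R) \<le> \<mu> + C / \<mu>" using main by linarith
  then have "b * (g * R - (\<mu> - C / \<mu>)) \<le> 2 * (C / \<mu>)"
    unfolding left_diff_distrib right_diff_distrib mult_1_left by linarith
  moreover have "C / \<mu> \<ge> 0" "C / \<mu> \<le> C" using assms by (simp_all add: field_simps)
  moreover from this have "b * (g * R / 2) \<le> b * (g * R - (\<mu> - C / \<mu>))"
    using ab \<open>g * R \<ge> 2 * \<mu>\<close> by (intro mult_left_mono) linarith+
  ultimately have "b * (g * R / 2) \<le> 2 * C" by linarith
  then have bR: "b * R \<le> 4 * C / g" using assms by (simp add: field_simps)
  have 1: "norm (v - a *\<^sub>R u) = b * R" using assms by simp
  have "\<bar>norm v - norm (a *\<^sub>R u)\<bar> \<le> norm (v - a *\<^sub>R u)" by (rule norm_triangle_ineq3)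
  then have "\<bar>R - a * R\<bar> \<le> b * R" using 1 assms by simp
  moreover have "norm ((a - 1) *\<^sub>R u) = \<bar>R - a * R\<bar>"
  proof -
    have "R - a * R = (1 - a) * R" by (simp add: left_diff_distrib)
    then have "\<bar>R - a * R\<bar> = \<bar>1 - a\<bar> * R" using \<open>R > 0\<close> by (simp add: abs_mult)
    then show ?thesis using assms(2) by (simp add: abs_minus_commute)
  qed
  ultimately have 2: "norm ((a - 1) *\<^sub>R u) \<le> b * R" by simp
  have "v - u = (v - a *\<^sub>R u) + (a - 1) *\<^sub>R u" by (simp add: algebra_simps)
  then have "norm (v - u) \<le> norm (v - a *\<^sub>R u) + norm ((a - 1) *\<^sub>R u)"
    by (metis norm_triangle_ineq)
  moreover have "8 * C / g = 2 * (4 * C / g)" by simp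
  ultimately show ?thesis using 1 2 bR by linarith
qed

text \<open>By Lagrange's identity parallel vectors of equal length agree up to sign; the common
  sign of the products with \<open>z\<close> excludes \<open>u = - v\<close>.\<close>

lemma eq_of_cross2_eq_0:
  assumes "cross2 u v = 0" "norm u = norm v" "inner u z * inner v z > 0"
  shows "u = v"
proof -
  have "(inner u v)\<^sup>2 + (cross2 u v)\<^sup>2 = inner u u * inner v v"
    by (simp add: inner_prod2 cross2_def power2_eq_square algebra_simps)
  moreover have uv: "inner v v = inner u u" using assms(2) by (simp add: norm_eq_sqrt_inner)
  ultimately have "(inner u v)\<^sup>2 = (inner u u)\<^sup>2" using assms(1) by (simp add: power2_eq_square)
  then consider "inner u v = inner u u" | "inner u v = - inner u u" by (auto simp: power2_eq_iff)
  then show ?thesis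
  proof cases
    case 1
    then have "inner (u - v) (u - v) = 0" using uv by (simp add: inner_diff_left inner_diff_right inner_commute)
    then show ?thesis by simp
  next
    case 2
    then have "inner (u + v) (u + v) = 0" using uv by (simp add: inner_add_left inner_add_right inner_commute)
    then have "u = - v" by (simp add: add_eq_0_iff)
    then show ?thesis using assms(3) by (simp add: zero_less_mult_iff)
  qed
qed

text \<open>The tolerance \<open>C / \<mu>\<close> is what an energy error of order
  \<open>S^2\<close> becomes after passing to \<open>S^(-1/2)\<close>.\<close>

definition near_level :: "real \<Rightarrow> real \<Rightarrow> real \<Rightarrow> real \<times> real \<Rightarrow> bool" where
  "near_level C R \<mu> u \<longleftrightarrow> regular u \<and> norm u = R \<and> \<bar>\<sigma> u - \<mu>\<bar> \<le> C / \<mu>"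

text \<open>Vectors of one cone are linearly ordered by angle, so one of the three lies between the
  other two and \<open>close_of_between_mid\<close> applies to it.\<close>

lemma three_close:
  assumes "near_level C R \<mu> a" "near_level C R \<mu> b" "near_level C R \<mu> c"
    and "same_cone a b" "same_cone b c" "same_cone a c"
    and "R > 0" "\<mu> > 0" "C > 0" "4 * C \<le> \<mu>\<^sup>2" "R\<^sup>2 \<le> D * \<mu>\<^sup>2"
  shows "(norm (a - b))\<^sup>2 \<le> 20 * C * D \<or> (norm (b - c))\<^sup>2 \<le> 20 * C * D \<or> (norm (a - c))\<^sup>2 \<le> 20 * C * D"
proof -
  obtain m where m: "m \<in> \<Lambda>" using poles_nonempty by auto
  define z where "z = rvec m"
  \<comment> \<open>The slope relative to one pole direction \<open>z\<close>. Its denominator keeps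
    its sign on a cone, so comparing slopes is the same as taking the sign of \<open>cross2\<close>;
    this makes the angular order transitive.\<close>
  define t where "t u = inner u (- snd z, fst z) / inner u z" for u
  have cr: "cross2 u v * inner z z = (inner u z * inner v z) * (t v - t u)"
    if "same_cone u v" for u v
  proof -
    have "inner u z \<noteq> 0" "inner v z \<noteq> 0"
      using same_coneD[OF that] m by (auto simp: regular_def z_def)
    then have "(inner u z * inner v z) * (t v - t u) =
        inner u z * inner v (- snd z, fst z) - inner v z * inner u (- snd z, fst z)"
      by (simp add: t_def field_simps)
    then show ?thesis by (simp add: inner_prod2 cross2_def algebra_simps)
  qed
  have z: "inner z z > 0"
    using assms(1) m by (auto simp: near_level_def regular_def z_def)
  have D: "D > 0"
  proof -
    have "0 < D * \<mu>\<^sup>2" using \<open>R > 0\<close> \<open>R\<^sup>2 \<le> D * \<mu>\<^sup>2\<close> by (meson less_le_trans zero_less_power)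
    then show ?thesis using \<open>\<mu> > 0\<close> by (simp add: zero_less_mult_iff)
  qed
  have sc: "inner u z * inner v z > 0" if "same_cone u v" for u v
    using that m by (auto simp: same_cone_def z_def)
  have sgn: "cross2 u v \<ge> 0 \<longleftrightarrow> t u \<le> t v" if "same_cone u v" for u v
  proof -
    have "cross2 u v \<ge> 0 \<longleftrightarrow> cross2 u v * inner z z \<ge> 0"
      by (subst zero_le_mult_iff) (use z in linarith)
    also have "\<dots> \<longleftrightarrow> t v - t u \<ge> 0"
      unfolding cr[OF that] by (rule zero_le_mult_iff[THEN trans]) (use sc[OF that] in linarith)
    finally show ?thesis by simp
  qed
  have mid: "(norm (v - u))\<^sup>2 \<le> 20 * C * D \<or> (norm (v - u'))\<^sup>2 \<le> 20 * C * D"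
    if lv: "near_level C R \<mu> u" "near_level C R \<mu> v" "near_level C R \<mu> u'"
      and cn: "same_cone u v" "same_cone v u'" "same_cone u u'" and ord: "t u \<le> t v" "t v \<le> t u'"
    for u v u'
  \<comment> \<open>If the outer vectors are parallel, they are no basis; but then all slopes agree
    and \<open>v\<close> coincides with \<open>u\<close>.\<close>
  proof (cases "cross2 u u' = 0")
    case True
    then have "t u = t u'" using cr[OF cn(3)] sc[OF cn(3)] by auto
    then have "cross2 u v = 0" using cr[OF cn(1)] ord z by auto
    then have "u = v" using eq_of_cross2_eq_0 lv sc[OF cn(1)] by (auto simp: near_level_def)
    then show ?thesis using D \<open>C > 0\<close> by simp
  next
    case False
    then have pos: "cross2 u u' > 0" using sgn[OF cn(3)] ord by linarith
    define \<alpha> \<beta> where "\<alpha> = cross2 v u' / cross2 u u'" and "\<beta> = cross2 u v / cross2 u u'"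
    have "v = \<alpha> *\<^sub>R u + \<beta> *\<^sub>R u'"
    proof -
      have "cross2 u u' *\<^sub>R v = cross2 u u' *\<^sub>R (\<alpha> *\<^sub>R u + \<beta> *\<^sub>R u')"
        using pos by (subst cross2_expansion) (simp add: \<alpha>_def \<beta>_def scaleR_add_right)
      then show ?thesis using pos by (metis less_irrefl scaleR_cancel_left)
    qed
    moreover have "\<alpha> \<ge> 0" "\<beta> \<ge> 0"
      using pos sgn[OF cn(1)] sgn[OF cn(2)] ord by (auto simp: \<alpha>_def \<beta>_def)
    ultimately show ?thesis
      using close_of_between_mid[of u u' R v \<alpha> \<beta> \<mu> C D] lv cn assms by (auto simp: near_level_def)
  qed
  note sym = assms(4-6)[THEN same_cone_sym]
  consider "t a \<le> t b" "t b \<le> t c" | "t a \<le> t c" "t c \<le> t b" | "t b \<le> t a" "t a \<le> t c"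
    | "t b \<le> t c" "t c \<le> t a" | "t c \<le> t a" "t a \<le> t b" | "t c \<le> t b" "t b \<le> t a" by linarith
  then show ?thesis
  proof cases
    case 1 with mid[OF assms(1,2,3,4,5,6)] show ?thesis by (auto simp: norm_minus_commute)
  next
    case 2 with mid[OF assms(1,3,2,6) sym(2) assms(4)] show ?thesis by (auto simp: norm_minus_commute)
  next
    case 3 with mid[OF assms(2,1,3) sym(1) assms(6,5)] show ?thesis by (auto simp: norm_minus_commute)
  next
    case 4 with mid[OF assms(2,3,1,5) sym(3) sym(1)] show ?thesis by (auto simp: norm_minus_commute)
  next
    case 5 with mid[OF assms(3,1,2) sym(3) assms(4) sym(2)] show ?thesis by (auto simp: norm_minus_commute)
  next
    case 6 with mid[OF assms(3,2,1) sym(2) sym(1) sym(3)] show ?thesis by (auto simp: norm_minus_commute)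
  qed
qed

text \<open>For \<open>a\<close> and \<open>b\<close> on the same side of the reference vector
  \<open>u\<close>, one of them lies between the other and \<open>u\<close>, so that
  \<open>close_of_between_low\<close> applies with \<open>u\<close> as the high end.\<close>

lemma two_close:
  assumes "near_level C R \<mu> a" "near_level C R \<mu> b" "norm u = R" "\<sigma> u = g * R"
    and "same_cone a b" "same_cone a u" "same_cone b u" "cross2 a u * cross2 b u > 0"
    and "R > 0" "\<mu> \<ge> 1" "C > 0" "4 * C \<le> \<mu>\<^sup>2" "g * R \<ge> 2 * \<mu>" "g > 0"
  shows "norm (a - b) \<le> 8 * C / g"
proof -
  have main: "norm (q - p) \<le> 8 * C / g"
    if lv: "near_level C R \<mu> p" "near_level C R \<mu> q" and cn: "same_cone p u"
      and cr: "cross2 p u * cross2 q u > 0" "cross2 p q * cross2 p u \<ge> 0" for p q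
  proof -
    define \<alpha> \<beta> where "\<alpha> = cross2 q u / cross2 p u" and "\<beta> = cross2 p q / cross2 p u"
    have n0: "cross2 p u \<noteq> 0" using cr by auto
    have "q = \<alpha> *\<^sub>R p + \<beta> *\<^sub>R u"
    proof -
      have "cross2 p u *\<^sub>R q = cross2 p u *\<^sub>R (\<alpha> *\<^sub>R p + \<beta> *\<^sub>R u)"
        using n0 by (subst cross2_expansion) (simp add: \<alpha>_def \<beta>_def scaleR_add_right)
      then show ?thesis using n0 by (metis scaleR_cancel_left)
    qed
    moreover have "\<alpha> \<ge> 0" "\<beta> \<ge> 0"
      using cr n0 by (auto simp: \<alpha>_def \<beta>_def zero_le_divide_iff zero_less_mult_iff zero_le_mult_iff)
    ultimately show ?thesis
      using close_of_between_low[of p u R q \<alpha> \<beta> \<mu> C g] lv cn assms by (auto simp: near_level_def)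
  qed
  have anti: "cross2 b a = - cross2 a b" by (simp add: cross2_def)
  show ?thesis
  proof (cases "cross2 a b * cross2 a u \<ge> 0")
    case True
    then show ?thesis using main[of a b] assms by (simp add: norm_minus_commute)
  next
    case False
    then have "cross2 b a * cross2 b u \<ge> 0"
    proof -
      have "(cross2 a b * cross2 a u) * (cross2 a u * cross2 b u) < 0"
        using False assms(8) by (metis mult_neg_pos not_le)
      then have "(cross2 a b * cross2 b u) * (cross2 a u)\<^sup>2 < 0" by (simp add: power2_eq_square mult_ac)
      then have "cross2 a b * cross2 b u < 0" by (metis mult_less_0_iff zero_le_power2 not_le)
      then show ?thesis unfolding anti by simp
    qed
    then show ?thesis using main[of b a] assms by (simp add: mult.commute)
  qed
qed

text \<open>The set \<open>P\<close> of poles with positive product labels a cone. The bound may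
  depend on the cone, through the value \<open>g\<close> at a unit vector in it, but not on
  \<open>R\<close> or \<open>\<mu>\<close>.\<close>

lemma card_near_level_cone:
  assumes "C > 0"
  shows "\<exists>N. \<forall>F R \<mu>. finite F \<longrightarrow> \<mu> \<ge> 1 \<longrightarrow> 4 * C \<le> \<mu>\<^sup>2 \<longrightarrow>
    (\<forall>n\<in>F. near_level C R \<mu> (rvec n) \<and> {m\<in>\<Lambda>. inner (rvec n) (rvec m) > 0} = P) \<longrightarrow> card F \<le> N"
proof (cases "\<exists>u. regular u \<and> {m\<in>\<Lambda>. inner u (rvec m) > 0} = P")
  case False
  show ?thesis
  proof (intro exI[of _ 0] allI impI)
    fix F :: "(int \<times> int) set" and R \<mu> :: real
    assume "\<forall>n\<in>F. near_level C R \<mu> (rvec n) \<and> {m\<in>\<Lambda>. inner (rvec n) (rvec m) > 0} = P"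
    then have "F = {}" using False unfolding near_level_def by blast
    then show "card F \<le> 0" by simp
  qed
next
  case True
  have cone: "same_cone u v"
    if "regular u" "regular v" "{m\<in>\<Lambda>. inner u (rvec m) > 0} = P" "{m\<in>\<Lambda>. inner v (rvec m) > 0} = P" for u v
    unfolding same_cone_def
  proof
    fix m assume m: "m \<in> \<Lambda>"
    then have "inner u (rvec m) > 0 \<longleftrightarrow> inner v (rvec m) > 0" using that by blast
    then show "inner u (rvec m) * inner v (rvec m) > 0"
      using that m by (auto simp: regular_def zero_less_mult_iff)
  qed
  from True obtain u0 where u0: "regular u0" "{m\<in>\<Lambda>. inner u0 (rvec m) > 0} = P" by auto
  have "u0 \<noteq> 0" using u0 poles_nonempty by (auto simp: regular_def)
  define u1 where "u1 = (1 / norm u0) *\<^sub>R u0"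
  define g where "g = \<sigma> u1"
  have self: "same_cone u0 u0" using u0 by (intro cone) auto
  have u1: "same_cone u1 u0" "norm u1 = 1"
    using \<open>u0 \<noteq> 0\<close> self by (auto simp: u1_def intro!: same_cone_scale)
  have g: "g > 0" using \<sigma>_pos same_coneD(1)[OF u1(1)] by (simp add: g_def)
  \<comment> \<open>In the case \<open>g R < 2 \<mu>\<close> this constant yields the hypothesis
    \<open>R^2 <= D \<mu>^2\<close> of \<open>three_close\<close>.\<close>
  define D where "D = 4 / g\<^sup>2"
  define r1 r2 where "r1 = sqrt (20 * C * D)" and "r2 = 8 * C / g"
  define N1 N2 where "N1 = nat (2 * \<lceil>r1\<rceil> + 1) ^ 2" and "N2 = nat (2 * \<lceil>r2\<rceil> + 1) ^ 2"
  show ?thesis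
  proof (intro exI[of _ "2 * N1 + 2 * N2"] allI impI)
    fix F :: "(int \<times> int) set" and R \<mu> :: real
    assume F: "finite F" "\<mu> \<ge> 1" "4 * C \<le> \<mu>\<^sup>2"
      and P: "\<forall>n\<in>F. near_level C R \<mu> (rvec n) \<and> {m\<in>\<Lambda>. inner (rvec n) (rvec m) > 0} = P"
    have cnF: "same_cone (rvec n) (rvec n')" "same_cone (rvec n) u0" if "n \<in> F" "n' \<in> F" for n n'
      using cone u0 P that by (auto simp: near_level_def)
    show "card F \<le> 2 * N1 + 2 * N2"
    proof (cases "F = {}")
      case True then show ?thesis by simp
    next
      case False
      then obtain a where a: "a \<in> F" by auto
      have "rvec a \<noteq> 0" using P a poles_nonempty by (auto simp: near_level_def regular_def)
      then have R: "R > 0" using P a by (auto simp: near_level_def)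
      show ?thesis
      proof (cases "g * R \<ge> 2 * \<mu>")
        case True
        define u where "u = R *\<^sub>R u1"
        have u: "norm u = R" "\<sigma> u = g * R" "same_cone u u0"
          using u1 R by (auto simp: u_def g_def \<sigma>_scale same_cone_scale)
        have cu: "same_cone (rvec n) u" if "n \<in> F" for n
          unfolding same_cone_def
        proof
          fix m assume "m \<in> \<Lambda>"
          then have "inner (rvec n) (rvec m) * inner u0 (rvec m) > 0" "inner u (rvec m) * inner u0 (rvec m) > 0"
            using cnF(2)[OF that that] u(3) by (auto simp: same_cone_def)
          then show "inner (rvec n) (rvec m) * inner u (rvec m) > 0"
            by (auto simp: zero_less_mult_iff)
        qed
        \<comment> \<open>A point on the ray of \<open>u\<close> would equal \<open>u\<close>, where
          the value \<open>g R >= 2 \<mu>\<close> is outside the tolerance. Hence the ray splits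
          \<open>F\<close> into two sides, each of diameter at most \<open>r2\<close>.\<close>
        have nz: "cross2 (rvec n) u \<noteq> 0" if n: "n \<in> F" for n
        proof
          assume "cross2 (rvec n) u = 0"
          moreover obtain m where "m \<in> \<Lambda>" using poles_nonempty by auto
          ultimately have "rvec n = u"
            using eq_of_cross2_eq_0[of "rvec n" u "rvec m"] cu[OF n] P n u(1)
            by (auto simp: near_level_def same_cone_def)
          then have "\<bar>g * R - \<mu>\<bar> \<le> C / \<mu>" using P n u by (auto simp: near_level_def)
          moreover have "C / \<mu> \<le> \<mu> / 4" using F by (simp add: field_simps power2_eq_square)
          ultimately show False using True F by linarith
        qed
        have half: "card {n\<in>F. e * cross2 (rvec n) u > 0} \<le> N2" for e
        proof (cases "{n\<in>F. e * cross2 (rvec n) u > 0} = {}")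
          case True then show ?thesis by (metis card.empty le0)
        next
          case False
          then obtain b where b: "b \<in> F" "e * cross2 (rvec b) u > 0" by auto
          have "norm (rvec n - rvec b) \<le> r2" if "n \<in> F" "e * cross2 (rvec n) u > 0" for n
            unfolding r2_def
          proof (rule two_close[where R = R and \<mu> = \<mu> and u = u])
            show "0 < cross2 (rvec n) u * cross2 (rvec b) u"
              using that b by (auto simp: zero_less_mult_iff)
          qed (use that b P u cu cnF R F g True assms in auto)
          then show ?thesis unfolding N2_def using F by (intro card_lattice_near) auto
        qed
        have "F = {n\<in>F. 1 * cross2 (rvec n) u > 0} \<union> {n\<in>F. (-1) * cross2 (rvec n) u > 0}"
          using nz by (auto simp: neq_iff)
        then have "card F \<le> card {n\<in>F. 1 * cross2 (rvec n) u > 0} + card {n\<in>F. (-1) * cross2 (rvec n) u > 0}"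
          by (metis (lifting) card_Un_le)
        then show ?thesis using half[of 1] half[of "-1"] by linarith
      next
        case False
        have "(g * R)\<^sup>2 \<le> (2 * \<mu>)\<^sup>2" using False g R by (intro power_mono) auto
        then have RD: "R\<^sup>2 \<le> D * \<mu>\<^sup>2" using g by (simp add: D_def field_simps power_mult_distrib)
        have D: "D > 0" using g by (simp add: D_def)
        have r1: "norm z \<le> r1 \<longleftrightarrow> (norm z)\<^sup>2 \<le> 20 * C * D" for z :: "real \<times> real"
        proof -
          have "20 * C * D = r1\<^sup>2" "r1 \<ge> 0" using D assms by (auto simp: r1_def)
          then show ?thesis by (metis abs_norm_cancel abs_of_nonneg norm_ge_zero power2_le_iff_abs_le)
        qed
        \<comment> \<open>Two clusters suffice: of two points outside \<open>F1\<close> neither is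
          close to \<open>a\<close>, so \<open>three_close\<close> makes them close to each
          other.\<close>
        define F1 where "F1 = {n\<in>F. norm (rvec n - rvec a) \<le> r1}"
        have c1: "card F1 \<le> N1"
          unfolding N1_def F1_def using F by (intro card_lattice_near[where a = a]) auto
        have c2: "card (F - F1) \<le> N1"
        proof (cases "F - F1 = {}")
          case True then show ?thesis by (metis card.empty le0)
        next
          case False
          then obtain b where b: "b \<in> F" "b \<notin> F1" by auto
          have "norm (rvec n - rvec b) \<le> r1" if n: "n \<in> F - F1" for n
          proof -
            have "(norm (rvec n - rvec b))\<^sup>2 \<le> 20 * C * D \<or> (norm (rvec b - rvec a))\<^sup>2 \<le> 20 * C * D \<or>
                (norm (rvec n - rvec a))\<^sup>2 \<le> 20 * C * D"
              by (rule three_close[where R = R and \<mu> = \<mu>]) (use n b a P cnF R F RD assms in auto)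
            then show ?thesis using b n by (auto simp: F1_def r1[symmetric])
          qed
          then show ?thesis unfolding N1_def using F by (intro card_lattice_near) auto
        qed
        have "F1 \<subseteq> F" by (auto simp: F1_def)
        then have "card F = card F1 + card (F - F1)"
          using F(1) by (metis card_Diff_subset card_mono finite_subset le_add_diff_inverse)
        then show ?thesis using c1 c2 by linarith
      qed
    qed
  qed
qed

text \<open>There are finitely many sign patterns of the products with the poles; the constants of
  the corresponding cones are added.\<close>

lemma card_near_level:
  assumes "C > 0"
  shows "\<exists>N. \<forall>F R \<mu>. finite F \<longrightarrow> \<mu> \<ge> 1 \<longrightarrow> 4 * C \<le> \<mu>\<^sup>2 \<longrightarrow>
    (\<forall>n\<in>F. near_level C R \<mu> (rvec n)) \<longrightarrow> card F \<le> N"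
proof -
  define Q where "Q P N \<longleftrightarrow> (\<forall>F R \<mu>. finite F \<longrightarrow> \<mu> \<ge> 1 \<longrightarrow> 4 * C \<le> \<mu>\<^sup>2 \<longrightarrow>
    (\<forall>n\<in>F. near_level C R \<mu> (rvec n) \<and> {m\<in>\<Lambda>. inner (rvec n) (rvec m) > 0} = P) \<longrightarrow> card F \<le> N)" for P N
  have "\<forall>P. \<exists>N. Q P N" unfolding Q_def by (rule allI) (rule card_near_level_cone[OF assms])
  then have "\<exists>N. \<forall>P. Q P (N P)" by (rule choice)
  then obtain N where "\<forall>P. Q P (N P)" by blast
  have N: "card F \<le> N P" if "finite F" "\<mu> \<ge> 1" "4 * C \<le> \<mu>\<^sup>2"
    "\<forall>n\<in>F. near_level C R \<mu> (rvec n) \<and> {m\<in>\<Lambda>. inner (rvec n) (rvec m) > 0} = P" for P F R \<mu>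
  proof -
    have "Q P (N P)" using \<open>\<forall>P. Q P (N P)\<close> by (rule spec)
    then have "\<forall>F R \<mu>. finite F \<longrightarrow> \<mu> \<ge> 1 \<longrightarrow> 4 * C \<le> \<mu>\<^sup>2 \<longrightarrow>
      (\<forall>n\<in>F. near_level C R \<mu> (rvec n) \<and> {m\<in>\<Lambda>. inner (rvec n) (rvec m) > 0} = P) \<longrightarrow> card F \<le> N P"
      by (simp only: Q_def)
    from this[THEN spec, THEN spec, THEN spec, THEN mp, THEN mp, THEN mp, THEN mp, OF that]
    show ?thesis .
  qed
  define M where "M = sum N (Pow \<Lambda>)"
  have "\<forall>F R \<mu>. finite F \<longrightarrow> \<mu> \<ge> 1 \<longrightarrow> 4 * C \<le> \<mu>\<^sup>2 \<longrightarrow>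
    (\<forall>n\<in>F. near_level C R \<mu> (rvec n)) \<longrightarrow> card F \<le> M"
  proof (intro allI impI)
    fix F :: "(int \<times> int) set" and R \<mu> :: real
    assume F: "finite F" "\<mu> \<ge> 1" "4 * C \<le> \<mu>\<^sup>2" and l: "\<forall>n\<in>F. near_level C R \<mu> (rvec n)"
    let ?G = "\<lambda>P. {n\<in>F. {m\<in>\<Lambda>. inner (rvec n) (rvec m) > 0} = P}"
    have "F \<subseteq> (\<Union>P\<in>Pow \<Lambda>. ?G P)"
    proof
      fix n assume "n \<in> F"
      then have "n \<in> ?G {m\<in>\<Lambda>. inner (rvec n) (rvec m) > 0}" by simp
      moreover have "{m\<in>\<Lambda>. inner (rvec n) (rvec m) > 0} \<in> Pow \<Lambda>" by blast
      ultimately show "n \<in> (\<Union>P\<in>Pow \<Lambda>. ?G P)" by (rule UN_I[rotated])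
    qed
    moreover have "finite (\<Union>P\<in>Pow \<Lambda>. ?G P)" using F(1) finite_poles by simp
    ultimately have "card F \<le> card (\<Union>P\<in>Pow \<Lambda>. ?G P)" by (rule card_mono[rotated])
    also have "\<dots> \<le> (\<Sum>P\<in>Pow \<Lambda>. card (?G P))" by (rule card_UN_le) (simp add: finite_poles)
    also have "\<dots> \<le> (\<Sum>P\<in>Pow \<Lambda>. N P)"
    proof (rule sum_mono)
      fix P assume "P \<in> Pow \<Lambda>"
      show "card (?G P) \<le> N P"
      proof (rule N)
        show "finite (?G P)" using F(1) by simp
        show "\<mu> \<ge> 1" "4 * C \<le> \<mu>\<^sup>2" using F by simp_all
        show "\<forall>n\<in>?G P. near_level C R \<mu> (rvec n) \<and> {m\<in>\<Lambda>. inner (rvec n) (rvec m) > 0} = P"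
          using l by blast
      qed
    qed
    finally show "card F \<le> M" by (simp add: M_def)
  qed
  then show ?thesis by (rule exI)
qed

section \<open>From prescribed energies to a circle and a level\<close>

definition near_energy :: "real \<Rightarrow> real \<Rightarrow> real \<Rightarrow> int \<times> int \<Rightarrow> bool" where
  "near_energy C \<epsilon> E n \<longleftrightarrow> regular (rvec n) \<and> S (rvec n) \<le> \<epsilon> \<and>
     \<bar>E - (norm (rvec n))\<^sup>2 - S (rvec n)\<bar> \<le> C * (S (rvec n))\<^sup>2"

lemma card_near_energy:
  assumes "C > 0"
  shows "\<exists>\<epsilon>>0. \<exists>N. \<forall>F E. finite F \<longrightarrow>
    (\<forall>n\<in>F. near_energy C \<epsilon> E n) \<longrightarrow> card F \<le> N"
proof -
  define C' where "C' = 2 * C"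
  have "C' > 0" using assms by (simp add: C'_def)
  from card_near_level[OF this] obtain N where N: "\<forall>F R \<mu>. finite F \<longrightarrow> \<mu> \<ge> 1 \<longrightarrow> 4 * C' \<le> \<mu>\<^sup>2 \<longrightarrow>
    (\<forall>n\<in>F. near_level C' R \<mu> (rvec n)) \<longrightarrow> card F \<le> N"
    by blast
  \<comment> \<open>The bound \<open>1 / 8\<close> keeps the integers \<open>|n|^2\<close> less than
    1 apart, so that all points lie on one circle; \<open>1 / (16 C)\<close> turns the tolerance
    into \<open>S / 16\<close> and makes \<open>E - |n|^2\<close> comparable to
    \<open>S\<close>.\<close>
  define \<epsilon> where "\<epsilon> = min (1 / 8) (1 / (16 * C))"
  have \<epsilon>: "\<epsilon> > 0" "\<epsilon> \<le> 1 / 8" "C * \<epsilon> \<le> 1 / 16"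
    using assms by (auto simp: \<epsilon>_def min_def field_simps)
  show ?thesis
  proof (intro exI[of _ \<epsilon>] conjI exI[of _ N] allI impI)
    fix F :: "(int \<times> int) set" and E :: real
    assume F: "finite F" and "\<forall>n\<in>F. near_energy C \<epsilon> E n"
    then have h: "\<forall>n\<in>F. regular (rvec n) \<and> S (rvec n) \<le> \<epsilon> \<and>
       \<bar>E - (norm (rvec n))\<^sup>2 - S (rvec n)\<bar> \<le> C * (S (rvec n))\<^sup>2" by (simp only: near_energy_def)
    have est: "0 < S (rvec n)" "S (rvec n) \<le> \<epsilon>" "\<bar>E - (norm (rvec n))\<^sup>2 - S (rvec n)\<bar> \<le> S (rvec n) / 16"
      if n: "n \<in> F" for n
    proof -
      show 1: "0 < S (rvec n)" "S (rvec n) \<le> \<epsilon>" using h n S_pos by auto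
      have "C * S (rvec n) \<le> C * \<epsilon>" using 1 assms by (intro mult_left_mono) auto
      then have "C * S (rvec n) * S (rvec n) \<le> 1 / 16 * S (rvec n)"
        using 1 \<epsilon> by (intro mult_right_mono) auto
      then show "\<bar>E - (norm (rvec n))\<^sup>2 - S (rvec n)\<bar> \<le> S (rvec n) / 16"
        using h n by (force simp: power2_eq_square)
    qed
    show "card F \<le> N"
    proof (cases "F = {}")
      case True then show ?thesis by simp
    next
      case False
      then obtain a where a: "a \<in> F" by auto
      define e where "e = E - (norm (rvec a))\<^sup>2"
      have sq: "(norm (rvec n))\<^sup>2 = real_of_int ((fst n)\<^sup>2 + (snd n)\<^sup>2)" for n
        unfolding power2_norm_eq_inner inner_prod2 rvec_def by (simp add: power2_eq_square)
      have same: "(norm (rvec n))\<^sup>2 = (norm (rvec a))\<^sup>2" if n: "n \<in> F" for n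
      proof -
        have "\<bar>(norm (rvec n))\<^sup>2 - (norm (rvec a))\<^sup>2\<bar> < 1"
          using est[OF n] est[OF a] \<epsilon>(2) by linarith
        then have "\<bar>((fst n)\<^sup>2 + (snd n)\<^sup>2) - ((fst a)\<^sup>2 + (snd a)\<^sup>2)\<bar> < 1"
          unfolding sq by (simp only: of_int_diff[symmetric] of_int_abs[symmetric] of_int_less_1_iff)
        then show ?thesis unfolding sq by simp
      qed
      have e: "e > 0" "e \<le> 17 / 16 * \<epsilon>" using est[OF a] unfolding e_def by linarith+
      define \<mu> where "\<mu> = 1 / sqrt e"
      have \<mu>2: "\<mu>\<^sup>2 = 1 / e" "\<mu> > 0" using e by (auto simp: \<mu>_def power_divide)
      have "near_level C' (norm (rvec a)) \<mu> (rvec n)" if n: "n \<in> F" for n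
        unfolding near_level_def
      proof (intro conjI)
        show "regular (rvec n)" using h n by auto
        show "norm (rvec n) = norm (rvec a)" using same[OF n] by simp
        define s where "s = S (rvec n)"
        have s: "s > 0" "\<bar>e - s\<bar> \<le> C * s\<^sup>2" "\<bar>e - s\<bar> \<le> s / 16"
          using est[OF n] h n same[OF n] by (auto simp: s_def e_def)
        define p q where "p = sqrt s" and "q = sqrt e"
        have pq: "p > 0" "q > 0" "s = p\<^sup>2" "e = q\<^sup>2" using s e by (auto simp: p_def q_def)
        have se: "s \<le> 2 * e" using s by linarith
        \<comment> \<open>Since \<open>e\<close> and \<open>s\<close> are comparable and differ by
          O(s^2), their inverse square roots differ by O(sqrt e), and \<open>sqrt e\<close> is
          \<open>1 / \<mu>\<close>. The factor 2 in \<open>C'\<close> comes from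
          \<open>s <= 2 e\<close>.\<close>
        have "\<bar>1 / p - 1 / q\<bar> = \<bar>e - s\<bar> / (p * q * (p + q))"
        proof -
          have "e - s = (q - p) * (p + q)" using pq by (simp add: power2_eq_square algebra_simps)
          then have "(e - s) / (p * q * (p + q)) = (q - p) / (p * q)" using pq by simp
          also have "\<dots> = 1 / p - 1 / q" using pq by (simp add: field_simps)
          finally have "1 / p - 1 / q = (e - s) / (p * q * (p + q))" by simp
          then show ?thesis using pq by simp
        qed
        also have "\<dots> \<le> C * s\<^sup>2 / (p * q * p)"
          using pq s assms by (intro frac_le) auto
        also have "\<dots> = C * s / q" using pq by (simp add: power2_eq_square)
        also have "\<dots> \<le> C * (2 * e) / q" using se pq assms by (intro divide_right_mono mult_left_mono) auto
        also have "\<dots> = C' / \<mu>" using pq e by (simp add: C'_def \<mu>_def q_def[symmetric] power2_eq_square)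
        finally show "\<bar>\<sigma> (rvec n) - \<mu>\<bar> \<le> C' / \<mu>"
          by (simp add: \<sigma>_def \<mu>_def p_def q_def s_def)
      qed
      moreover have "\<mu> \<ge> 1"
      proof -
        have "e \<le> 1" using e \<epsilon> by linarith
        then show ?thesis using e by (simp add: \<mu>_def)
      qed
      moreover have "4 * C' \<le> \<mu>\<^sup>2"
      proof -
        have "C * e \<le> C * (17 / 16 * \<epsilon>)" using e assms by (intro mult_left_mono) auto
        then have "8 * (C * e) \<le> 1" using \<epsilon> by linarith
        then show ?thesis using e by (simp add: \<mu>2 C'_def field_simps)
      qed
      ultimately show ?thesis using N[rule_format, OF F] by blast
    qed
  qed (use \<epsilon> in auto)
qed

end

section \<open>Quasimodes\<close>

definition idot :: "int \<times> int \<Rightarrow> int \<times> int \<Rightarrow> int" where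
  "idot m n = fst m * fst n + snd m * snd n"

lemma inner_rvec: "inner (rvec m) (rvec n) = of_int (idot m n)"
  by (simp add: inner_prod2 rvec_def idot_def)

lemma norm_rvec_sq: "(norm (rvec n))\<^sup>2 = of_int (idot n n)"
  by (simp add: power2_norm_eq_inner inner_rvec)

lemma idot_commute: "idot m n = idot n m"
  by (simp add: idot_def)

lemma idot_add: "idot (m + m') n = idot m n + idot m' n" "idot n (m + m') = idot n m + idot n m'"
  by (simp_all add: idot_def algebra_simps)

lemma idot_minus: "idot (- m) n = - idot m n" "idot n (- m) = - idot n m"
  by (simp_all add: idot_def)

lemma idot_zero [simp]: "idot 0 n = 0" "idot n 0 = 0"
  by (simp_all add: idot_def)

lemma idot_self_pos: "m \<noteq> 0 \<Longrightarrow> idot m m > 0"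
  by (cases m) (simp add: idot_def zero_prod_def, metis add_nonneg_eq_0_iff linorder_neqE_linordered_idom
      mult_eq_0_iff not_square_less_zero zero_le_square add_nonneg_nonneg leD)

section \<open>Calculus of trigonometric polynomials\<close>

definition mode :: "int \<times> int \<Rightarrow> real \<times> real \<Rightarrow> complex" where
  "mode n z = cis (of_int (fst n) * fst z + of_int (snd n) * snd z)"

lemma mode_add: "mode (m + n) z = mode m z * mode n z"
  by (simp add: mode_def cis_mult algebra_simps)

lemma mode_zero [simp]: "mode 0 z = 1"
  by (simp add: mode_def)

lemma norm_mode [simp]: "cmod (mode n z) = 1"
  by (simp add: mode_def)

lemma continuous_mode [continuous_intros]: "continuous_on A (mode n)"
  unfolding mode_def by (intro continuous_intros)

text \<open>A trigonometric polynomial is represented by a list of pairs (coefficient, frequency);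
  frequencies may repeat.\<close>

type_synonym trig = "(complex \<times> (int \<times> int)) list"

definition ev :: "trig \<Rightarrow> real \<times> real \<Rightarrow> complex" where
  "ev xs z = (\<Sum>(a, m)\<leftarrow>xs. a * mode m z)"

text \<open>Dominates the sum of the moduli of the Fourier coefficients, with equality if no
  frequency is repeated; in particular it dominates the sup norm.\<close>

definition coeff_norm :: "trig \<Rightarrow> real" where
  "coeff_norm xs = (\<Sum>(a, m)\<leftarrow>xs. cmod a)"

definition zero_mode :: "trig \<Rightarrow> complex" where
  "zero_mode xs = (\<Sum>(a, m)\<leftarrow>xs. if m = 0 then a else 0)"

definition dx :: "trig \<Rightarrow> trig" where
  "dx = map (\<lambda>(a, m). (\<i> * of_int (fst m) * a, m))"

definition dy :: "trig \<Rightarrow> trig" where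
  "dy = map (\<lambda>(a, m). (\<i> * of_int (snd m) * a, m))"

definition tneg :: "trig \<Rightarrow> trig" where
  "tneg = map (\<lambda>(a, m). (- a, m))"

text \<open>The scalar product of the two gradients; the minus sign is the square of the imaginary
  unit.\<close>

definition grad_prod :: "trig \<Rightarrow> trig \<Rightarrow> trig" where
  "grad_prod xs ys = concat (map (\<lambda>(a, m). map (\<lambda>(b, l). (- of_int (idot m l) * a * b, m + l)) ys) xs)"

text \<open>This is \<open>|n + m|^2 - |n|^2\<close>, the small divisor of perturbation
  theory.\<close>

definition symb :: "int \<times> int \<Rightarrow> int \<times> int \<Rightarrow> int" where
  "symb n m = 2 * idot n m + idot m m"

text \<open>The operator Laplace + \<open>|n|^2\<close> conjugated by the plane wave
  \<open>mode n\<close>.\<close>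

definition transport :: "int \<times> int \<Rightarrow> trig \<Rightarrow> real \<times> real \<Rightarrow> complex" where
  "transport n xs z = 2 * \<i> * (of_int (fst n) * ev (dx xs) z + of_int (snd n) * ev (dy xs) z)
    + ev (dx (dx xs)) z + ev (dy (dy xs)) z"

text \<open>Inverse of \<open>- transport n\<close> on trigonometric polynomials without zero mode.\<close>

definition trans_inv :: "int \<times> int \<Rightarrow> trig \<Rightarrow> trig" where
  "trans_inv n = map (\<lambda>(a, m). (if m = 0 then 0 else a / of_int (symb n m), m))"

lemma ev_simps [simp]: "ev [] z = 0" "ev (p # xs) z = fst p * mode (snd p) z + ev xs z"
  "ev (xs @ ys) z = ev xs z + ev ys z"
  by (simp_all add: ev_def case_prod_unfold)

lemma coeff_norm_simps [simp]: "coeff_norm [] = 0" "coeff_norm (p # xs) = cmod (fst p) + coeff_norm xs"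
  "coeff_norm (xs @ ys) = coeff_norm xs + coeff_norm ys"
  by (simp_all add: coeff_norm_def case_prod_unfold)

lemma zero_mode_simps [simp]: "zero_mode [] = 0"
  "zero_mode (p # xs) = (if snd p = 0 then fst p else 0) + zero_mode xs"
  "zero_mode (xs @ ys) = zero_mode xs + zero_mode ys"
  by (simp_all add: zero_mode_def case_prod_unfold)

lemma dx_simps [simp]: "dx [] = []" "dx (p # xs) = (\<i> * of_int (fst (snd p)) * fst p, snd p) # dx xs"
  "dx (xs @ ys) = dx xs @ dx ys"
  by (simp_all add: dx_def case_prod_unfold)

lemma dy_simps [simp]: "dy [] = []" "dy (p # xs) = (\<i> * of_int (snd (snd p)) * fst p, snd p) # dy xs"
  "dy (xs @ ys) = dy xs @ dy ys"
  by (simp_all add: dy_def case_prod_unfold)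

lemma trans_inv_simps [simp]: "trans_inv n [] = []"
  "trans_inv n (p # xs) = (if snd p = 0 then 0 else fst p / of_int (symb n (snd p)), snd p) # trans_inv n xs"
  "trans_inv n (xs @ ys) = trans_inv n xs @ trans_inv n ys"
  by (simp_all add: trans_inv_def case_prod_unfold)

lemma grad_prod_simps [simp]: "grad_prod [] ys = []"
  "grad_prod (p # xs) ys = map (\<lambda>(b, l). (- of_int (idot (snd p) l) * fst p * b, snd p + l)) ys @ grad_prod xs ys"
  "grad_prod (xs @ xs') ys = grad_prod xs ys @ grad_prod xs' ys"
  by (simp_all add: grad_prod_def case_prod_unfold)

lemma tneg_simps [simp]: "tneg [] = []" "tneg (p # xs) = (- fst p, snd p) # tneg xs"
  by (simp_all add: tneg_def case_prod_unfold)

lemma ev_tneg [simp]: "ev (tneg xs) z = - ev xs z"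
  by (induction xs) auto

lemma coeff_norm_tneg [simp]: "coeff_norm (tneg xs) = coeff_norm xs"
  by (induction xs) auto

lemma coeff_norm_nonneg [simp]: "coeff_norm xs \<ge> 0"
  by (induction xs) auto

lemma norm_ev_le: "cmod (ev xs z) \<le> coeff_norm xs"
proof (induction xs)
  case (Cons p xs)
  have "cmod (ev (p # xs) z) \<le> cmod (fst p * mode (snd p) z) + cmod (ev xs z)"
    by (simp add: norm_triangle_ineq)
  then show ?case using Cons by (simp add: norm_mult)
qed simp

lemma ev_grad_prod:
  "ev (grad_prod xs ys) z = ev (dx xs) z * ev (dx ys) z + ev (dy xs) z * ev (dy ys) z"
proof (induction xs)
  case (Cons p xs)
  have "ev (map (\<lambda>(b, l). (- of_int (idot (snd p) l) * fst p * b, snd p + l)) ys) z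
      = fst p * mode (snd p) z * (\<i> * of_int (fst (snd p)) * ev (dx ys) z + \<i> * of_int (snd (snd p)) * ev (dy ys) z)"
  proof (induction ys)
    case (Cons q ys)
    have "\<i> * (\<i> * x) = - x" for x by (simp add: mult.assoc[symmetric])
    with Cons show ?case
      by (simp add: case_prod_unfold mode_add idot_def algebra_simps)
  qed simp
  with Cons show ?case by (simp add: algebra_simps)
qed simp

text \<open>\<open>mode m\<close> is an eigenfunction of \<open>transport n\<close> with eigenvalue
  \<open>- symb n m\<close>. Constants lie in the kernel, so the zero mode cannot be inverted and
  remains on the right.\<close>

lemma ev_trans_inv:
  assumes "\<And>a m. (a, m) \<in> set xs \<Longrightarrow> m \<noteq> 0 \<Longrightarrow> symb n m \<noteq> 0"
  shows "transport n (trans_inv n xs) z = zero_mode xs - ev xs z"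
  using assms unfolding transport_def
proof (induction xs)
  case (Cons p xs)
  obtain a m where p: "p = (a, m)" by (cases p)
  have IH: "2 * \<i> * (of_int (fst n) * ev (dx (trans_inv n xs)) z + of_int (snd n) * ev (dy (trans_inv n xs)) z)
    + ev (dx (dx (trans_inv n xs))) z + ev (dy (dy (trans_inv n xs))) z = zero_mode xs - ev xs z"
    using Cons by (metis list.set_intros(2))
  show ?case
  proof (cases "m = 0")
    case True
    then show ?thesis using IH by (simp add: p algebra_simps)
  next
    case False
    define b where "b = a / of_int (symb n m)"
    have ab: "a = of_int (symb n m) * b" using Cons(2)[of a m] False p by (simp add: b_def)
    have ii: "\<i> * (\<i> * x) = - x" for x by (simp add: mult.assoc[symmetric])
    have "2 * \<i> * (of_int (fst n) * (\<i> * of_int (fst m) * b * mode m z) + of_int (snd n) * (\<i> * of_int (snd m) * b * mode m z))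
      + \<i> * of_int (fst m) * (\<i> * of_int (fst m) * b) * mode m z
      + \<i> * of_int (snd m) * (\<i> * of_int (snd m) * b) * mode m z = - (a * mode m z)"
      unfolding ab by (simp add: symb_def idot_def algebra_simps ii)
    then show ?thesis using IH False by (simp add: p b_def[symmetric] algebra_simps)
  qed
qed simp

lemma coeff_norm_grad_prod_le:
  assumes "\<And>a m b l. (a, m) \<in> set xs \<Longrightarrow> (b, l) \<in> set ys \<Longrightarrow> \<bar>real_of_int (idot m l)\<bar> \<le> \<kappa>"
  shows "coeff_norm (grad_prod xs ys) \<le> \<kappa> * coeff_norm xs * coeff_norm ys"
  using assms
proof (induction xs)
  case (Cons p xs)
  have "coeff_norm (map (\<lambda>(b, l). (- of_int (idot (snd p) l) * fst p * b, snd p + l)) ys)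
      \<le> \<kappa> * cmod (fst p) * coeff_norm ys"
    using Cons(2)[of "fst p" "snd p"]
  proof (induction ys)
    case (Cons q ys)
    obtain b l where q: "q = (b, l)" by (cases q)
    have "\<bar>real_of_int (idot (snd p) l)\<bar> \<le> \<kappa>" using Cons(2)[of b l] q by simp
    then have "\<bar>real_of_int (idot (snd p) l)\<bar> * (cmod (fst p) * cmod b) \<le> \<kappa> * (cmod (fst p) * cmod b)"
      by (rule mult_right_mono) simp
    moreover have "coeff_norm (map (\<lambda>(b, l). (- of_int (idot (snd p) l) * fst p * b, snd p + l)) ys)
      \<le> \<kappa> * cmod (fst p) * coeff_norm ys"
      using Cons by (metis list.set_intros(2))
    ultimately show ?case by (simp add: q norm_mult algebra_simps)
  qed simp
  moreover have "coeff_norm (grad_prod xs ys) \<le> \<kappa> * coeff_norm xs * coeff_norm ys"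
    using Cons by (metis list.set_intros(2))
  ultimately show ?case by (simp add: algebra_simps)
qed simp

lemma coeff_norm_trans_inv_le:
  assumes "Y > 0" "\<And>a m. (a, m) \<in> set xs \<Longrightarrow> m \<noteq> 0 \<Longrightarrow> Y \<le> \<bar>real_of_int (symb n m)\<bar>"
  shows "coeff_norm (trans_inv n xs) \<le> coeff_norm xs / Y"
  using assms(2)
proof (induction xs)
  case (Cons p xs)
  obtain a m where p: "p = (a, m)" by (cases p)
  have "cmod (if m = 0 then 0 else a / of_int (symb n m)) \<le> cmod a / Y"
    using Cons(2)[of a m] p assms(1) by (auto simp: norm_divide intro!: divide_left_mono mult_pos_pos)
  moreover have "coeff_norm (trans_inv n xs) \<le> coeff_norm xs / Y"
    using Cons by (metis list.set_intros(2))
  ultimately show ?case by (auto simp: p add_divide_distrib split: if_splits)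
qed simp

text \<open>Only the modes \<open>-m\<close> with \<open>m\<close> a frequency of the other factor contribute to the zero mode,
  so that the small divisor at those modes suffices.\<close>

lemma norm_zero_mode_grad_prod_le:
  assumes "Y > 0" "\<And>a m. (a, m) \<in> set xs \<Longrightarrow> Y \<le> \<bar>real_of_int (symb n (- m))\<bar>"
    and "\<And>a m b l. (a, m) \<in> set xs \<Longrightarrow> (b, l) \<in> set ys \<Longrightarrow> \<bar>real_of_int (idot m l)\<bar> \<le> \<kappa>" and "\<kappa> \<ge> 0"
  shows "cmod (zero_mode (grad_prod xs (trans_inv n ys))) \<le> \<kappa> * coeff_norm xs * coeff_norm ys / Y"
  using assms(2,3)
proof (induction xs)
  case (Cons p xs)
  let ?f = "\<lambda>ys. map (\<lambda>(b, l). (- of_int (idot (snd p) l) * fst p * b, snd p + l)) (trans_inv n ys)"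
  have Y: "Y \<le> \<bar>real_of_int (symb n (- snd p))\<bar>" using Cons(2)[of "fst p" "snd p"] by simp
  have 1: "cmod (zero_mode (?f ys)) \<le> \<kappa> * cmod (fst p) * coeff_norm ys / Y"
    using Cons(3)[of "fst p" "snd p"]
  proof (induction ys)
    case (Cons q ys)
    obtain b l where q: "q = (b, l)" by (cases q)
    define t where "t = (if snd p + l = 0 then - of_int (idot (snd p) l) * fst p * (if l = 0 then 0 else b / of_int (symb n l)) else 0)"
    have "cmod t \<le> \<kappa> * cmod (fst p) * cmod b / Y"
    proof (cases "snd p + l = 0 \<and> l \<noteq> 0")
      case True
      then have l: "l = - snd p" by (simp add: add_eq_0_iff)
      have "cmod t = \<bar>real_of_int (idot (snd p) l)\<bar> * cmod (fst p) * cmod b / \<bar>real_of_int (symb n l)\<bar>"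
        using True by (simp add: t_def norm_mult norm_divide)
      also have "\<dots> \<le> \<kappa> * cmod (fst p) * cmod b / Y"
        using Cons(2)[of b l] q Y l assms(1,4) by (intro frac_le mult_mono) auto
      finally show ?thesis .
    next
      case False
      then have "t = 0" by (auto simp: t_def)
      then show ?thesis using assms by simp
    qed
    moreover have "cmod (zero_mode (?f ys)) \<le> \<kappa> * cmod (fst p) * coeff_norm ys / Y"
      using Cons by (metis (no_types, lifting) list.set_intros(2))
    moreover have "zero_mode (?f (q # ys)) = t + zero_mode (?f ys)"
      by (simp add: q t_def)
    moreover have "cmod (t + zero_mode (?f ys)) \<le> cmod t + cmod (zero_mode (?f ys))" by (rule norm_triangle_ineq)
    ultimately show ?case by (simp add: q algebra_simps add_divide_distrib)
  qed simp
  have 2: "cmod (zero_mode (grad_prod xs (trans_inv n ys))) \<le> \<kappa> * coeff_norm xs * coeff_norm ys / Y"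
    using Cons by (metis (no_types, lifting) list.set_intros(2))
  have "cmod (zero_mode (grad_prod (p # xs) (trans_inv n ys)))
     \<le> cmod (zero_mode (?f ys)) + cmod (zero_mode (grad_prod xs (trans_inv n ys)))"
    by (simp add: norm_triangle_ineq)
  with 1 2 show ?case by (simp add: algebra_simps add_divide_distrib)
qed simp

definition freqs_in :: "int \<Rightarrow> trig \<Rightarrow> bool" where
  "freqs_in r xs \<longleftrightarrow> (\<forall>(a, m)\<in>set xs. \<bar>fst m\<bar> \<le> r \<and> \<bar>snd m\<bar> \<le> r)"

lemma freqs_in_append [simp]: "freqs_in r (xs @ ys) \<longleftrightarrow> freqs_in r xs \<and> freqs_in r ys"
  by (auto simp: freqs_in_def)

lemma freqs_in_tneg [simp]: "freqs_in r (tneg xs) \<longleftrightarrow> freqs_in r xs"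
  by (auto simp: freqs_in_def tneg_def)

lemma freqs_in_trans_inv [simp]: "freqs_in r (trans_inv n xs) \<longleftrightarrow> freqs_in r xs"
  by (auto simp: freqs_in_def trans_inv_def)

lemma freqs_in_mono: "freqs_in r xs \<Longrightarrow> r \<le> s \<Longrightarrow> freqs_in s xs"
  by (force simp: freqs_in_def)

lemma freqs_in_grad_prod:
  assumes "freqs_in r xs" "freqs_in s ys"
  shows "freqs_in (r + s) (grad_prod xs ys)"
  using assms by (force simp: freqs_in_def grad_prod_def)

lemma idot_le:
  assumes "\<bar>fst m\<bar> \<le> r" "\<bar>snd m\<bar> \<le> r" "\<bar>fst l\<bar> \<le> s" "\<bar>snd l\<bar> \<le> s"
  shows "\<bar>idot m l\<bar> \<le> 2 * r * s"
proof -
  have "\<bar>fst m\<bar> * \<bar>fst l\<bar> \<le> r * s" "\<bar>snd m\<bar> * \<bar>snd l\<bar> \<le> r * s"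
    using assms by (auto intro!: mult_mono)
  moreover have "\<bar>idot m l\<bar> \<le> \<bar>fst m\<bar> * \<bar>fst l\<bar> + \<bar>snd m\<bar> * \<bar>snd l\<bar>"
    unfolding idot_def abs_mult[symmetric] by (rule abs_triangle_ineq)
  ultimately show ?thesis by linarith
qed

lemma freqs_in_idot:
  assumes "freqs_in r xs" "freqs_in r ys" "(a, m) \<in> set xs" "(b, l) \<in> set ys"
  shows "\<bar>real_of_int (idot m l)\<bar> \<le> of_int (2 * r * r)"
proof -
  have "\<bar>idot m l\<bar> \<le> 2 * r * r"
    using assms by (intro idot_le) (auto simp: freqs_in_def)
  then show ?thesis by linarith
qed

lemma zero_mode_grad_prod_map:
  "zero_mode (grad_prod (map (\<lambda>m. (f m, m)) ms) (map (\<lambda>m. (g m, m)) ls)) =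
    (\<Sum>m\<leftarrow>ms. \<Sum>l\<leftarrow>ls. if m + l = 0 then - of_int (idot m l) * f m * g l else 0)"
proof (induction ms)
  case (Cons m ms)
  have "zero_mode (map (\<lambda>(b, l). (- of_int (idot m l) * f m * b, m + l)) (map (\<lambda>m. (g m, m)) ls)) =
      (\<Sum>l\<leftarrow>ls. if m + l = 0 then - of_int (idot m l) * f m * g l else 0)"
    by (induction ls) auto
  with Cons show ?case by simp
qed simp

lemma zero_mode_grad_prod_Nil [simp]: "zero_mode (grad_prod xs []) = 0"
  by (induction xs) auto

lemma zero_mode_grad_prod_Cons_right:
  "zero_mode (grad_prod xs (q # ys)) = zero_mode (grad_prod [q] xs) + zero_mode (grad_prod xs ys)"
  by (induction xs) (auto simp: case_prod_unfold idot_commute[of "snd q"] add.commute[of "snd q"] mult_ac)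

lemma zero_mode_grad_prod_commute: "zero_mode (grad_prod xs ys) = zero_mode (grad_prod ys xs)"
proof (induction ys)
  case (Cons q ys)
  have "zero_mode (grad_prod (q # ys) xs) = zero_mode (grad_prod [q] xs) + zero_mode (grad_prod ys xs)"
    by simp
  with Cons show ?case by (simp only: zero_mode_grad_prod_Cons_right)
qed simp

text \<open>\<open>V\<close> is the family of Fourier coefficients of the potential, \<open>ms\<close> enumerates its nonzero
  frequencies; the mean value of the potential is absorbed into the energy.\<close>

locale potential =
  fixes V :: "int \<times> int \<Rightarrow> complex" and ms :: "(int \<times> int) list" and k :: int
  assumes distinct_ms: "distinct ms" and ms_nonempty: "ms \<noteq> []" and zero_notin_ms: "0 \<notin> set ms"
    and ms_symmetric: "\<And>m. m \<in> set ms \<Longrightarrow> - m \<in> set ms"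
    and V_cnj: "\<And>m. m \<in> set ms \<Longrightarrow> V (- m) = cnj (V m)"
    and V_nonzero: "\<And>m. m \<in> set ms \<Longrightarrow> V m \<noteq> 0"
    and ms_bound: "\<And>m. m \<in> set ms \<Longrightarrow> \<bar>fst m\<bar> \<le> k \<and> \<bar>snd m\<bar> \<le> k"
begin

text \<open>Chosen so that \<open>S (rvec n)\<close> is the leading part of the second-order energy
  correction: adding the contributions of \<open>m\<close> and \<open>- m\<close> cancels the
  first-order divisors and leaves \<open>|m|^2\<close> over \<open>4 (n.m)^2\<close>.\<close>

definition weight :: "int \<times> int \<Rightarrow> real" where
  "weight m = of_int (idot m m) * (cmod (V m))\<^sup>2 / 4"

sublocale pole_weights "set ms" weight
proof
  show "weight m > 0" if "m \<in> set ms" for m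
  proof -
    have "m \<noteq> 0" using that zero_notin_ms by auto
    then show ?thesis using V_nonzero[OF that] idot_self_pos[of m] by (simp add: weight_def)
  qed
qed (use ms_nonempty in auto)

definition vs :: trig where "vs = map (\<lambda>m. (V m, m)) ms"

text \<open>\<open>d1\<close>, \<open>d2\<close>, \<open>d3\<close> are the terms of degree one, two and three in \<open>V\<close> of the phase of
  the quasimode.\<close>

definition d1 :: "int \<times> int \<Rightarrow> trig" where "d1 n = trans_inv n (tneg vs)"
definition d2 :: "int \<times> int \<Rightarrow> trig" where "d2 n = trans_inv n (grad_prod (d1 n) (d1 n))"
definition d3 :: "int \<times> int \<Rightarrow> trig" where
  "d3 n = trans_inv n (grad_prod (d1 n) (d2 n) @ grad_prod (d2 n) (d1 n))"
definition phase :: "int \<times> int \<Rightarrow> trig" where "phase n = d1 n @ d2 n @ d3 n"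
text \<open>The solvability constants of the transport equations: zero modes cannot be removed by
  the phase and move into the energy.\<close>

definition shift :: "int \<times> int \<Rightarrow> complex" where
  "shift n = - (zero_mode (grad_prod (d1 n) (d1 n)) + zero_mode (grad_prod (d1 n) (d2 n))
     + zero_mode (grad_prod (d2 n) (d1 n)))"
text \<open>All products of gradients of total degree at least four in \<open>V\<close>.\<close>

definition remainder :: "int \<times> int \<Rightarrow> trig" where
  "remainder n = grad_prod (d2 n) (d2 n) @ grad_prod (d1 n) (d3 n) @ grad_prod (d3 n) (d1 n)
     @ grad_prod (d2 n) (d3 n) @ grad_prod (d3 n) (d2 n) @ grad_prod (d3 n) (d3 n)"

text \<open>The products inverted to obtain the phase have frequencies that are sums of at most
  three frequencies of \<open>V\<close>, hence the factor 3.\<close>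

definition in_box :: "int \<times> int \<Rightarrow> bool" where
  "in_box m \<longleftrightarrow> \<bar>fst m\<bar> \<le> 3 * k \<and> \<bar>snd m\<bar> \<le> 3 * k"

definition \<kappa> :: real where "\<kappa> = of_int (2 * (3 * k) * (3 * k))"

text \<open>\<open>Xm\<close> bounds all small divisors from below and \<open>Y\<close>, which may be much larger, those at
  the frequencies of \<open>V\<close>. Energies of different quasimodes can be as close as \<open>Y\<close> to the power \<open>-4\<close>,
  so the errors have to be measured in \<open>Y\<close>.\<close>

definition nonresonant :: "int \<times> int \<Rightarrow> real \<Rightarrow> real \<Rightarrow> bool" where
  "nonresonant n Xm Y \<longleftrightarrow> 1 \<le> Xm \<and> \<kappa> \<le> Xm \<and> Xm \<le> Y
    \<and> (\<forall>m. in_box m \<longrightarrow> m \<noteq> 0 \<longrightarrow> Xm \<le> \<bar>of_int (idot n m)\<bar>)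
    \<and> (\<forall>m\<in>set ms. Y \<le> \<bar>of_int (idot n m)\<bar>)"

section \<open>Size of the phase, of the remainder and of the energy shift\<close>

lemma k_nonneg: "k \<ge> 0"
proof -
  obtain m where "m \<in> set ms" using ms_nonempty by (cases ms) auto
  then show ?thesis using ms_bound[of m] by linarith
qed

lemma \<kappa>_nonneg: "\<kappa> \<ge> 0" by (simp add: \<kappa>_def)

lemma idot_self_le: assumes "in_box m" shows "0 \<le> real_of_int (idot m m)" "real_of_int (idot m m) \<le> \<kappa>"
proof -
  show "0 \<le> real_of_int (idot m m)" by (simp add: idot_def)
  have "\<bar>idot m m\<bar> \<le> 2 * (3 * k) * (3 * k)" using assms by (intro idot_le) (auto simp: in_box_def)
  then show "real_of_int (idot m m) \<le> \<kappa>" unfolding \<kappa>_def by linarith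
qed

lemma in_box_ms: "m \<in> set ms \<Longrightarrow> in_box m"
  using ms_bound[of m] k_nonneg by (auto simp: in_box_def)

text \<open>\<open>2 |n.m| - |m|^2 >= 2 Xm - \<kappa> >= Xm\<close>; this is the purpose of the
  condition \<open>\<kappa> <= Xm\<close>.\<close>

lemma symb_ge: assumes "nonresonant n Xm Y" "in_box m" "m \<noteq> 0" shows "Xm \<le> \<bar>real_of_int (symb n m)\<bar>"
proof -
  have "\<bar>real_of_int (idot n m)\<bar> \<ge> Xm" "\<kappa> \<le> Xm" using assms unfolding nonresonant_def by blast+
  then show ?thesis using idot_self_le[OF assms(2)] by (simp add: symb_def)
qed

lemma symb_ge_ms: assumes "nonresonant n Xm Y" "m \<in> set ms" shows "Y \<le> \<bar>real_of_int (symb n m)\<bar>"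
proof -
  have "\<bar>real_of_int (idot n m)\<bar> \<ge> Y" "\<kappa> \<le> Y" using assms by (auto simp: nonresonant_def)
  then show ?thesis using idot_self_le[OF in_box_ms[OF assms(2)]] by (simp add: symb_def)
qed

lemma freqs_vs: "freqs_in k vs"
  using ms_bound by (auto simp: freqs_in_def vs_def)

lemma freqs_d: "freqs_in k (d1 n)" "freqs_in (2 * k) (d2 n)" "freqs_in (3 * k) (d3 n)"
proof -
  show 1: "freqs_in k (d1 n)" by (simp add: d1_def freqs_vs)
  show 2: "freqs_in (2 * k) (d2 n)"
    using freqs_in_grad_prod[OF 1 1] by (simp add: d2_def)
  show "freqs_in (3 * k) (d3 n)"
    using freqs_in_grad_prod[OF 1 2] freqs_in_grad_prod[OF 2 1] by (simp add: d3_def)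
qed

lemma freqs_d': "freqs_in (3 * k) (d1 n)" "freqs_in (3 * k) (d2 n)" "freqs_in (3 * k) (d3 n)"
  using freqs_in_mono[OF freqs_d(1)] freqs_in_mono[OF freqs_d(2)] freqs_d(3) k_nonneg by auto

lemma freqs_grad_prod_d: "freqs_in (3 * k) (grad_prod (d1 n) (d1 n))"
    "freqs_in (3 * k) (grad_prod (d1 n) (d2 n) @ grad_prod (d2 n) (d1 n))"
  using freqs_in_grad_prod[OF freqs_d(1) freqs_d(1), of n n] freqs_in_grad_prod[OF freqs_d(1) freqs_d(2), of n n]
    freqs_in_grad_prod[OF freqs_d(2) freqs_d(1), of n n] k_nonneg freqs_in_mono[of "k + k" _ "3 * k"]
  by auto

lemma in_box_freqs: "freqs_in (3 * k) xs \<Longrightarrow> (a, m) \<in> set xs \<Longrightarrow> in_box m"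
  by (auto simp: freqs_in_def in_box_def)

lemma coeff_norm_grad_prod_box:
  assumes "freqs_in (3 * k) xs" "freqs_in (3 * k) ys"
  shows "coeff_norm (grad_prod xs ys) \<le> \<kappa> * coeff_norm xs * coeff_norm ys"
  unfolding \<kappa>_def by (intro coeff_norm_grad_prod_le freqs_in_idot[OF assms])

definition vnorm :: real where "vnorm = coeff_norm vs"

lemma vnorm_nonneg: "vnorm \<ge> 0" by (simp add: vnorm_def)

text \<open>\<open>d1\<close> solves for the potential, \<open>d2\<close> and \<open>d3\<close>
  cancel the products of degree two and three up to zero modes. Adding the three transport equations
  leaves only \<open>shift\<close> and the products of higher degree.\<close>

lemma phase_equation:
  assumes "nonresonant n Xm Y"
  shows "transport n (phase n) z
    + (ev (dx (phase n)) z)\<^sup>2 + (ev (dy (phase n)) z)\<^sup>2 = ev vs z - shift n + ev (remainder n) z"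
proof -
  have symb: "symb n m \<noteq> 0" if "in_box m" "m \<noteq> 0" for m
    using symb_ge[OF assms that] assms by (auto simp: nonresonant_def)
  have "freqs_in (3 * k) (tneg vs)" using freqs_vs k_nonneg by (auto elim!: freqs_in_mono)
  note s1 = symb[OF in_box_freqs[OF this]]
  note s2 = symb[OF in_box_freqs[OF freqs_grad_prod_d(1)[of n]]]
  note s3 = symb[OF in_box_freqs[OF freqs_grad_prod_d(2)[of n]]]
  have "zero_mode (tneg vs) = 0"
  proof -
    have "zero_mode (tneg (map (\<lambda>m. (V m, m)) ls)) = 0" if "0 \<notin> set ls" for ls
      using that by (induction ls) auto
    then show ?thesis using zero_notin_ms by (simp add: vs_def)
  qed
  then have e1: "transport n (d1 n) z = ev vs z"
    using ev_trans_inv[OF s1, where z = z] unfolding d1_def by simp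
  have e2: "transport n (d2 n) z
    = zero_mode (grad_prod (d1 n) (d1 n)) - ev (grad_prod (d1 n) (d1 n)) z"
    unfolding d2_def by (rule ev_trans_inv[OF s2])
  have e3: "transport n (d3 n) z
    = zero_mode (grad_prod (d1 n) (d2 n) @ grad_prod (d2 n) (d1 n))
      - ev (grad_prod (d1 n) (d2 n) @ grad_prod (d2 n) (d1 n)) z"
    unfolding d3_def by (rule ev_trans_inv[OF s3])
  have "(ev (dx (phase n)) z)\<^sup>2 + (ev (dy (phase n)) z)\<^sup>2 = ev (grad_prod (phase n) (phase n)) z"
    by (simp add: ev_grad_prod power2_eq_square)
  also have "\<dots> = ev (grad_prod (d1 n) (d1 n)) z + ev (grad_prod (d1 n) (d2 n) @ grad_prod (d2 n) (d1 n)) z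
      + ev (remainder n) z"
    by (simp add: phase_def remainder_def ev_grad_prod algebra_simps)
  finally have q: "(ev (dx (phase n)) z)\<^sup>2 + (ev (dy (phase n)) z)\<^sup>2 =
    ev (grad_prod (d1 n) (d1 n)) z + ev (grad_prod (d1 n) (d2 n) @ grad_prod (d2 n) (d1 n)) z
      + ev (remainder n) z" .
  have "transport n (phase n) z =
    transport n (d1 n) z + transport n (d2 n) z + transport n (d3 n) z"
    by (simp add: transport_def phase_def algebra_simps)
  also have "\<dots> = ev vs z + (zero_mode (grad_prod (d1 n) (d1 n)) - ev (grad_prod (d1 n) (d1 n)) z)
     + (zero_mode (grad_prod (d1 n) (d2 n) @ grad_prod (d2 n) (d1 n))
        - ev (grad_prod (d1 n) (d2 n) @ grad_prod (d2 n) (d1 n)) z)"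
    by (simp only: e1 e2 e3)
  finally show ?thesis using q by (simp add: shift_def)
qed

text \<open>Every product of gradients costs a factor \<open>\<kappa>\<close>. The inversion for
  \<open>d1\<close> gains \<open>Y\<close>, those for \<open>d2\<close> and \<open>d3\<close> only
  \<open>Xm\<close>, because they meet sums of frequencies of \<open>V\<close>.\<close>

lemma coeff_norm_d:
  assumes "nonresonant n Xm Y"
  shows "coeff_norm (d1 n) \<le> vnorm / Y"
    and "coeff_norm (d2 n) \<le> \<kappa> * vnorm ^ 2 / (Xm * Y ^ 2)"
    and "coeff_norm (d3 n) \<le> 2 * \<kappa> ^ 2 * vnorm ^ 3 / (Xm ^ 2 * Y ^ 3)"
proof -
  have XY: "Xm > 0" "Y > 0" using assms by (auto simp: nonresonant_def)
  have "coeff_norm (d1 n) \<le> coeff_norm (tneg vs) / Y"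
    unfolding d1_def
    by (rule coeff_norm_trans_inv_le) (use symb_ge_ms[OF assms] XY in \<open>auto simp: vs_def tneg_def\<close>)
  then show 1: "coeff_norm (d1 n) \<le> vnorm / Y" by (simp add: vnorm_def)
  have "coeff_norm (d2 n) \<le> coeff_norm (grad_prod (d1 n) (d1 n)) / Xm"
    unfolding d2_def
    by (rule coeff_norm_trans_inv_le) (use symb_ge[OF assms] in_box_freqs[OF freqs_grad_prod_d(1)] XY in auto)
  also have "\<dots> \<le> (\<kappa> * coeff_norm (d1 n) * coeff_norm (d1 n)) / Xm"
    using XY by (intro divide_right_mono coeff_norm_grad_prod_box freqs_d') auto
  also have "\<dots> \<le> (\<kappa> * (vnorm / Y) * (vnorm / Y)) / Xm"
    using XY 1 \<kappa>_nonneg vnorm_nonneg by (intro divide_right_mono mult_mono) auto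
  finally show 2: "coeff_norm (d2 n) \<le> \<kappa> * vnorm ^ 2 / (Xm * Y ^ 2)"
    by (simp add: power2_eq_square mult_ac)
  have "coeff_norm (d3 n) \<le> coeff_norm (grad_prod (d1 n) (d2 n) @ grad_prod (d2 n) (d1 n)) / Xm"
    unfolding d3_def
    by (rule coeff_norm_trans_inv_le) (use symb_ge[OF assms] in_box_freqs[OF freqs_grad_prod_d(2)] XY in auto)
  also have "\<dots> \<le> (\<kappa> * coeff_norm (d1 n) * coeff_norm (d2 n) + \<kappa> * coeff_norm (d2 n) * coeff_norm (d1 n)) / Xm"
    unfolding coeff_norm_simps using XY
    by (intro divide_right_mono add_mono coeff_norm_grad_prod_box freqs_d') auto
  also have "\<dots> = (2 * \<kappa> * (coeff_norm (d1 n) * coeff_norm (d2 n))) / Xm" by (simp add: algebra_simps)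
  also have "\<dots> \<le> (2 * \<kappa> * ((vnorm / Y) * (\<kappa> * vnorm ^ 2 / (Xm * Y ^ 2)))) / Xm"
    using XY 1 2 \<kappa>_nonneg vnorm_nonneg by (intro divide_right_mono mult_left_mono mult_mono) auto
  finally show "coeff_norm (d3 n) \<le> 2 * \<kappa> ^ 2 * vnorm ^ 3 / (Xm ^ 2 * Y ^ 3)"
    by (simp add: power2_eq_square power3_eq_cube mult_ac)
qed

text \<open>The terms of degree four, five and six of the remainder. The 5 is 1 from
  \<open>d2\<close> with itself and 2 from each order of \<open>d1\<close> and \<open>d3\<close>, as
  the bound for \<open>d3\<close> carries a factor 2.\<close>

definition C_rem :: real where
  "C_rem = \<kappa> * (5 * \<kappa> ^ 2 * vnorm ^ 4 + 4 * \<kappa> ^ 3 * vnorm ^ 5 + 4 * \<kappa> ^ 4 * vnorm ^ 6)"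

lemma norm_remainder:
  assumes "nonresonant n Xm Y"
  shows "cmod (ev (remainder n) z) \<le> C_rem / (Xm ^ 2 * Y ^ 4)"
proof -
  have XY: "Xm \<ge> 1" "Y \<ge> 1" using assms by (auto simp: nonresonant_def)
  define x y where "x = 1 / Xm" and "y = 1 / Y"
  have xy: "0 < x" "x \<le> 1" "0 < y" "y \<le> 1" using XY by (auto simp: x_def y_def)
  define a1 a2 a3 where "a1 = vnorm * y" and "a2 = \<kappa> * vnorm ^ 2 * (x * y ^ 2)"
    and "a3 = 2 * \<kappa> ^ 2 * vnorm ^ 3 * (x ^ 2 * y ^ 3)"
  have a: "coeff_norm (d1 n) \<le> a1" "coeff_norm (d2 n) \<le> a2" "coeff_norm (d3 n) \<le> a3"
    using coeff_norm_d[OF assms] by (simp_all add: a1_def a2_def a3_def x_def y_def power_divide)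
  have a0: "0 \<le> a1" "0 \<le> a2" "0 \<le> a3"
    using a by (meson coeff_norm_nonneg order_trans)+
  have Q: "coeff_norm (grad_prod xs ys) \<le> \<kappa> * (s * t)"
    if "freqs_in (3 * k) xs" "freqs_in (3 * k) ys" "coeff_norm xs \<le> s" "coeff_norm ys \<le> t" "0 \<le> s" for xs ys s t
  proof -
    have "coeff_norm (grad_prod xs ys) \<le> \<kappa> * (coeff_norm xs * coeff_norm ys)"
      using coeff_norm_grad_prod_box[OF that(1,2)] by (simp add: mult.assoc)
    also have "\<dots> \<le> \<kappa> * (s * t)" using that \<kappa>_nonneg by (intro mult_left_mono mult_mono) auto
    finally show ?thesis .
  qed
  have "cmod (ev (remainder n) z) \<le> coeff_norm (remainder n)" by (rule norm_ev_le)
  also have "\<dots> \<le> \<kappa> * (a2 * a2) + (\<kappa> * (a1 * a3) + (\<kappa> * (a3 * a1) + (\<kappa> * (a2 * a3) + (\<kappa> * (a3 * a2) + \<kappa> * (a3 * a3)))))"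
    unfolding remainder_def coeff_norm_simps
    by (intro add_mono Q freqs_d' a a0)
  also have "\<dots> = \<kappa> * ((5 * \<kappa> ^ 2 * vnorm ^ 4) * (x ^ 2 * y ^ 4) + (4 * \<kappa> ^ 3 * vnorm ^ 5) * (x ^ 3 * y ^ 5)
      + (4 * \<kappa> ^ 4 * vnorm ^ 6) * (x ^ 4 * y ^ 6))"
    by (simp add: a1_def a2_def a3_def eval_nat_numeral algebra_simps)
  also have "\<dots> \<le> \<kappa> * ((5 * \<kappa> ^ 2 * vnorm ^ 4) * (x ^ 2 * y ^ 4) + (4 * \<kappa> ^ 3 * vnorm ^ 5) * (x ^ 2 * y ^ 4)
      + (4 * \<kappa> ^ 4 * vnorm ^ 6) * (x ^ 2 * y ^ 4))"
    using xy \<kappa>_nonneg vnorm_nonneg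
    by (intro mult_left_mono add_mono mult_mono power_decreasing order_refl) auto
  also have "\<dots> = C_rem * (x ^ 2 * y ^ 4)" by (simp add: C_rem_def algebra_simps)
  finally show ?thesis by (simp add: x_def y_def power_divide)
qed

definition C_phase :: real where "C_phase = vnorm + (\<kappa> * vnorm ^ 2 + 2 * \<kappa> ^ 2 * vnorm ^ 3)"

lemma coeff_norm_phase:
  assumes "nonresonant n Xm Y"
  shows "coeff_norm (d2 n @ d3 n) \<le> C_phase / Xm ^ 2" "coeff_norm (phase n) \<le> C_phase / Xm"
proof -
  have XY: "Xm \<ge> 1" "Y \<ge> Xm" using assms by (auto simp: nonresonant_def)
  have "coeff_norm (d1 n) \<le> vnorm / Y" by (rule coeff_norm_d[OF assms])
  also have "\<dots> \<le> vnorm / Xm" using XY vnorm_nonneg by (intro divide_left_mono) auto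
  finally have 1: "coeff_norm (d1 n) \<le> vnorm / Xm" .
  have X2: "Xm ^ 2 \<le> Xm * Y ^ 2" "Xm ^ 2 \<le> Xm ^ 2 * Y ^ 3" "Xm \<le> Xm ^ 2"
  proof -
    have "Xm * 1 \<le> Y * Y" using XY by (intro mult_mono) auto
    then show "Xm ^ 2 \<le> Xm * Y ^ 2" using XY by (simp add: power2_eq_square)
    show "Xm ^ 2 \<le> Xm ^ 2 * Y ^ 3" using XY by (simp add: one_le_power)
    show "Xm \<le> Xm ^ 2" using XY by (simp add: power2_eq_square)
  qed
  have "\<kappa> * vnorm ^ 2 / (Xm * Y ^ 2) \<le> \<kappa> * vnorm ^ 2 / Xm ^ 2"
    using XY X2 \<kappa>_nonneg by (intro divide_left_mono) auto
  then have 2: "coeff_norm (d2 n) \<le> \<kappa> * vnorm ^ 2 / Xm ^ 2" using coeff_norm_d(2)[OF assms] by linarith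
  have "2 * \<kappa> ^ 2 * vnorm ^ 3 / (Xm ^ 2 * Y ^ 3) \<le> 2 * \<kappa> ^ 2 * vnorm ^ 3 / Xm ^ 2"
    using XY X2 \<kappa>_nonneg vnorm_nonneg by (intro divide_left_mono) auto
  then have 3: "coeff_norm (d3 n) \<le> 2 * \<kappa> ^ 2 * vnorm ^ 3 / Xm ^ 2" using coeff_norm_d(3)[OF assms] by linarith
  have 4: "coeff_norm (d2 n @ d3 n) \<le> (\<kappa> * vnorm ^ 2 + 2 * \<kappa> ^ 2 * vnorm ^ 3) / Xm ^ 2"
    using 2 3 by (simp add: add_divide_distrib)
  also have "\<dots> \<le> C_phase / Xm ^ 2" unfolding C_phase_def using vnorm_nonneg by (intro divide_right_mono) auto
  finally show "coeff_norm (d2 n @ d3 n) \<le> C_phase / Xm ^ 2" .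
  have "(\<kappa> * vnorm ^ 2 + 2 * \<kappa> ^ 2 * vnorm ^ 3) / Xm ^ 2 \<le> (\<kappa> * vnorm ^ 2 + 2 * \<kappa> ^ 2 * vnorm ^ 3) / Xm"
    using XY X2 \<kappa>_nonneg vnorm_nonneg by (intro divide_left_mono) auto
  with 4 1 show "coeff_norm (phase n) \<le> C_phase / Xm"
    unfolding phase_def C_phase_def coeff_norm_simps(3)[of "d1 n"] add_divide_distrib[of vnorm] by linarith
qed

text \<open>Only pairs \<open>m\<close>, \<open>- m\<close> of frequencies contribute to the zero
  mode.\<close>

lemma zero_mode_d1:
  "zero_mode (grad_prod (d1 n) (d1 n)) =
    (\<Sum>m\<in>set ms. of_int (idot m m) * (V m * V (- m)) / of_int (symb n m * symb n (- m)))"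
proof -
  define D where "D m = (if m = 0 then 0 else - V m / of_int (symb n m))" for m
  have d1: "d1 n = map (\<lambda>m. (D m, m)) ms"
    by (simp add: d1_def trans_inv_def tneg_def vs_def D_def)
  have "zero_mode (grad_prod (d1 n) (d1 n)) =
      (\<Sum>m\<in>set ms. \<Sum>l\<in>set ms. if m + l = 0 then - of_int (idot m l) * D m * D l else 0)"
    unfolding d1 zero_mode_grad_prod_map using distinct_ms
    by (simp only: sum.distinct_set_conv_list)
  also have "\<dots> = (\<Sum>m\<in>set ms. of_int (idot m m) * (V m * V (- m)) / of_int (symb n m * symb n (- m)))"
  proof (rule sum.cong[OF refl])
    fix m assume m: "m \<in> set ms"
    have "m \<noteq> 0" using m zero_notin_ms by auto
    have "(\<Sum>l\<in>set ms. if m + l = 0 then - of_int (idot m l) * D m * D l else 0) =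
      (\<Sum>l\<in>set ms. if l = - m then - of_int (idot m l) * D m * D l else 0)"
      by (intro sum.cong) (auto simp: add_eq_0_iff)
    also have "\<dots> = of_int (idot m m) * D m * D (- m)"
      using ms_symmetric[OF m] by (simp add: idot_minus)
    finally show "(\<Sum>l\<in>set ms. if m + l = 0 then - of_int (idot m l) * D m * D l else 0) =
      of_int (idot m m) * (V m * V (- m)) / of_int (symb n m * symb n (- m))"
      using \<open>m \<noteq> 0\<close> by (simp add: D_def)
  qed
  finally show ?thesis .
qed

definition C_shift :: real where
  "C_shift = 2 * \<kappa> ^ 2 * vnorm ^ 3 + (\<Sum>m\<in>set ms. \<kappa> ^ 3 * (cmod (V m))\<^sup>2)"

lemma norm_shift_diff:
  assumes "nonresonant n Xm Y"
  shows "cmod (shift n - of_real (S (rvec n))) \<le> C_shift / Y ^ 4"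
proof -
  have XY: "Xm \<ge> 1" "Y \<ge> Xm" "\<kappa> \<le> Y" using assms by (auto simp: nonresonant_def)
  \<comment> \<open>Bounding \<open>d2\<close> by its norm would give only
    \<open>1 / (Xm Y^3)\<close>. But \<open>d1\<close> pairs with \<open>d2\<close> only at
    frequencies \<open>- m\<close> with \<open>m\<close> in \<open>ms\<close>, again frequencies of
    \<open>V\<close>, and there the divisor is at least \<open>Y\<close>.\<close>
  have cross: "cmod (zero_mode (grad_prod (d1 n) (d2 n))) \<le> \<kappa> ^ 2 * vnorm ^ 3 / Y ^ 4"
  proof -
    have "cmod (zero_mode (grad_prod (d1 n) (d2 n))) \<le>
        \<kappa> * coeff_norm (d1 n) * coeff_norm (grad_prod (d1 n) (d1 n)) / Y"
      unfolding d2_def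
    proof (rule norm_zero_mode_grad_prod_le)
      show "Y \<le> \<bar>real_of_int (symb n (- m))\<bar>" if "(a, m) \<in> set (d1 n)" for a m
        using that ms_symmetric by (intro symb_ge_ms[OF assms]) (auto simp: d1_def trans_inv_def tneg_def vs_def)
      show "\<bar>real_of_int (idot m l)\<bar> \<le> \<kappa>"
        if "(a, m) \<in> set (d1 n)" "(b, l) \<in> set (grad_prod (d1 n) (d1 n))" for a m b l
        unfolding \<kappa>_def by (rule freqs_in_idot[OF freqs_d'(1) freqs_grad_prod_d(1) that])
    qed (use XY \<kappa>_nonneg in auto)
    also have "\<dots> \<le> \<kappa> * (vnorm / Y) * (\<kappa> * (vnorm / Y) * (vnorm / Y)) / Y"
    proof -
      have 1: "coeff_norm (d1 n) \<le> vnorm / Y" by (rule coeff_norm_d[OF assms])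
      have "coeff_norm (grad_prod (d1 n) (d1 n)) \<le> \<kappa> * coeff_norm (d1 n) * coeff_norm (d1 n)"
        by (intro coeff_norm_grad_prod_box freqs_d')
      also have "\<dots> \<le> \<kappa> * (vnorm / Y) * (vnorm / Y)"
        using 1 XY \<kappa>_nonneg vnorm_nonneg by (intro mult_mono) auto
      finally show ?thesis using 1 XY \<kappa>_nonneg vnorm_nonneg by (intro divide_right_mono mult_mono) auto
    qed
    also have "\<dots> = \<kappa> ^ 2 * vnorm ^ 3 / Y ^ 4" by (simp add: eval_nat_numeral mult_ac)
    finally show ?thesis .
  qed
  have sym: "zero_mode (grad_prod (d2 n) (d1 n)) = zero_mode (grad_prod (d1 n) (d2 n))"
    by (rule zero_mode_grad_prod_commute)
  \<comment> \<open>The exact denominator is \<open>4 x^2 - s^2\<close> after the sign change, that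
    of \<open>S\<close> is \<open>4 x^2\<close>; the relative error is of order
    \<open>s^2 / x^2\<close>, which gains the two missing powers of \<open>Y\<close>.\<close>
  have diff: "cmod (- (of_int (idot m m) * (V m * V (- m)) / of_int (symb n m * symb n (- m)))
       - of_real (weight m / (inner (rvec n) (rvec m))\<^sup>2)) \<le> \<kappa> ^ 3 * (cmod (V m))\<^sup>2 / Y ^ 4"
    if m: "m \<in> set ms" for m
  proof -
    define x s u where "x = real_of_int (idot n m)" and "s = real_of_int (idot m m)" and "u = (cmod (V m))\<^sup>2"
    have s: "0 \<le> s" "s \<le> \<kappa>" using idot_self_le[OF in_box_ms[OF m]] by (auto simp: s_def)
    have x: "Y \<le> \<bar>x\<bar>" using assms m by (auto simp: nonresonant_def x_def)
    have "V m * V (- m) = of_real u" using V_cnj[OF m] by (simp add: u_def complex_norm_square[symmetric])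
    have "s\<^sup>2 \<le> Y\<^sup>2" "Y\<^sup>2 \<le> x\<^sup>2" using s x XY by (auto simp: abs_le_square_iff[symmetric])
    then have x2: "3 * x\<^sup>2 \<le> 4 * x\<^sup>2 - s\<^sup>2" "0 < x\<^sup>2" using x XY by auto
    have "complex_of_int (symb n m * symb n (- m)) = of_real (s\<^sup>2 - 4 * x\<^sup>2)"
    proof -
      have "real_of_int (symb n m * symb n (- m)) = s\<^sup>2 - 4 * x\<^sup>2"
        by (simp add: symb_def idot_minus x_def s_def power2_eq_square algebra_simps)
      then show ?thesis by (metis of_real_of_int_eq)
    qed
    moreover have nonneg: "0 \<le> s * u * s\<^sup>2 / ((4 * x\<^sup>2 - s\<^sup>2) * (4 * x\<^sup>2))"
    proof -
      have "0 \<le> 4 * x\<^sup>2 - s\<^sup>2" using x2 by linarith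
      then show ?thesis using s(1) by (intro divide_nonneg_nonneg mult_nonneg_nonneg) (simp_all add: u_def)
    qed
    ultimately have "- (of_int (idot m m) * (V m * V (- m)) / of_int (symb n m * symb n (- m)))
       - of_real (weight m / (inner (rvec n) (rvec m))\<^sup>2) =
       of_real (- (s * u / (s\<^sup>2 - 4 * x\<^sup>2)) - s * u / 4 / x\<^sup>2)"
      using \<open>V m * V (- m) = of_real u\<close>
      by (simp add: weight_def inner_rvec x_def[symmetric] s_def u_def)
    also have "- (s * u / (s\<^sup>2 - 4 * x\<^sup>2)) - s * u / 4 / x\<^sup>2 = s * u * s\<^sup>2 / ((4 * x\<^sup>2 - s\<^sup>2) * (4 * x\<^sup>2))"
    proof -
      define p B where "p = 4 * x\<^sup>2 - s\<^sup>2" and "B = x\<^sup>2"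
      have pB: "p > 0" "B > 0" using x2 unfolding p_def B_def by linarith+
      have "- (s * u / (- p)) - s * u / 4 / B = s * u * (4 * B - p) / (p * (4 * B))"
        using pB by (simp add: field_simps)
      moreover have "4 * B - p = s\<^sup>2" by (simp add: p_def B_def)
      moreover have "s\<^sup>2 - 4 * x\<^sup>2 = - p" "4 * x\<^sup>2 - s\<^sup>2 = p" by (simp_all add: p_def)
      ultimately show ?thesis by (simp only: B_def[symmetric])
    qed
    finally have "cmod (- (of_int (idot m m) * (V m * V (- m)) / of_int (symb n m * symb n (- m)))
       - of_real (weight m / (inner (rvec n) (rvec m))\<^sup>2)) = s * u * s\<^sup>2 / ((4 * x\<^sup>2 - s\<^sup>2) * (4 * x\<^sup>2))"
      using nonneg by (simp only: norm_of_real abs_of_nonneg)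
    also have "\<dots> \<le> \<kappa> * u * \<kappa>\<^sup>2 / (Y\<^sup>2 * Y\<^sup>2)"
    proof -
      have "Y\<^sup>2 \<le> 4 * x\<^sup>2 - s\<^sup>2" "Y\<^sup>2 \<le> 4 * x\<^sup>2" "0 \<le> 4 * x\<^sup>2 - s\<^sup>2"
        using x2 \<open>Y\<^sup>2 \<le> x\<^sup>2\<close> by linarith+
      then show ?thesis using s \<kappa>_nonneg XY
        by (intro frac_le mult_mono power_mono) (auto simp: u_def)
    qed
    also have "\<dots> = \<kappa> ^ 3 * u / Y ^ 4" by (simp add: eval_nat_numeral mult_ac)
    finally show ?thesis by (simp add: u_def)
  qed
  have "cmod (- zero_mode (grad_prod (d1 n) (d1 n)) - of_real (S (rvec n))) \<le>
      (\<Sum>m\<in>set ms. \<kappa> ^ 3 * (cmod (V m))\<^sup>2 / Y ^ 4)"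
    unfolding zero_mode_d1 S_def of_real_sum sum_negf[symmetric] sum_subtractf[symmetric]
    by (intro order_trans[OF norm_sum] sum_mono diff)
  then have main: "cmod (- zero_mode (grad_prod (d1 n) (d1 n)) - of_real (S (rvec n))) \<le>
      (\<Sum>m\<in>set ms. \<kappa> ^ 3 * (cmod (V m))\<^sup>2) / Y ^ 4" by (simp add: sum_divide_distrib)
  have "shift n - of_real (S (rvec n)) = (- zero_mode (grad_prod (d1 n) (d1 n)) - of_real (S (rvec n)))
     + - (2 * zero_mode (grad_prod (d1 n) (d2 n)))"
    by (simp add: shift_def sym)
  then have "cmod (shift n - of_real (S (rvec n))) \<le>
    cmod (- zero_mode (grad_prod (d1 n) (d1 n)) - of_real (S (rvec n))) + cmod (- (2 * zero_mode (grad_prod (d1 n) (d2 n))))"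
    by (metis norm_triangle_ineq)
  also have "\<dots> \<le> (\<Sum>m\<in>set ms. \<kappa> ^ 3 * (cmod (V m))\<^sup>2) / Y ^ 4 + 2 * (\<kappa> ^ 2 * vnorm ^ 3 / Y ^ 4)"
    using main cross by (intro add_mono) (auto simp: norm_mult)
  also have "\<dots> = C_shift / Y ^ 4" by (simp add: C_shift_def add_divide_distrib)
  finally show ?thesis .
qed

end

section \<open>Summability of the coefficients of an eigenfunction\<close>

lemma sum_inverse_squares_int_le:
  assumes "finite Xm" "0 \<notin> Xm"
  shows "(\<Sum>x\<in>Xm. 1 / (real_of_int x)\<^sup>2) \<le> 4"
proof -
  have half: "(\<Sum>j=1..L. 1 / (real j)\<^sup>2) \<le> 2" for L
  proof -
    have "(\<Sum>j=1..Suc L. 1 / (real j)\<^sup>2) \<le> 2 - 1 / real (Suc L)" for L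
    proof (induction L)
      case (Suc L)
      have "1 / (real (Suc (Suc L)))\<^sup>2 \<le> 1 / (real (Suc L) * real (Suc (Suc L)))"
        by (intro divide_left_mono) (auto simp: power2_eq_square)
      also have "\<dots> = 1 / real (Suc L) - 1 / real (Suc (Suc L))" by (simp add: field_simps)
      finally show ?case using Suc by (simp del: of_nat_Suc)
    qed simp
    from this[of "L - 1"] show ?thesis
      by (cases L) (auto simp del: of_nat_Suc sum.cl_ivl_Suc intro: order_trans)
  qed
  define L where "L = nat (Max (insert 0 (abs ` Xm)))"
  have L: "\<bar>x\<bar> \<le> int L" if "x \<in> Xm" for x
    using that assms(1) by (simp add: L_def)
  have sub: "Xm \<subseteq> int ` {1..L} \<union> (\<lambda>j. - int j) ` {1..L}"
  proof
    fix x assume x: "x \<in> Xm"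
    have "x \<noteq> 0" using x assms by auto
    show "x \<in> int ` {1..L} \<union> (\<lambda>j. - int j) ` {1..L}"
    proof (cases "x > 0")
      case True
      then have "x = int (nat x)" "nat x \<in> {1..L}" using L[OF x] by auto
      then show ?thesis by blast
    next
      case False
      then have "x = - int (nat (- x))" "nat (- x) \<in> {1..L}" using L[OF x] \<open>x \<noteq> 0\<close> by auto
      then show ?thesis by blast
    qed
  qed
  have "(\<Sum>x\<in>Xm. 1 / (real_of_int x)\<^sup>2) \<le> (\<Sum>x\<in>int ` {1..L} \<union> (\<lambda>j. - int j) ` {1..L}. 1 / (real_of_int x)\<^sup>2)"
    by (intro sum_mono2 sub) auto
  also have "\<dots> \<le> (\<Sum>x\<in>int ` {1..L}. 1 / (real_of_int x)\<^sup>2) + (\<Sum>x\<in>(\<lambda>j. - int j) ` {1..L}. 1 / (real_of_int x)\<^sup>2)"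
    by (subst sum.union_inter[symmetric]) (auto intro!: sum_nonneg)
  also have "\<dots> = (\<Sum>j=1..L. 1 / (real j)\<^sup>2) + (\<Sum>j=1..L. 1 / (real j)\<^sup>2)"
    by (subst (1 2) sum.reindex) (auto simp: inj_on_def)
  finally show ?thesis using half[of L] by linarith
qed

text \<open>For integers \<open>t > t0 >= 0\<close> the difference \<open>t^2 - t0^2\<close> is at
  least \<open>t - t0\<close>. So on either side of 0 the element of least modulus confines the
  others to an interval of length \<open>D\<close>.\<close>

lemma card_near_squares:
  fixes T :: "int set"
  assumes "finite T" "\<And>t t'. t \<in> T \<Longrightarrow> t' \<in> T \<Longrightarrow> \<bar>t\<^sup>2 - t'\<^sup>2\<bar> \<le> int D"
  shows "card T \<le> 2 * (D + 1)"
proof -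
  have half: "card {t\<in>T. e * t \<ge> 0} \<le> D + 1" if e: "e = 1 \<or> e = -1" for e
  proof (cases "{t\<in>T. e * t \<ge> 0} = {}")
    case True then show ?thesis by (metis card.empty le0)
  next
    case False
    define P where "P = (\<lambda>t. e * t) ` {t\<in>T. e * t \<ge> 0}"
    have P: "finite P" "P \<noteq> {}" using assms(1) False by (auto simp: P_def)
    define t0 where "t0 = Min P"
    have t0: "t0 \<in> P" "\<And>t. t \<in> P \<Longrightarrow> t0 \<le> t" using P by (auto simp: t0_def)
    have "P \<subseteq> {t0..t0 + int D}"
    proof
      fix t assume t: "t \<in> P"
      have sq: "\<bar>t\<^sup>2 - t0\<^sup>2\<bar> \<le> int D" and pos: "t \<ge> 0" "t0 \<ge> 0"
        using t t0(1) assms(2) e by (auto simp: P_def power_mult_distrib)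
      show "t \<in> {t0..t0 + int D}"
      proof (cases "t = t0")
        case False
        then have "t > t0" using t0(2)[OF t] by linarith
        then have "(t - t0) * 1 \<le> (t - t0) * (t + t0)" using pos by (intro mult_left_mono) auto
        also have "\<dots> = t\<^sup>2 - t0\<^sup>2" by (simp add: power2_eq_square algebra_simps)
        finally show ?thesis using sq \<open>t > t0\<close> by auto
      qed auto
    qed
    then have "card P \<le> card {t0..t0 + int D}" by (intro card_mono) auto
    moreover have "card P = card {t\<in>T. e * t \<ge> 0}"
      unfolding P_def using e by (intro card_image) (auto simp: inj_on_def)
    ultimately show ?thesis by simp
  qed
  have "T = {t\<in>T. 1 * t \<ge> 0} \<union> {t\<in>T. (-1) * t \<ge> 0}" by auto
  then have "card T \<le> card {t\<in>T. 1 * t \<ge> 0} + card {t\<in>T. (-1) * t \<ge> 0}" by (metis (lifting) card_Un_le)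
  then show ?thesis using half[of 1] half[of "-1"] by simp
qed

text \<open>\<open>E\<close> is complex because the eigenvalue equation does not presuppose a real
  eigenvalue.\<close>

definition annulus :: "complex \<Rightarrow> real \<Rightarrow> (int \<times> int) set" where
  "annulus E K = {n. cmod (E - of_int (idot n n)) \<le> K}"

definition line_count :: "real \<Rightarrow> int \<times> int \<Rightarrow> nat" where
  "line_count K m = 2 * (nat \<lceil>2 * K * of_int (idot m m)\<rceil> + 1)"

text \<open>Lagrange's identity \<open>|m|^2 |n|^2 = (n.m)^2 + t^2\<close>, with \<open>t\<close>
  the cross product of \<open>n\<close> and \<open>m\<close>: on the line \<open>n.m = x\<close> the
  point is determined by \<open>t\<close>, and the annulus lets \<open>t^2\<close> vary by at most
  \<open>2 K |m|^2\<close>. The bound depends neither on \<open>x\<close> nor on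
  \<open>E\<close>.\<close>

lemma card_annulus_line:
  assumes "finite F" "F \<subseteq> annulus E K" "m \<noteq> 0" "\<And>n. n \<in> F \<Longrightarrow> idot n m = x"
  shows "card F \<le> line_count K m"
proof -
  define t where "t n = fst n * snd m - snd n * fst m" for n
  have mm: "idot m m > 0" using idot_self_pos[OF assms(3)] .
  have lag: "idot m m * idot n n = x\<^sup>2 + (t n)\<^sup>2" if "n \<in> F" for n
  proof -
    have "idot m m * idot n n = (idot n m)\<^sup>2 + (t n)\<^sup>2"
      by (simp add: idot_def t_def power2_eq_square algebra_simps)
    then show ?thesis using assms(4)[OF that] by simp
  qed
  have "inj_on t F"
  proof (rule inj_onI)
    fix n n' assume n: "n \<in> F" "n' \<in> F" "t n = t n'"
    have "idot m m * fst n = idot n m * fst m + t n * snd m" "idot m m * snd n = idot n m * snd m - t n * fst m" for n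
      by (simp_all add: idot_def t_def algebra_simps)
    then have "idot m m * fst n = idot m m * fst n'" "idot m m * snd n = idot m m * snd n'"
      using n assms(4) by simp_all
    then show "n = n'" using mm by (simp add: prod_eq_iff)
  qed
  then have "card F = card (t ` F)" by (simp add: card_image)
  also have "\<dots> \<le> 2 * (nat \<lceil>2 * K * of_int (idot m m)\<rceil> + 1)"
  proof (rule card_near_squares)
    show "finite (t ` F)" using assms(1) by simp
    fix u u' assume "u \<in> t ` F" "u' \<in> t ` F"
    then obtain n n' where n: "n \<in> F" "n' \<in> F" "u = t n" "u' = t n'" by auto
    have "cmod (E - of_int (idot n n)) \<le> K" "cmod (E - of_int (idot n' n')) \<le> K"
      using n assms(2) by (auto simp: annulus_def)
    then have "cmod ((E - of_int (idot n n)) - (E - of_int (idot n' n'))) \<le> K + K"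
      using norm_triangle_ineq4[of "E - of_int (idot n n)" "E - of_int (idot n' n')"] by linarith
    then have "cmod (of_real (real_of_int (idot n' n' - idot n n))) \<le> K + K" by simp
    then have le: "\<bar>real_of_int (idot n' n' - idot n n)\<bar> \<le> 2 * K" by (simp only: norm_of_real)
    have "u\<^sup>2 - u'\<^sup>2 = idot m m * (idot n n - idot n' n')"
      using lag[OF n(1)] lag[OF n(2)] n by (simp add: algebra_simps)
    then have "\<bar>real_of_int (u\<^sup>2 - u'\<^sup>2)\<bar> = real_of_int (idot m m) * \<bar>real_of_int (idot n' n' - idot n n)\<bar>"
      using mm by (simp add: abs_mult abs_minus_commute)
    also have "\<dots> \<le> real_of_int (idot m m) * (2 * K)"
      using mm le by (intro mult_left_mono) auto
    finally have "real_of_int \<bar>u\<^sup>2 - u'\<^sup>2\<bar> \<le> 2 * K * of_int (idot m m)"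
      by (simp only: of_int_abs mult_ac)
    then have "real_of_int \<bar>u\<^sup>2 - u'\<^sup>2\<bar> \<le> of_int \<lceil>2 * K * of_int (idot m m)\<rceil>"
      using le_of_int_ceiling order_trans by blast
    then have "\<bar>u\<^sup>2 - u'\<^sup>2\<bar> \<le> \<lceil>2 * K * of_int (idot m m)\<rceil>" by (simp only: of_int_le_iff)
    then show "\<bar>u\<^sup>2 - u'\<^sup>2\<bar> \<le> int (nat \<lceil>2 * K * of_int (idot m m)\<rceil>)"
      by (rule order_trans) simp
  qed
  finally show ?thesis by (simp add: line_count_def)
qed

lemma sum_inverse_squares_annulus:
  assumes "finite F" "F \<subseteq> annulus E K" "m \<noteq> 0" "\<And>n. n \<in> F \<Longrightarrow> idot n m \<noteq> 0"
  shows "(\<Sum>n\<in>F. 1 / (real_of_int (idot n m))\<^sup>2) \<le> 4 * real (line_count K m)"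
proof -
  have "(\<Sum>n\<in>F. 1 / (real_of_int (idot n m))\<^sup>2) =
      (\<Sum>x\<in>(\<lambda>n. idot n m) ` F. \<Sum>n | n \<in> F \<and> idot n m = x. 1 / (real_of_int (idot n m))\<^sup>2)"
    by (rule sum.image_gen[OF assms(1)])
  also have "\<dots> = (\<Sum>x\<in>(\<lambda>n. idot n m) ` F. card {n\<in>F. idot n m = x} * (1 / (real_of_int x)\<^sup>2))"
    by (intro sum.cong) auto
  also have "\<dots> \<le> (\<Sum>x\<in>(\<lambda>n. idot n m) ` F. line_count K m * (1 / (real_of_int x)\<^sup>2))"
  proof (intro sum_mono mult_right_mono)
    show "real (card {n\<in>F. idot n m = x}) \<le> line_count K m" for x
      unfolding of_nat_le_iff by (rule card_annulus_line[where x = x and E = E]) (use assms in auto)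
  qed auto
  also have "\<dots> = line_count K m * (\<Sum>x\<in>(\<lambda>n. idot n m) ` F. 1 / (real_of_int x)\<^sup>2)"
    by (simp add: sum_distrib_left)
  also have "\<dots> \<le> real (line_count K m) * 4"
    using assms by (intro mult_left_mono sum_inverse_squares_int_le) auto
  finally show ?thesis by simp
qed

lemma card_annulus_strip:
  assumes "finite F" "F \<subseteq> annulus E K" "m \<noteq> 0" "\<And>n. n \<in> F \<Longrightarrow> \<bar>idot n m\<bar> \<le> b"
  shows "card F \<le> nat (2 * b + 1) * line_count K m"
proof -
  have eq: "(\<Union>x\<in>{-b..b}. {n\<in>F. idot n m = x}) = F" using assms(4) by force
  have "card (\<Union>x\<in>{-b..b}. {n\<in>F. idot n m = x}) \<le> (\<Sum>x\<in>{-b..b}. card {n\<in>F. idot n m = x})"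
    by (rule card_UN_le) simp
  then have "card F \<le> (\<Sum>x\<in>{-b..b}. card {n\<in>F. idot n m = x})" unfolding eq .
  also have "\<dots> \<le> (\<Sum>x\<in>{-b..b}. line_count K m)"
  proof (rule sum_mono)
    show "card {n\<in>F. idot n m = x} \<le> line_count K m" for x
      by (rule card_annulus_line[where x = x and E = E]) (use assms in auto)
  qed
  finally show ?thesis by (simp add: algebra_simps)
qed

lemma sum_power_abs_le:
  fixes r :: real
  assumes "0 < r" "r < 1" "finite F"
  shows "(\<Sum>n\<in>F. r ^ (nat \<bar>fst n\<bar> + nat \<bar>snd n\<bar>)) \<le> (2 / (1 - r))\<^sup>2"
proof -
  have one: "(\<Sum>j\<in>J. r ^ nat \<bar>j\<bar>) \<le> 2 / (1 - r)" if "finite J" for J :: "int set"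
  proof -
    define L where "L = nat (Max (insert 0 (abs ` J)))"
    have L: "nat \<bar>j\<bar> \<le> L" if "j \<in> J" for j
      unfolding L_def using that \<open>finite J\<close> by (intro nat_mono Max_ge) auto
    have geo: "(\<Sum>i\<le>L. r ^ i) \<le> 1 / (1 - r)"
    proof -
      have "(1 - r) * (\<Sum>i\<le>L. r ^ i) \<le> 1" using assms by (simp add: sum_gp_basic)
      then show ?thesis using assms by (simp add: pos_le_divide_eq mult.commute)
    qed
    have sub: "J \<subseteq> int ` {..L} \<union> (\<lambda>i. - int i) ` {..L}"
    proof
      fix j assume j: "j \<in> J"
      have "j = int (nat \<bar>j\<bar>) \<or> j = - int (nat \<bar>j\<bar>)" by auto
      then show "j \<in> int ` {..L} \<union> (\<lambda>i. - int i) ` {..L}" using L[OF j] by blast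
    qed
    have "(\<Sum>j\<in>J. r ^ nat \<bar>j\<bar>) \<le> (\<Sum>j\<in>int ` {..L} \<union> (\<lambda>i. - int i) ` {..L}. r ^ nat \<bar>j\<bar>)"
      using assms by (intro sum_mono2 sub) auto
    also have "\<dots> \<le> (\<Sum>j\<in>int ` {..L}. r ^ nat \<bar>j\<bar>) + (\<Sum>j\<in>(\<lambda>i. - int i) ` {..L}. r ^ nat \<bar>j\<bar>)"
      using assms by (subst sum.union_inter[symmetric]) (auto intro!: sum_nonneg)
    also have "\<dots> = (\<Sum>i\<le>L. r ^ i) + (\<Sum>i\<le>L. r ^ i)"
      by (subst (1 2) sum.reindex) (auto simp: inj_on_def)
    also have "\<dots> \<le> 2 / (1 - r)" using geo by simp
    finally show ?thesis .
  qed
  have "(\<Sum>n\<in>F. r ^ (nat \<bar>fst n\<bar> + nat \<bar>snd n\<bar>)) \<le>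
      (\<Sum>n\<in>fst ` F \<times> snd ` F. r ^ (nat \<bar>fst n\<bar> + nat \<bar>snd n\<bar>))"
    using assms by (intro sum_mono2) (auto intro: rev_image_eqI)
  also have "\<dots> = (\<Sum>i\<in>fst ` F. r ^ nat \<bar>i\<bar>) * (\<Sum>j\<in>snd ` F. r ^ nat \<bar>j\<bar>)"
    by (simp add: sum_product sum.cartesian_product power_add case_prod_unfold)
  also have "\<dots> \<le> 2 / (1 - r) * (2 / (1 - r))"
    using assms by (intro mult_mono one) (auto intro!: sum_nonneg)
  finally show ?thesis by (simp add: power2_eq_square)
qed

lemma norm_le_via: "norm c \<le> norm q + norm (q - c - s) + norm s" for c q s :: "'a::real_normed_vector"
proof -
  have "norm (q - ((q - c - s) + s)) \<le> norm q + (norm (q - c - s) + norm s)"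
    by (intro order_trans[OF norm_triangle_ineq4] add_left_mono norm_triangle_ineq)
  then show ?thesis by simp
qed

section \<open>Coefficients inside and outside the annulus\<close>

context potential
begin

text \<open>\<open>c n\<close> stands for the integral of the eigenfunction against \<open>mode n\<close>, without complex
  conjugation, and \<open>q\<close> for its integral against the quasimode at \<open>n\<close>.\<close>

definition eigen_coeffs :: "(int \<times> int \<Rightarrow> complex) \<Rightarrow> complex \<Rightarrow> real \<Rightarrow> bool" where
  "eigen_coeffs c E M \<longleftrightarrow> M \<ge> 0 \<and> (\<forall>n. cmod (c n) \<le> M)
    \<and> (\<forall>n. (E - of_int (idot n n)) * c n = (\<Sum>m\<in>set ms. V m * c (n + m)))
    \<and> (\<forall>n Xm Y. nonresonant n Xm Y \<and> C_phase \<le> Xm \<longrightarrow> (\<exists>q.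
        cmod ((E - of_int (idot n n) - shift n) * q) \<le> 3 * M * C_rem / (Xm ^ 2 * Y ^ 4) \<and>
        cmod (q - c n - (\<Sum>m\<in>set ms. - V m / of_int (symb n m) * c (n + m)))
          \<le> M * (C_phase + 3 * C_phase\<^sup>2) / Xm\<^sup>2))"

lemma eigen_coeffsD:
  assumes "eigen_coeffs c E M"
  shows "M \<ge> 0" "cmod (c n) \<le> M" "(E - of_int (idot n n)) * c n = (\<Sum>m\<in>set ms. V m * c (n + m))"
  using assms unfolding eigen_coeffs_def by blast+

lemma vnorm_eq: "vnorm = (\<Sum>m\<in>set ms. cmod (V m))"
proof -
  have "coeff_norm (map (\<lambda>m. (V m, m)) ls) = (\<Sum>m\<leftarrow>ls. cmod (V m))" for ls
    by (induction ls) auto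
  then show ?thesis using distinct_ms by (simp add: vnorm_def vs_def sum.distinct_set_conv_list)
qed

text \<open>Makes \<open>2 vnorm <= K / 2\<close>, so that the part outside the annulus can be
  absorbed; the 2 is the loss from shifting the weights.\<close>

definition K :: real where "K = 4 * vnorm + 1"

lemma eigen_coeffs_outside:
  assumes "eigen_coeffs c E M"
  shows "cmod (E - of_int (idot n n)) * cmod (c n) \<le> (\<Sum>m\<in>set ms. cmod (V m) * cmod (c (n + m)))"
proof -
  have "(E - of_int (idot n n)) * c n = (\<Sum>m\<in>set ms. V m * c (n + m))"
    by (rule eigen_coeffsD[OF assms])
  then have "cmod (E - of_int (idot n n)) * cmod (c n) = cmod (\<Sum>m\<in>set ms. V m * c (n + m))"
    by (metis norm_mult)
  also have "\<dots> \<le> (\<Sum>m\<in>set ms. cmod (V m * c (n + m)))" by (rule norm_sum)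
  finally show ?thesis by (simp add: norm_mult)
qed

text \<open>The weights make the sum over all of \<open>\<int>\<^sup>2\<close> finite, so that it can be absorbed.\<close>

lemma weighted_sum_le:
  assumes ec: "eigen_coeffs c E M" and T: "\<And>F. finite F \<Longrightarrow> F \<subseteq> annulus E K \<Longrightarrow> (\<Sum>n\<in>F. cmod (c n)) \<le> T"
    and r: "0 < r" "r < 1" "1 / 2 \<le> r ^ nat (2 * k)" and F: "finite F"
  shows "(\<Sum>n\<in>F. cmod (c n) * r ^ (nat \<bar>fst n\<bar> + nat \<bar>snd n\<bar>)) \<le> 2 * T"
proof -
  define g where "g n = r ^ (nat \<bar>fst n\<bar> + nat \<bar>snd n\<bar>)" for n :: "int \<times> int"
  define U where "U = (\<lambda>F. \<Sum>n\<in>F. cmod (c n) * g n) ` {F. finite F}"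
  \<comment> \<open>The supremum is finite because the coefficients are bounded by \<open>M\<close>
    and the weights are summable. Only with a finite \<open>s\<close> does
    \<open>s <= T + s / 2\<close> give \<open>s <= 2 T\<close>.\<close>
  define s where "s = Sup U"
  have M: "M \<ge> 0" "cmod (c n) \<le> M" for n using eigen_coeffsD[OF ec] by auto
  have bdd: "bdd_above U"
    unfolding bdd_above_def
  proof (intro exI ballI)
    fix u assume "u \<in> U"
    then obtain F where F: "finite F" "u = (\<Sum>n\<in>F. cmod (c n) * g n)" by (auto simp: U_def)
    have "u \<le> (\<Sum>n\<in>F. M * g n)" unfolding F(2) using M r by (intro sum_mono mult_right_mono) (auto simp: g_def)
    also have "\<dots> = M * (\<Sum>n\<in>F. r ^ (nat \<bar>fst n\<bar> + nat \<bar>snd n\<bar>))" by (simp add: sum_distrib_left g_def)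
    also have "\<dots> \<le> M * (2 / (1 - r))\<^sup>2" using M r F by (intro mult_left_mono sum_power_abs_le) auto
    finally show "u \<le> M * (2 / (1 - r))\<^sup>2" .
  qed
  have le_s: "(\<Sum>n\<in>F. cmod (c n) * g n) \<le> s" if "finite F" for F
    unfolding s_def using that by (intro cSup_upper bdd) (auto simp: U_def)
  have s0: "s \<ge> 0" using le_s[of "{}"] by simp
  \<comment> \<open>A shift by a frequency of \<open>V\<close> raises the exponent by at most
    \<open>2 k\<close>, so the hypothesis on \<open>r\<close> limits the loss to a factor 2.\<close>
  have shift: "g n \<le> 2 * g (n + m)" if "m \<in> set ms" for n m
  proof -
    let ?e = "\<lambda>n :: int \<times> int. nat \<bar>fst n\<bar> + nat \<bar>snd n\<bar>"
    have nat_abs: "nat \<bar>i + j\<bar> \<le> nat \<bar>i\<bar> + nat k" if "\<bar>j\<bar> \<le> k" for i j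
    proof -
      have "nat \<bar>i + j\<bar> \<le> nat (\<bar>i\<bar> + k)" using that by (intro nat_mono) linarith
      then show ?thesis using k_nonneg by (simp add: nat_add_distrib)
    qed
    have "nat (2 * k) = nat k + nat k" using k_nonneg by (simp add: nat_add_distrib[symmetric])
    then have "?e (n + m) \<le> ?e n + nat (2 * k)"
      using ms_bound[OF that] nat_abs[of "fst m" "fst n"] nat_abs[of "snd m" "snd n"] by simp
    then have "r ^ (?e n + nat (2 * k)) \<le> r ^ ?e (n + m)" using r by (intro power_decreasing) auto
    moreover have "r ^ ?e n * (1 / 2) \<le> r ^ ?e n * r ^ nat (2 * k)" using r by (intro mult_left_mono) auto
    ultimately show ?thesis by (simp add: g_def power_add)
  qed
  have K0: "K > 0" using vnorm_nonneg by (simp add: K_def)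
  have main: "(\<Sum>n\<in>F. cmod (c n) * g n) \<le> T + s / 2" if F: "finite F" for F
  proof -
    define F1 F2 where "F1 = F \<inter> annulus E K" and "F2 = F - annulus E K"
    have split: "(\<Sum>n\<in>F. cmod (c n) * g n) = (\<Sum>n\<in>F1. cmod (c n) * g n) + (\<Sum>n\<in>F2. cmod (c n) * g n)"
      unfolding F1_def F2_def by (rule sum.Int_Diff[OF F])
    have "(\<Sum>n\<in>F1. cmod (c n) * g n) \<le> (\<Sum>n\<in>F1. cmod (c n) * 1)"
      using r by (intro sum_mono mult_left_mono) (auto simp: g_def power_le_one)
    also have "\<dots> \<le> T" using T[of F1] F by (simp add: F1_def)
    finally have 1: "(\<Sum>n\<in>F1. cmod (c n) * g n) \<le> T" .
    have "K * (\<Sum>n\<in>F2. cmod (c n) * g n) = (\<Sum>n\<in>F2. (K * cmod (c n)) * g n)"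
      by (simp add: sum_distrib_left mult.assoc)
    also have "\<dots> \<le> (\<Sum>n\<in>F2. (\<Sum>m\<in>set ms. cmod (V m) * cmod (c (n + m))) * g n)"
    proof (intro sum_mono mult_right_mono)
      fix n assume "n \<in> F2"
      then have "K * cmod (c n) \<le> cmod (E - of_int (idot n n)) * cmod (c n)"
        by (intro mult_right_mono) (auto simp: F2_def annulus_def)
      then show "K * cmod (c n) \<le> (\<Sum>m\<in>set ms. cmod (V m) * cmod (c (n + m)))"
        using eigen_coeffs_outside[OF ec, of n] by linarith
    qed (use r in \<open>auto simp: g_def\<close>)
    also have "\<dots> = (\<Sum>n\<in>F2. \<Sum>m\<in>set ms. cmod (V m) * (cmod (c (n + m)) * g n))"
      by (simp add: sum_distrib_right mult.assoc)
    also have "\<dots> \<le> (\<Sum>n\<in>F2. \<Sum>m\<in>set ms. cmod (V m) * (cmod (c (n + m)) * (2 * g (n + m))))"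
      by (intro sum_mono mult_left_mono shift) auto
    also have "\<dots> = (\<Sum>m\<in>set ms. 2 * cmod (V m) * (\<Sum>n\<in>F2. cmod (c (n + m)) * g (n + m)))"
      by (subst sum.swap) (simp add: sum_distrib_left mult_ac)
    also have "\<dots> \<le> (\<Sum>m\<in>set ms. 2 * cmod (V m) * s)"
    proof (intro sum_mono mult_left_mono)
      fix m
      have "(\<Sum>n\<in>F2. cmod (c (n + m)) * g (n + m)) = (\<Sum>n\<in>(\<lambda>n. n + m) ` F2. cmod (c n) * g n)"
        by (subst sum.reindex) (auto simp: inj_on_def)
      also have "\<dots> \<le> s" using F by (intro le_s) (auto simp: F2_def)
      finally show "(\<Sum>n\<in>F2. cmod (c (n + m)) * g (n + m)) \<le> s" .
    qed auto
    also have "\<dots> = 2 * vnorm * s" by (simp add: vnorm_eq sum_distrib_left sum_distrib_right)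
    also have "\<dots> \<le> K * (s / 2)"
    proof -
      have "2 * vnorm \<le> K / 2" by (simp add: K_def)
      then have "2 * vnorm * s \<le> K / 2 * s" using s0 by (rule mult_right_mono)
      then show ?thesis by simp
    qed
    finally have 2: "(\<Sum>n\<in>F2. cmod (c n) * g n) \<le> s / 2" using K0 by simp
    show ?thesis using split 1 2 by linarith
  qed
  have "s \<le> T + s / 2"
    unfolding s_def by (rule cSup_least) (use main in \<open>auto simp: U_def s_def\<close>)
  then show ?thesis using le_s[OF F] by (simp add: g_def)
qed

text \<open>The weighted bound \<open>2 T\<close> does not depend on \<open>r\<close>; for a fixed
  finite set \<open>r\<close> may tend to 1.\<close>

lemma sum_le_annulus:
  assumes ec: "eigen_coeffs c E M" and T: "\<And>F. finite F \<Longrightarrow> F \<subseteq> annulus E K \<Longrightarrow> (\<Sum>n\<in>F. cmod (c n)) \<le> T"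
    and F: "finite F"
  shows "(\<Sum>n\<in>F. cmod (c n)) \<le> 2 * T"
proof (rule tendsto_upperbound)
  let ?f = "\<lambda>r::real. (\<Sum>n\<in>F. cmod (c n) * r ^ (nat \<bar>fst n\<bar> + nat \<bar>snd n\<bar>))"
  have "(?f \<longlongrightarrow> (\<Sum>n\<in>F. cmod (c n) * 1 ^ (nat \<bar>fst n\<bar> + nat \<bar>snd n\<bar>))) (at_left 1)"
    by (intro tendsto_intros)
  then show "(?f \<longlongrightarrow> (\<Sum>n\<in>F. cmod (c n))) (at_left 1)" by simp
  have "((\<lambda>r::real. r ^ nat (2 * k)) \<longlongrightarrow> 1 ^ nat (2 * k)) (at_left 1)" by (intro tendsto_intros)
  then have "eventually (\<lambda>r::real. 1 / 2 < r ^ nat (2 * k)) (at_left 1)"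
    by (rule order_tendstoD) simp
  moreover have "eventually (\<lambda>r::real. r \<in> {0<..<1}) (at_left 1)"
    by (rule eventually_at_left_real) simp
  ultimately show "eventually (\<lambda>r. ?f r \<le> 2 * T) (at_left 1)"
    by eventually_elim (use weighted_sum_le[OF ec T _ _ _ F] in auto)
qed simp

definition small_modes :: "(int \<times> int) set" where "small_modes = {m. in_box m \<and> m \<noteq> 0}"

lemma finite_small_modes: "finite small_modes"
proof (rule finite_subset)
  show "small_modes \<subseteq> {-3*k..3*k} \<times> {-3*k..3*k}" by (auto simp: small_modes_def in_box_def)
qed auto

lemma ms_subset_small_modes: "set ms \<subseteq> small_modes"
  using in_box_ms zero_notin_ms by (auto simp: small_modes_def)

definition wmin :: real where "wmin = Min (weight ` set ms)"

lemma wmin: "wmin > 0" "m \<in> set ms \<Longrightarrow> wmin \<le> weight m"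
  using ms_nonempty weight_pos by (auto simp: wmin_def)

definition C1 :: real where "C1 = 3 * C_rem + C_phase + 3 * C_phase\<^sup>2 + 2 * vnorm\<^sup>2"

text \<open>The pairing with the quasimode is its residual divided by the energy gap, hence
  O(Xm^-2). It differs from \<open>c n\<close> by a first-order term with factors
  \<open>1 / symb n m\<close> and by O(Xm^-2); the first-order term is small because the
  neighbouring coefficients are small as well.\<close>

lemma bad_coeff_le:
  assumes ec: "eigen_coeffs c E M" and n: "n \<in> annulus E K" and nr: "nonresonant n Xm Y"
    and Xm: "C_phase \<le> Xm" "2 * K \<le> Xm"
    and bad: "cmod (E - of_int (idot n n) - shift n) \<ge> 1 / Y ^ 4"
  shows "cmod (c n) \<le> C1 * M * (1 / Xm\<^sup>2)"
proof -
  have XY: "Xm \<ge> 1" "Y \<ge> 1" using nr by (auto simp: nonresonant_def)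
  have M: "M \<ge> 0" "cmod (c n) \<le> M" for n using eigen_coeffsD[OF ec] by auto
  obtain q where q: "cmod ((E - of_int (idot n n) - shift n) * q) \<le> 3 * M * C_rem / (Xm ^ 2 * Y ^ 4)"
    "cmod (q - c n - (\<Sum>m\<in>set ms. - V m / of_int (symb n m) * c (n + m))) \<le> M * (C_phase + 3 * C_phase\<^sup>2) / Xm\<^sup>2"
    using ec nr Xm unfolding eigen_coeffs_def by blast
  have "1 / Y ^ 4 * cmod q \<le> cmod (E - of_int (idot n n) - shift n) * cmod q"
    using bad by (intro mult_right_mono) auto
  also have "\<dots> \<le> 3 * M * C_rem / (Xm ^ 2 * Y ^ 4)" using q(1) by (simp add: norm_mult)
  finally have q': "cmod q \<le> 3 * M * C_rem / Xm\<^sup>2" using XY by (simp add: field_simps)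
  \<comment> \<open>For \<open>n\<close> in the annulus, \<open>n + m\<close> is off the circle by
    at least \<open>Xm - K >= Xm / 2\<close>, so the equation at \<open>n + m\<close> gains a factor
    \<open>1 / Xm\<close>.\<close>
  have nb: "cmod (c (n + m)) \<le> 2 * M * vnorm / Xm" if m: "m \<in> set ms" for m
  proof -
    have "Y \<le> \<bar>real_of_int (symb n m)\<bar>" by (rule symb_ge_ms[OF nr m])
    then have sy: "Xm \<le> \<bar>real_of_int (symb n m)\<bar>" using nr by (auto simp: nonresonant_def)
    have "idot (n + m) (n + m) = idot n n + symb n m"
      by (simp add: idot_add symb_def idot_commute[of m n])
    then have "complex_of_int (symb n m) = (E - of_int (idot n n)) - (E - of_int (idot (n + m) (n + m)))" by simp
    then have "cmod (of_int (symb n m)) \<le> cmod (E - of_int (idot n n)) + cmod (E - of_int (idot (n + m) (n + m)))"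
      by (metis norm_triangle_ineq4)
    then have "Xm / 2 \<le> cmod (E - of_int (idot (n + m) (n + m)))"
      using sy n Xm by (simp add: annulus_def)
    then have "Xm / 2 * cmod (c (n + m)) \<le> cmod (E - of_int (idot (n + m) (n + m))) * cmod (c (n + m))"
      by (rule mult_right_mono) simp
    also have "\<dots> \<le> (\<Sum>l\<in>set ms. cmod (V l) * cmod (c (n + m + l)))" by (rule eigen_coeffs_outside[OF ec])
    also have "\<dots> \<le> (\<Sum>l\<in>set ms. cmod (V l) * M)" by (intro sum_mono mult_left_mono M) auto
    also have "\<dots> = vnorm * M" by (simp add: vnorm_eq sum_distrib_right)
    finally show ?thesis using XY by (simp add: field_simps)
  qed
  have "cmod (\<Sum>m\<in>set ms. - V m / of_int (symb n m) * c (n + m)) \<le>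
      (\<Sum>m\<in>set ms. cmod (V m) * (1 / Xm * (2 * M * vnorm / Xm)))"
  proof (rule order_trans[OF norm_sum], rule sum_mono)
    fix m assume m: "m \<in> set ms"
    have "Y \<le> \<bar>real_of_int (symb n m)\<bar>" by (rule symb_ge_ms[OF nr m])
    then have "Xm \<le> \<bar>real_of_int (symb n m)\<bar>" using nr by (auto simp: nonresonant_def)
    then have "1 / \<bar>real_of_int (symb n m)\<bar> \<le> 1 / Xm" using XY by (intro divide_left_mono) auto
    then have "cmod (V m) * (1 / \<bar>real_of_int (symb n m)\<bar> * cmod (c (n + m))) \<le> cmod (V m) * (1 / Xm * (2 * M * vnorm / Xm))"
      using nb[OF m] XY by (intro mult_left_mono mult_mono) auto
    then show "cmod (- V m / of_int (symb n m) * c (n + m)) \<le> cmod (V m) * (1 / Xm * (2 * M * vnorm / Xm))"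
      by (simp add: norm_mult norm_divide)
  qed
  also have "\<dots> = vnorm * (1 / Xm * (2 * M * vnorm / Xm))" by (simp only: vnorm_eq sum_distrib_right)
  also have "\<dots> = 2 * M * vnorm\<^sup>2 / Xm\<^sup>2" by (simp add: power2_eq_square)
  finally have s: "cmod (\<Sum>m\<in>set ms. - V m / of_int (symb n m) * c (n + m)) \<le> 2 * M * vnorm\<^sup>2 / Xm\<^sup>2" .
  let ?s = "\<Sum>m\<in>set ms. - V m / of_int (symb n m) * c (n + m)"
  have "cmod (c n) \<le> cmod q + cmod (q - c n - ?s) + cmod ?s" by (rule norm_le_via)
  then have "cmod (c n) \<le> 3 * M * C_rem / Xm\<^sup>2 + M * (C_phase + 3 * C_phase\<^sup>2) / Xm\<^sup>2 + 2 * M * vnorm\<^sup>2 / Xm\<^sup>2"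
    using q' q(2) s by linarith
  also have "\<dots> = C1 * M * (1 / Xm\<^sup>2)" using XY by (simp add: C1_def field_simps)
  finally show ?thesis .
qed

lemma C1_nonneg: "C1 \<ge> 0"
  using \<kappa>_nonneg vnorm_nonneg by (simp add: C1_def C_rem_def C_phase_def)

lemma C_shift_nonneg: "C_shift \<ge> 0"
  using \<kappa>_nonneg vnorm_nonneg by (simp add: C_shift_def sum_nonneg)

theorem sum_eigen_coeffs_bounded:
  "\<exists>C. \<forall>c E F. eigen_coeffs c E M \<longrightarrow> finite F \<longrightarrow> (\<Sum>n\<in>F. cmod (c n)) \<le> C"
proof -
  \<comment> \<open>An energy error \<open>(1 + C_shift) / Y^4\<close> is at most
    \<open>Cg S^2\<close>, because \<open>S >= wmin / Y^2\<close>.\<close>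
  define Cg where "Cg = (1 + C_shift) / wmin\<^sup>2"
  have Cg: "Cg > 0" using C_shift_nonneg wmin by (simp add: Cg_def)
  from card_near_energy[OF Cg] obtain \<epsilon> where \<epsilon>: "\<epsilon> > 0" and
    "\<exists>N. \<forall>F E. finite F \<longrightarrow> (\<forall>n\<in>F. near_energy Cg \<epsilon> E n) \<longrightarrow> card F \<le> N" by blast
  then obtain Ng where all: "\<forall>F E. finite F \<longrightarrow> (\<forall>n\<in>F. near_energy Cg \<epsilon> E n) \<longrightarrow> card F \<le> Ng" by (elim exE)
  have Ng: "card F \<le> Ng" if "finite F" "\<forall>n\<in>F. near_energy Cg \<epsilon> E n" for F E
    by (rule all[THEN spec[of _ F], THEN spec[of _ E], THEN mp, THEN mp, OF that])
  define W where "W = (\<Sum>m\<in>set ms. weight m)"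
  have W: "W \<ge> 0" unfolding W_def using weight_pos by (intro sum_nonneg) (auto intro: less_imp_le)
  \<comment> \<open>Beyond this threshold all conditions on \<open>Xm\<close> hold at once: those of
    \<open>nonresonant\<close>, those of \<open>bad_coeff_le\<close>, and
    \<open>W / \<epsilon> <= Y\<close>, which makes \<open>S\<close> at most
    \<open>\<epsilon>\<close>.\<close>
  define b where "b = \<lceil>1 + \<kappa> + C_phase + 2 * K + W / \<epsilon>\<rceil>"
  have nn: "\<kappa> \<ge> 0" "C_phase \<ge> 0" "K \<ge> 0" "W / \<epsilon> \<ge> 0"
    using \<kappa>_nonneg vnorm_nonneg W \<epsilon> by (auto simp: C_phase_def K_def)
  have b: "1 + \<kappa> + C_phase + 2 * K + W / \<epsilon> \<le> of_int b" unfolding b_def by linarith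
  define Nr where "Nr = (\<Sum>m\<in>small_modes. nat (2 * b + 1) * line_count K m)"
  define Sg where "Sg = (\<Sum>m\<in>small_modes. 4 * real (line_count K m))"
  define T where "T = M * Nr + M * Ng + C1 * M * Sg"
  have ann: "(\<Sum>n\<in>F. cmod (c n)) \<le> T"
    if ec: "eigen_coeffs c E M" and F: "finite F" "F \<subseteq> annulus E K" for c E F
  proof -
    have M: "M \<ge> 0" "cmod (c n) \<le> M" for n using eigen_coeffsD[OF ec] by auto
    define R where "R = {n\<in>F. \<exists>m\<in>small_modes. \<bar>idot n m\<bar> \<le> b}"
    have R_eq: "R = (\<Union>m\<in>small_modes. {n\<in>F. \<bar>idot n m\<bar> \<le> b})" by (auto simp: R_def)
    have "card R \<le> (\<Sum>m\<in>small_modes. card {n\<in>F. \<bar>idot n m\<bar> \<le> b})"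
      unfolding R_eq by (rule card_UN_le[OF finite_small_modes])
    also have "\<dots> \<le> Nr" unfolding Nr_def
      by (intro sum_mono card_annulus_strip[where E = E]) (use F in \<open>auto simp: small_modes_def\<close>)
    finally have cR: "card R \<le> Nr" .
    define Xm Y where "Xm n = Min ((\<lambda>m. \<bar>real_of_int (idot n m)\<bar>) ` small_modes)"
      and "Y n = Min ((\<lambda>m. \<bar>real_of_int (idot n m)\<bar>) ` set ms)" for n
    have ne: "small_modes \<noteq> {}" "set ms \<noteq> {}" using ms_subset_small_modes ms_nonempty by auto
    have Xm: "\<exists>m\<in>small_modes. Xm n = \<bar>real_of_int (idot n m)\<bar>" "\<And>m. m \<in> small_modes \<Longrightarrow> Xm n \<le> \<bar>real_of_int (idot n m)\<bar>" for n
    proof -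
      have "Xm n \<in> (\<lambda>m. \<bar>real_of_int (idot n m)\<bar>) ` small_modes" unfolding Xm_def using finite_small_modes ne by (intro Min_in) auto
      then show "\<exists>m\<in>small_modes. Xm n = \<bar>real_of_int (idot n m)\<bar>" by auto
    qed (simp add: Xm_def finite_small_modes)
    have Y: "\<exists>m\<in>set ms. Y n = \<bar>real_of_int (idot n m)\<bar>" "\<And>m. m \<in> set ms \<Longrightarrow> Y n \<le> \<bar>real_of_int (idot n m)\<bar>" for n
    proof -
      have "Y n \<in> (\<lambda>m. \<bar>real_of_int (idot n m)\<bar>) ` set ms" unfolding Y_def using ne by (intro Min_in) auto
      then show "\<exists>m\<in>set ms. Y n = \<bar>real_of_int (idot n m)\<bar>" by auto
    qed (simp add: Y_def)
    have Xb: "Xm n \<ge> of_int b" if "n \<in> F - R" for n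
    proof -
      obtain m where m: "m \<in> small_modes" "Xm n = \<bar>real_of_int (idot n m)\<bar>" using Xm(1)[of n] by blast
      then have "b < \<bar>idot n m\<bar>" using that by (auto simp: R_def)
      then show ?thesis using m(2) by linarith
    qed
    have XY: "Xm n \<le> Y n" for n
    proof -
      obtain m where "m \<in> set ms" "Y n = \<bar>real_of_int (idot n m)\<bar>" using Y(1)[of n] by blast
      then show ?thesis using Xm(2)[of m n] ms_subset_small_modes by auto
    qed
    have nr: "nonresonant n (Xm n) (Y n)" if "n \<in> F - R" for n
      unfolding nonresonant_def
    proof (intro conjI allI impI ballI)
      show "1 \<le> Xm n" "\<kappa> \<le> Xm n" using Xb[OF that] b nn by linarith+
      show "Xm n \<le> \<bar>real_of_int (idot n m)\<bar>" if "in_box m" "m \<noteq> 0" for m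
        using Xm(2)[of m n] that by (simp add: small_modes_def)
    qed (use XY Y in auto)
    \<comment> \<open>The gap \<open>1 / Y^4\<close> is the largest order that
      \<open>near_energy\<close> tolerates and the smallest at which the residual still leaves
      \<open>1 / Xm^2\<close>.\<close>
    define G where "G = {n\<in>F - R. cmod (E - of_int (idot n n) - shift n) < 1 / Y n ^ 4}"
    have "card G \<le> Ng"
    proof (rule Ng[where E = "Re E"], use F in \<open>simp add: G_def\<close>, intro ballI)
      fix n assume "n \<in> G"
      then have n: "n \<in> F - R" "cmod (E - of_int (idot n n) - shift n) < 1 / Y n ^ 4" by (auto simp: G_def)
      note nrn = nr[OF n(1)]
      have Y1: "Y n \<ge> of_int b" using Xb[OF n(1)] XY[of n] by linarith
      have Y0: "Y n \<ge> 1" using Y1 b nn by linarith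
      have reg: "regular (rvec n)"
        unfolding regular_def
      proof
        fix m assume "m \<in> set ms"
        from Y(2)[OF this, of n] Y0 show "inner (rvec n) (rvec m) \<noteq> 0" by (auto simp: inner_rvec)
      qed
      have "S (rvec n) \<le> (\<Sum>m\<in>set ms. weight m / (Y n)\<^sup>2)"
        unfolding S_def
      proof (intro sum_mono divide_left_mono)
        fix m assume m: "m \<in> set ms"
        have "\<bar>Y n\<bar> \<le> \<bar>inner (rvec n) (rvec m)\<bar>" using Y(2)[OF m, of n] Y0 by (simp add: inner_rvec)
        then have le: "(Y n)\<^sup>2 \<le> (inner (rvec n) (rvec m))\<^sup>2" by (simp only: abs_le_square_iff)
        then show "(Y n)\<^sup>2 \<le> (inner (rvec n) (rvec m))\<^sup>2" .
        have "(Y n)\<^sup>2 > 0" using Y0 by simp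
        then show "0 < (inner (rvec n) (rvec m))\<^sup>2 * (Y n)\<^sup>2" using le by (intro mult_pos_pos) linarith+
        show "weight m \<ge> 0" using weight_pos[OF m] by simp
      qed
      also have "\<dots> = W / (Y n)\<^sup>2" by (simp add: W_def sum_divide_distrib)
      also have "\<dots> \<le> W / Y n" using Y0 W by (intro divide_left_mono) (auto simp: power2_eq_square)
      also have "\<dots> \<le> \<epsilon>"
      proof -
        have "W / \<epsilon> \<le> Y n" using Y1 b nn by linarith
        then show ?thesis using Y0 \<epsilon> by (simp add: field_simps)
      qed
      finally have Se: "S (rvec n) \<le> \<epsilon>" .
      \<comment> \<open>The frequency attaining the minimum \<open>Y n\<close> alone bounds
        \<open>S\<close> from below.\<close>
      obtain m where m: "m \<in> set ms" "Y n = \<bar>real_of_int (idot n m)\<bar>" using Y(1)[of n] by blast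
      have "wmin / (Y n)\<^sup>2 \<le> weight m / (inner (rvec n) (rvec m))\<^sup>2"
        using m wmin(2)[OF m(1)] by (simp add: inner_rvec divide_right_mono)
      also have "\<dots> \<le> S (rvec n)"
        unfolding S_def using m(1) by (intro member_le_sum divide_nonneg_nonneg less_imp_le[OF weight_pos]) auto
      finally have "wmin / (Y n)\<^sup>2 \<le> S (rvec n)" .
      then have "(wmin / (Y n)\<^sup>2)\<^sup>2 \<le> (S (rvec n))\<^sup>2"
        using wmin(1) by (intro power_mono) auto
      then have S2: "1 / Y n ^ 4 \<le> (S (rvec n))\<^sup>2 / wmin\<^sup>2"
        using wmin(1) Y0 by (simp add: power_divide field_simps flip: power_mult)
      have "cmod (E - of_int (idot n n) - of_real (S (rvec n))) \<le>
          cmod (E - of_int (idot n n) - shift n) + cmod (shift n - of_real (S (rvec n)))"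
        using norm_triangle_ineq[of "E - of_int (idot n n) - shift n" "shift n - of_real (S (rvec n))"]
        by (simp add: algebra_simps)
      also have "\<dots> \<le> 1 / Y n ^ 4 + C_shift / Y n ^ 4"
        using n(2) norm_shift_diff[OF nrn] by linarith
      also have "\<dots> = (1 + C_shift) * (1 / Y n ^ 4)" by (simp add: add_divide_distrib)
      also have "\<dots> \<le> (1 + C_shift) * ((S (rvec n))\<^sup>2 / wmin\<^sup>2)"
        using S2 C_shift_nonneg by (intro mult_left_mono) auto
      also have "\<dots> = Cg * (S (rvec n))\<^sup>2" by (simp add: Cg_def)
      finally have "cmod (E - of_int (idot n n) - of_real (S (rvec n))) \<le> Cg * (S (rvec n))\<^sup>2" .
      then have "\<bar>Re (E - of_int (idot n n) - of_real (S (rvec n)))\<bar> \<le> Cg * (S (rvec n))\<^sup>2"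
        using abs_Re_le_cmod order_trans by blast
      then have "\<bar>Re E - (norm (rvec n))\<^sup>2 - S (rvec n)\<bar> \<le> Cg * (S (rvec n))\<^sup>2"
        by (simp add: norm_rvec_sq)
      then show "near_energy Cg \<epsilon> (Re E) n"
        using reg Se by (simp add: near_energy_def)
    qed
    \<comment> \<open>The inverse square of the minimum \<open>Xm n\<close> is bounded by the sum
      over all small modes, so that afterwards each mode can be summed over the annulus
      separately.\<close>
    have bad: "cmod (c n) \<le> C1 * M * (\<Sum>m\<in>small_modes. 1 / (real_of_int (idot n m))\<^sup>2)" if n: "n \<in> F - R - G" for n
    proof -
      have n': "n \<in> F - R" "n \<in> annulus E K" using n F by auto
      have "cmod (c n) \<le> C1 * M * (1 / (Xm n)\<^sup>2)"
      proof (rule bad_coeff_le[OF ec n'(2) nr[OF n'(1)]])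
        show "C_phase \<le> Xm n" "2 * K \<le> Xm n" using Xb[OF n'(1)] b nn by linarith+
        show "1 / Y n ^ 4 \<le> cmod (E - of_int (idot n n) - shift n)" using n by (auto simp: G_def)
      qed
      also have "\<dots> \<le> C1 * M * (\<Sum>m\<in>small_modes. 1 / (real_of_int (idot n m))\<^sup>2)"
      proof (intro mult_left_mono)
        obtain m where m: "m \<in> small_modes" "Xm n = \<bar>real_of_int (idot n m)\<bar>" using Xm(1)[of n] by blast
        then have "1 / (Xm n)\<^sup>2 = 1 / (real_of_int (idot n m))\<^sup>2" by simp
        also have "\<dots> \<le> (\<Sum>m\<in>small_modes. 1 / (real_of_int (idot n m))\<^sup>2)"
          using m finite_small_modes by (intro member_le_sum) auto
        finally show "1 / (Xm n)\<^sup>2 \<le> (\<Sum>m\<in>small_modes. 1 / (real_of_int (idot n m))\<^sup>2)" .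
      qed (use C1_nonneg M in auto)
      finally show ?thesis .
    qed
    have const: "(\<Sum>n\<in>F'. cmod (c n)) \<le> M * real N" if "card F' \<le> N" for F' N
    proof -
      have "(\<Sum>n\<in>F'. cmod (c n)) \<le> (\<Sum>n\<in>F'. M)" by (intro sum_mono M)
      also have "\<dots> \<le> M * real N" using that M by (simp add: mult.commute mult_left_mono)
      finally show ?thesis .
    qed
    have "(\<Sum>n\<in>F - R - G. cmod (c n)) \<le> (\<Sum>n\<in>F - R - G. C1 * M * (\<Sum>m\<in>small_modes. 1 / (real_of_int (idot n m))\<^sup>2))"
      by (intro sum_mono bad)
    also have "\<dots> = C1 * M * (\<Sum>m\<in>small_modes. \<Sum>n\<in>F - R - G. 1 / (real_of_int (idot n m))\<^sup>2)"
      by (subst sum.swap) (simp add: sum_distrib_left)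
    also have "\<dots> \<le> C1 * M * Sg"
      unfolding Sg_def
    proof (intro mult_left_mono sum_mono)
      fix m assume m: "m \<in> small_modes"
      show "(\<Sum>n\<in>F - R - G. 1 / (real_of_int (idot n m))\<^sup>2) \<le> 4 * real (line_count K m)"
      proof (rule sum_inverse_squares_annulus[where E = E])
        show "idot n m \<noteq> 0" if "n \<in> F - R - G" for n
        proof -
          have "b < \<bar>idot n m\<bar>" using that m by (auto simp: R_def)
          moreover have "b \<ge> 0" using b nn by linarith
          ultimately show ?thesis by auto
        qed
      qed (use F m in \<open>auto simp: small_modes_def\<close>)
    qed (use C1_nonneg M in auto)
    finally have 3: "(\<Sum>n\<in>F - R - G. cmod (c n)) \<le> C1 * M * Sg" .
    have sub: "R \<subseteq> F" "G \<subseteq> F - R" by (auto simp: R_def G_def)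
    have "(\<Sum>n\<in>F. cmod (c n)) = (\<Sum>n\<in>F - R. cmod (c n)) + (\<Sum>n\<in>R. cmod (c n))"
      using F sub by (intro sum.subset_diff) auto
    also have "(\<Sum>n\<in>F - R. cmod (c n)) = (\<Sum>n\<in>F - R - G. cmod (c n)) + (\<Sum>n\<in>G. cmod (c n))"
      using F sub by (intro sum.subset_diff) auto
    finally show ?thesis
      using 3 const[OF cR] const[OF \<open>card G \<le> Ng\<close>] by (simp add: T_def)
  qed
  show ?thesis
    using sum_le_annulus ann by (intro exI[of _ "2 * T"]) blast
qed

end

section \<open>Eigenfunctions tested against quasimodes\<close>

lemma square_eq_cbox: "{-pi..pi} \<times> {-pi..pi} = cbox (-pi, -pi) (pi, pi)"
  by (subst cbox_Pair_eq) (simp only: cbox_interval)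

lemma space_T2: "space T2 = {-pi..pi} \<times> {-pi..pi}"
  by simp

lemma finite_measure_T2: "finite_measure T2"
  unfolding square_eq_cbox by (rule finite_measure_lebesgue_on) simp

lemma measure_T2: "measure T2 (space T2) = (2 * pi)\<^sup>2"
proof -
  have "measure T2 (space T2) = measure lebesgue (cbox (-pi, -pi) (pi, pi :: real))"
    unfolding space_T2 square_eq_cbox by (subst measure_restrict_space) auto
  also have "\<dots> = (2 * pi)\<^sup>2"
    by (simp add: content_Pair power2_eq_square)
  finally show ?thesis .
qed

lemma integrable_const_T2 [simp]: "integrable T2 (\<lambda>z. c :: 'a :: {banach, second_countable_topology})"
  using finite_measure.integrable_const[OF finite_measure_T2] .

lemma continuous_measurable_T2:
  fixes f :: "real \<times> real \<Rightarrow> 'a :: {euclidean_space}"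
  assumes "continuous_on UNIV f"
  shows "f \<in> borel_measurable T2"
  unfolding square_eq_cbox
  by (rule continuous_imp_measurable_on_sets_lebesgue[OF continuous_on_subset[OF assms]]) auto

lemma in_Lp_2_integrable:
  assumes "in_Lp 2 f"
  shows "integrable T2 f" "integrable T2 (\<lambda>z. (cmod (f z))\<^sup>2)"
proof -
  have m: "f \<in> borel_measurable T2" using assms by (simp add: in_Lp_def)
  have "(\<lambda>z. cmod (f z) powr 2) = (\<lambda>z. (cmod (f z))\<^sup>2)" by (auto simp: powr_numeral)
  then show sq: "integrable T2 (\<lambda>z. (cmod (f z))\<^sup>2)" using assms by (simp add: in_Lp_def)
  have "integrable T2 (\<lambda>z. 1 + (cmod (f z))\<^sup>2)" by (intro Bochner_Integration.integrable_add sq integrable_const_T2)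
  then show "integrable T2 f"
  proof (rule Bochner_Integration.integrable_bound[OF _ m], intro AE_I2)
    fix z
    have "0 \<le> (cmod (f z) - 1)\<^sup>2" by simp
    then have "2 * cmod (f z) \<le> 1 + (cmod (f z))\<^sup>2" by (simp add: power2_eq_square algebra_simps)
    then have "cmod (f z) \<le> 1 + (cmod (f z))\<^sup>2" using norm_ge_zero[of "f z"] by linarith
    then show "norm (f z) \<le> norm (1 + (cmod (f z))\<^sup>2)" by simp
  qed
qed

lemma continuous_bounded_square:
  fixes g :: "real \<times> real \<Rightarrow> complex"
  assumes "continuous_on UNIV g"
  obtains B where "\<And>z. z \<in> {-pi..pi} \<times> {-pi..pi} \<Longrightarrow> cmod (g z) \<le> B"
proof -
  have "compact (g ` ({-pi..pi} \<times> {-pi..pi}))"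
    by (intro compact_continuous_image continuous_on_subset[OF assms] compact_Times) auto
  then have "bounded (g ` ({-pi..pi} \<times> {-pi..pi}))" by (rule compact_imp_bounded)
  then show ?thesis using that by (auto simp: bounded_iff)
qed

lemma integrable_mult_continuous:
  fixes f g :: "real \<times> real \<Rightarrow> complex"
  assumes f: "integrable T2 f" and g: "continuous_on UNIV g"
  shows "integrable T2 (\<lambda>z. f z * g z)"
proof -
  obtain B where B: "\<And>z. z \<in> {-pi..pi} \<times> {-pi..pi} \<Longrightarrow> cmod (g z) \<le> B"
    using continuous_bounded_square[OF g] by blast
  have "integrable T2 (\<lambda>z. B * norm (f z))" using f by simp
  then show ?thesis
  proof (rule Bochner_Integration.integrable_bound)
    show "(\<lambda>z. f z * g z) \<in> borel_measurable T2"
      using f continuous_measurable_T2[OF g] by measurable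
    show "AE z in T2. norm (f z * g z) \<le> norm (B * norm (f z))"
    proof (intro AE_I2)
      fix z assume "z \<in> space T2"
      then have "cmod (g z) \<le> B" using B by (simp only: space_T2)
      then have "cmod (f z) * cmod (g z) \<le> cmod (f z) * \<bar>B\<bar>" by (intro mult_left_mono) auto
      then show "norm (f z * g z) \<le> norm (B * norm (f z))" by (simp add: norm_mult abs_mult mult.commute)
    qed
  qed
qed

lemma norm_integral_mult_le:
  fixes f g :: "real \<times> real \<Rightarrow> complex"
  assumes f: "integrable T2 f" and g: "continuous_on UNIV g" and B: "\<And>z. cmod (g z) \<le> B"
  shows "cmod (LINT z|T2. f z * g z) \<le> (LINT z|T2. cmod (f z)) * B"
proof -
  have "cmod (LINT z|T2. f z * g z) \<le> (LINT z|T2. cmod (f z * g z))" by (rule integral_norm_bound)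
  also have "\<dots> \<le> (LINT z|T2. cmod (f z) * B)"
  proof (rule integral_mono)
    show "integrable T2 (\<lambda>z. cmod (f z * g z))"
      by (rule integrable_norm[OF integrable_mult_continuous[OF f g]])
    show "integrable T2 (\<lambda>z. cmod (f z) * B)" using f by simp
    show "cmod (f z * g z) \<le> cmod (f z) * B" for z
      unfolding norm_mult using B by (rule mult_left_mono) simp
  qed
  finally show ?thesis by simp
qed

lemma continuous_ev [continuous_intros]: "continuous_on A (ev xs)"
proof (induction xs)
  case Nil
  have "ev [] = (\<lambda>z. 0)" by (rule ext) simp
  then show ?case by simp
next
  case (Cons p xs)
  have "ev (p # xs) = (\<lambda>z. fst p * mode (snd p) z + ev xs z)" by (rule ext) simp
  then show ?case using Cons by (simp add: continuous_intros)
qed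

lemma mode_periodic: "mode n (x + 2 * pi, y) = mode n (x, y)" "mode n (x, y + 2 * pi) = mode n (x, y)"
proof -
  have c: "cis (2 * pi * of_int j) = 1" for j by (intro cis_multiple_2pi) simp
  have "mode n (x + 2 * pi, y) = mode n (x, y) * cis (2 * pi * of_int (fst n))"
    by (simp add: mode_def cis_mult algebra_simps)
  then show "mode n (x + 2 * pi, y) = mode n (x, y)" by (simp add: c)
  have "mode n (x, y + 2 * pi) = mode n (x, y) * cis (2 * pi * of_int (snd n))"
    by (simp add: mode_def cis_mult algebra_simps)
  then show "mode n (x, y + 2 * pi) = mode n (x, y)" by (simp add: c)
qed

lemma ev_periodic: "ev xs (x + 2 * pi, y) = ev xs (x, y)" "ev xs (x, y + 2 * pi) = ev xs (x, y)"
  by (induction xs) (auto simp: mode_periodic)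

lemma mode_deriv:
  "((\<lambda>t. mode n (z + t *\<^sub>R (1, 0))) has_vector_derivative (\<i> * of_int (fst n) * mode n z)) (at 0)"
  "((\<lambda>t. mode n (z + t *\<^sub>R (0, 1))) has_vector_derivative (\<i> * of_int (snd n) * mode n z)) (at 0)"
proof -
  have chain: "((\<lambda>t. cis (a + b * t)) has_vector_derivative (\<i> * of_real b * cis a)) (at 0)" for a b :: real
  proof -
    have "((\<lambda>t. \<i> * of_real (a + b * t)) has_vector_derivative (\<i> * of_real b)) (at 0)"
      unfolding has_vector_derivative_def
      by (auto intro!: derivative_eq_intros simp: scaleR_conv_of_real)
    from field_vector_diff_chain_at[OF this DERIV_exp]
    show ?thesis by (simp add: o_def cis_conv_exp)
  qed
  show "((\<lambda>t. mode n (z + t *\<^sub>R (1, 0))) has_vector_derivative (\<i> * of_int (fst n) * mode n z)) (at 0)"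
    using chain[of "of_int (fst n) * fst z + of_int (snd n) * snd z" "of_int (fst n)"]
    by (simp add: mode_def algebra_simps)
  show "((\<lambda>t. mode n (z + t *\<^sub>R (0, 1))) has_vector_derivative (\<i> * of_int (snd n) * mode n z)) (at 0)"
    using chain[of "of_int (fst n) * fst z + of_int (snd n) * snd z" "of_int (snd n)"]
    by (simp add: mode_def algebra_simps)
qed

lemma ev_deriv:
  "((\<lambda>t. ev xs (z + t *\<^sub>R (1, 0))) has_vector_derivative ev (dx xs) z) (at 0)"
  "((\<lambda>t. ev xs (z + t *\<^sub>R (0, 1))) has_vector_derivative ev (dy xs) z) (at 0)"
proof (induction xs)
  case (Cons p xs)
  {
    case 1
    have "((\<lambda>t. fst p * mode (snd p) (z + t *\<^sub>R (1, 0)) + ev xs (z + t *\<^sub>R (1, 0))) has_vector_derivative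
        (fst p * (\<i> * of_int (fst (snd p)) * mode (snd p) z) + ev (dx xs) z)) (at 0)"
      by (intro has_vector_derivative_add has_vector_derivative_mult_right mode_deriv Cons)
    then show ?case by (simp add: mult_ac)
  next
    case 2
    have "((\<lambda>t. fst p * mode (snd p) (z + t *\<^sub>R (0, 1)) + ev xs (z + t *\<^sub>R (0, 1))) has_vector_derivative
        (fst p * (\<i> * of_int (snd (snd p)) * mode (snd p) z) + ev (dy xs) z)) (at 0)"
      by (intro has_vector_derivative_add has_vector_derivative_mult_right mode_deriv Cons)
    then show ?case by (simp add: mult_ac)
  }
qed simp_all

text \<open>A smooth periodic function, hence an admissible test function; with the empty phase it
  is the plane wave itself.\<close>

definition wave :: "int \<times> int \<Rightarrow> trig \<Rightarrow> real \<times> real \<Rightarrow> complex" where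
  "wave n w z = mode n z * exp (ev w z)"

lemma continuous_wave [continuous_intros]: "continuous_on A (wave n w)"
  unfolding wave_def by (intro continuous_intros)

lemma wave_deriv:
  "((\<lambda>t. wave n w (z + t *\<^sub>R (1, 0))) has_vector_derivative wave n w z * (\<i> * of_int (fst n) + ev (dx w) z)) (at 0)"
  "((\<lambda>t. wave n w (z + t *\<^sub>R (0, 1))) has_vector_derivative wave n w z * (\<i> * of_int (snd n) + ev (dy w) z)) (at 0)"
proof -
  have e: "((\<lambda>t. exp (ev w (z + t *\<^sub>R (1, 0)))) has_vector_derivative ev (dx w) z * exp (ev w z)) (at 0)"
    "((\<lambda>t. exp (ev w (z + t *\<^sub>R (0, 1)))) has_vector_derivative ev (dy w) z * exp (ev w z)) (at 0)"
    using field_vector_diff_chain_at[OF ev_deriv(1) DERIV_exp, of w z] field_vector_diff_chain_at[OF ev_deriv(2) DERIV_exp, of w z]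
    by (simp_all add: o_def flip: zero_prod_def)
  show "((\<lambda>t. wave n w (z + t *\<^sub>R (1, 0))) has_vector_derivative wave n w z * (\<i> * of_int (fst n) + ev (dx w) z)) (at 0)"
    unfolding wave_def
    by (rule has_vector_derivative_eq_rhs[OF has_vector_derivative_mult[OF mode_deriv(1) e(1)]])
      (simp add: algebra_simps flip: zero_prod_def)
  show "((\<lambda>t. wave n w (z + t *\<^sub>R (0, 1))) has_vector_derivative wave n w z * (\<i> * of_int (snd n) + ev (dy w) z)) (at 0)"
    unfolding wave_def
    by (rule has_vector_derivative_eq_rhs[OF has_vector_derivative_mult[OF mode_deriv(2) e(2)]])
      (simp add: algebra_simps flip: zero_prod_def)
qed

definition wave_x :: "int \<times> int \<Rightarrow> trig \<Rightarrow> real \<times> real \<Rightarrow> complex" where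
  "wave_x n w z = wave n w z * (\<i> * of_int (fst n) + ev (dx w) z)"
definition wave_y :: "int \<times> int \<Rightarrow> trig \<Rightarrow> real \<times> real \<Rightarrow> complex" where
  "wave_y n w z = wave n w z * (\<i> * of_int (snd n) + ev (dy w) z)"
definition wave_xx :: "int \<times> int \<Rightarrow> trig \<Rightarrow> real \<times> real \<Rightarrow> complex" where
  "wave_xx n w z = wave n w z * ((\<i> * of_int (fst n) + ev (dx w) z)\<^sup>2 + ev (dx (dx w)) z)"
definition wave_yy :: "int \<times> int \<Rightarrow> trig \<Rightarrow> real \<times> real \<Rightarrow> complex" where
  "wave_yy n w z = wave n w z * ((\<i> * of_int (snd n) + ev (dy w) z)\<^sup>2 + ev (dy (dy w)) z)"

lemma continuous_wave_derivs [continuous_intros]: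
  "continuous_on A (wave_x n w)" "continuous_on A (wave_y n w)"
  "continuous_on A (wave_xx n w)" "continuous_on A (wave_yy n w)"
  unfolding wave_x_def wave_y_def wave_xx_def wave_yy_def by (intro continuous_intros)+

lemma wave_deriv2:
  "((\<lambda>t. wave_x n w (z + t *\<^sub>R (1, 0))) has_vector_derivative wave_xx n w z) (at 0)"
  "((\<lambda>t. wave_y n w (z + t *\<^sub>R (0, 1))) has_vector_derivative wave_yy n w z) (at 0)"
proof -
  have c: "((\<lambda>t. c + ev xs (z + t *\<^sub>R (1, 0))) has_vector_derivative ev (dx xs) z) (at 0)"
    "((\<lambda>t. c + ev xs (z + t *\<^sub>R (0, 1))) has_vector_derivative ev (dy xs) z) (at 0)" for c xs
    using has_vector_derivative_add[OF has_vector_derivative_const[of c] ev_deriv(1)[of xs z]]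
      has_vector_derivative_add[OF has_vector_derivative_const[of c] ev_deriv(2)[of xs z]] by simp_all
  show "((\<lambda>t. wave_x n w (z + t *\<^sub>R (1, 0))) has_vector_derivative wave_xx n w z) (at 0)"
    unfolding wave_x_def wave_xx_def
    by (rule has_vector_derivative_eq_rhs[OF has_vector_derivative_mult[OF wave_deriv(1) c(1)]])
      (simp add: power2_eq_square algebra_simps flip: zero_prod_def)
  show "((\<lambda>t. wave_y n w (z + t *\<^sub>R (0, 1))) has_vector_derivative wave_yy n w z) (at 0)"
    unfolding wave_y_def wave_yy_def
    by (rule has_vector_derivative_eq_rhs[OF has_vector_derivative_mult[OF wave_deriv(2) c(2)]])
      (simp add: power2_eq_square algebra_simps flip: zero_prod_def)
qed

lemma periodic_wave: "periodic2 (wave n w)" "periodic2 (wave_x n w)" "periodic2 (wave_y n w)"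
  by (simp_all add: periodic2_def wave_def wave_x_def wave_y_def mode_periodic ev_periodic)

lemma has_weak_derivativeD:
  assumes "has_weak_derivative e f g" "periodic2 \<eta>" "continuous_on UNIV \<eta>" "continuous_on UNIV \<eta>'"
    and "\<And>z. ((\<lambda>t. \<eta> (z + t *\<^sub>R e)) has_vector_derivative \<eta>' z) (at 0)"
  shows "(LINT z|T2. f z * \<eta>' z) = - (LINT z|T2. g z * \<eta> z)"
  using assms unfolding has_weak_derivative_def by blast

text \<open>Two integrations by parts in each variable move the derivatives to the test function.
  The pairing has no complex conjugation, in agreement with
  \<open>has_weak_derivative\<close>.\<close>

lemma weak_eigen_equation:
  assumes sch: "schroedinger V \<phi> (\<lambda>z. E * \<phi> z)" and V: "continuous_on UNIV (\<lambda>z. complex_of_real (V z))"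
  shows "(LINT z|T2. \<phi> z * (of_real (V z) * wave n w z - wave_xx n w z - wave_yy n w z))
    = E * (LINT z|T2. \<phi> z * wave n w z)"
proof -
  obtain \<phi>x \<phi>xx \<phi>y \<phi>yy where d: "has_weak_derivative (1, 0) \<phi> \<phi>x" "has_weak_derivative (1, 0) \<phi>x \<phi>xx"
    "has_weak_derivative (0, 1) \<phi> \<phi>y" "has_weak_derivative (0, 1) \<phi>y \<phi>yy"
    and ae: "AE z in T2. E * \<phi> z = - \<phi>xx z - \<phi>yy z + of_real (V z) * \<phi> z"
    using sch unfolding schroedinger_def by blast
  have int: "integrable T2 \<phi>" "integrable T2 \<phi>xx" "integrable T2 \<phi>yy"
    using d by (auto simp: has_weak_derivative_def intro: in_Lp_2_integrable)
  let ?q = "wave n w"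
  have x: "(LINT z|T2. \<phi> z * wave_xx n w z) = (LINT z|T2. \<phi>xx z * ?q z)"
    using has_weak_derivativeD[OF d(1) periodic_wave(2) continuous_wave_derivs(1,3) wave_deriv2(1), of n w]
      has_weak_derivativeD[OF d(2) periodic_wave(1) continuous_wave continuous_wave_derivs(1), of n w n w]
      wave_deriv(1) by (simp add: wave_x_def)
  have y: "(LINT z|T2. \<phi> z * wave_yy n w z) = (LINT z|T2. \<phi>yy z * ?q z)"
    using has_weak_derivativeD[OF d(3) periodic_wave(3) continuous_wave_derivs(2,4) wave_deriv2(2), of n w]
      has_weak_derivativeD[OF d(4) periodic_wave(1) continuous_wave continuous_wave_derivs(2), of n w n w]
      wave_deriv(2) by (simp add: wave_y_def)
  have i: "integrable T2 (\<lambda>z. \<phi> z * (of_real (V z) * ?q z))" "integrable T2 (\<lambda>z. \<phi> z * wave_xx n w z)"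
    "integrable T2 (\<lambda>z. \<phi> z * wave_yy n w z)" "integrable T2 (\<lambda>z. \<phi>xx z * ?q z)" "integrable T2 (\<lambda>z. \<phi>yy z * ?q z)"
    using int V by (auto intro!: integrable_mult_continuous continuous_intros)
  have "(LINT z|T2. \<phi> z * (of_real (V z) * ?q z - wave_xx n w z - wave_yy n w z)) =
    (LINT z|T2. \<phi> z * (of_real (V z) * ?q z)) - (LINT z|T2. \<phi> z * wave_xx n w z) - (LINT z|T2. \<phi> z * wave_yy n w z)"
    using i by (simp add: right_diff_distrib)
  also have "\<dots> = (LINT z|T2. \<phi> z * (of_real (V z) * ?q z) - \<phi>xx z * ?q z - \<phi>yy z * ?q z)"
    using i by (simp add: x y)
  also have "\<dots> = (LINT z|T2. E * (\<phi> z * ?q z))"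
  proof (rule integral_cong_AE)
    show "(\<lambda>z. \<phi> z * (of_real (V z) * ?q z) - \<phi>xx z * ?q z - \<phi>yy z * ?q z) \<in> borel_measurable T2"
      using i by (intro borel_measurable_integrable Bochner_Integration.integrable_diff)
    show "(\<lambda>z. E * (\<phi> z * ?q z)) \<in> borel_measurable T2"
      using int by (intro borel_measurable_integrable integrable_mult_right integrable_mult_continuous continuous_intros)
    show "AE z in T2. \<phi> z * (of_real (V z) * ?q z) - \<phi>xx z * ?q z - \<phi>yy z * ?q z = E * (\<phi> z * ?q z)"
      using ae
    proof eventually_elim
      case (elim z)
      have "E * (\<phi> z * ?q z) = (E * \<phi> z) * ?q z" by simp
      also have "\<dots> = (- \<phi>xx z - \<phi>yy z + of_real (V z) * \<phi> z) * ?q z" by (simp only: elim)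
      finally show ?case by (simp add: algebra_simps)
    qed
  qed
  finally show ?thesis by simp
qed

text \<open>From \<open>|\<phi>| <= 1 + |\<phi>|^2\<close>; it bounds all coefficients uniformly in
  the eigenfunction.\<close>

lemma integral_cmod_le:
  assumes "in_Lp 2 \<phi>" "Lp_norm 2 \<phi> = 1"
  shows "(LINT z|T2. cmod (\<phi> z)) \<le> (2 * pi)\<^sup>2 + 1"
proof -
  note int = in_Lp_2_integrable[OF assms(1)]
  have "(\<lambda>z. cmod (\<phi> z) powr 2) = (\<lambda>z. (cmod (\<phi> z))\<^sup>2)" by (auto simp: powr_numeral)
  then have "(LINT z|T2. (cmod (\<phi> z))\<^sup>2) powr (1 / 2) = 1" using assms(2) by (simp add: Lp_norm_def)
  moreover have "(LINT z|T2. (cmod (\<phi> z))\<^sup>2) \<ge> 0" by simp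
  ultimately have one: "(LINT z|T2. (cmod (\<phi> z))\<^sup>2) = 1"
    by (simp add: powr_half_sqrt)
  have "(LINT z|T2. cmod (\<phi> z)) \<le> (LINT z|T2. 1 + (cmod (\<phi> z))\<^sup>2)"
  proof (rule integral_mono)
    show "cmod (\<phi> z) \<le> 1 + (cmod (\<phi> z))\<^sup>2" for z
    proof -
      have "0 \<le> (cmod (\<phi> z) - 1)\<^sup>2" by simp
      then have "2 * cmod (\<phi> z) \<le> 1 + (cmod (\<phi> z))\<^sup>2" by (simp add: power2_eq_square algebra_simps)
      then show ?thesis using norm_ge_zero[of "\<phi> z"] by linarith
    qed
  qed (use int in \<open>auto intro!: Bochner_Integration.integrable_add\<close>)
  also have "\<dots> = (LINT z|T2. (1::real)) + (LINT z|T2. (cmod (\<phi> z))\<^sup>2)"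
    using int by (intro Bochner_Integration.integral_add) auto
  also have "(LINT z|T2. (1::real)) = (2 * pi)\<^sup>2"
    using measure_T2 by (simp only: lebesgue_integral_const scaleR_one real_scaleR_def mult_1_right)
  finally show ?thesis using one by simp
qed

context potential
begin

lemma ev_vs: "ev vs z = (\<Sum>m\<in>set ms. V m * mode m z)"
proof -
  have "ev (map (\<lambda>m. (V m, m)) ls) z = (\<Sum>m\<leftarrow>ls. V m * mode m z)" for ls
    by (induction ls) auto
  then show ?thesis using distinct_ms by (simp add: vs_def sum.distinct_set_conv_list)
qed

lemma ev_d1: "ev (d1 n) z = (\<Sum>m\<in>set ms. - V m / of_int (symb n m) * mode m z)"
proof -
  have "ev (trans_inv n (tneg (map (\<lambda>m. (V m, m)) ls))) z = (\<Sum>m\<leftarrow>ls. - V m / of_int (symb n m) * mode m z)"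
    if "0 \<notin> set ls" for ls
    using that by (induction ls) auto
  then show ?thesis using distinct_ms zero_notin_ms by (simp add: d1_def vs_def sum.distinct_set_conv_list)
qed

text \<open>The weak equation is used with two phases: the empty one gives the linear equations for
  the coefficients, \<open>phase n\<close> gives the estimates for the quasimode.\<close>

lemma eigen_coeffs_of_eigenfunction:
  assumes sch: "schroedinger Vf \<phi> (\<lambda>z. E * \<phi> z)" and \<phi>: "in_Lp 2 \<phi>"
    and Vf: "\<And>z. complex_of_real (Vf z) = v0 + ev vs z" and M: "(LINT z|T2. cmod (\<phi> z)) \<le> M"
  shows "eigen_coeffs (\<lambda>n. LINT z|T2. \<phi> z * mode n z) (E - v0) M"
proof -
  have int: "integrable T2 \<phi>" by (rule in_Lp_2_integrable[OF \<phi>])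
  have M0: "M \<ge> 0" using M by (rule order_trans[rotated]) simp
  have Vc: "continuous_on UNIV (\<lambda>z. complex_of_real (Vf z))" unfolding Vf by (intro continuous_intros)
  define J where "J f = (LINT z|T2. \<phi> z * f z)" for f
  have Jint: "integrable T2 (\<lambda>z. \<phi> z * f z)" if "continuous_on UNIV f" for f
    using integrable_mult_continuous[OF int that] .
  have Jadd: "J (\<lambda>z. f z + g z) = J f + J g" if "continuous_on UNIV f" "continuous_on UNIV g" for f g
    using Jint that by (simp add: J_def distrib_left)
  have Jdiff: "J (\<lambda>z. f z - g z) = J f - J g" if "continuous_on UNIV f" "continuous_on UNIV g" for f g
    using Jint that by (simp add: J_def right_diff_distrib)
  have Jscale: "J (\<lambda>z. a * f z) = a * J f" for a f
    by (simp add: J_def mult.left_commute)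
  have Jsum: "J (\<lambda>z. \<Sum>m\<in>set ms. a m * mode (n + m) z) = (\<Sum>m\<in>set ms. a m * J (mode (n + m)))" for a n
  proof -
    have "J (\<lambda>z. \<Sum>m\<in>set ms. a m * mode (n + m) z) = (LINT z|T2. (\<Sum>m\<in>set ms. \<phi> z * (a m * mode (n + m) z)))"
      by (simp add: J_def sum_distrib_left)
    also have "\<dots> = (\<Sum>m\<in>set ms. (LINT z|T2. \<phi> z * (a m * mode (n + m) z)))"
      by (intro Bochner_Integration.integral_sum Jint continuous_intros)
    finally show ?thesis using Jscale by (simp add: J_def)
  qed
  have Jbound: "cmod (J f) \<le> M * B" if "continuous_on UNIV f" "\<And>z. cmod (f z) \<le> B" for f B
  proof -
    have "B \<ge> 0" using that(2)[of undefined] norm_ge_zero order_trans by blast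
    have "cmod (J f) \<le> (LINT z|T2. cmod (\<phi> z)) * B" unfolding J_def by (rule norm_integral_mult_le[OF int that])
    also have "\<dots> \<le> M * B" using M \<open>B \<ge> 0\<close> by (rule mult_right_mono)
    finally show ?thesis .
  qed
  have eq: "J (\<lambda>z. of_real (Vf z) * wave n w z - wave_xx n w z - wave_yy n w z) = E * J (wave n w)" for n w
    unfolding J_def by (rule weak_eigen_equation[OF sch Vc])
  have lap: "wave_xx n w z + wave_yy n w z = wave n w z * (- of_int (idot n n)
      + (transport n w z + (ev (dx w) z)\<^sup>2 + (ev (dy w) z)\<^sup>2))" for n w z
    by (simp add: wave_xx_def wave_yy_def transport_def idot_def power2_eq_square algebra_simps)
  have coeff: "(E - v0 - of_int (idot n n)) * J (mode n) = (\<Sum>m\<in>set ms. V m * J (mode (n + m)))" for n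
  proof -
    have w: "wave n [] = mode n" by (rule ext) (simp add: wave_def)
    have "(\<lambda>z. of_real (Vf z) * wave n [] z - wave_xx n [] z - wave_yy n [] z) =
        (\<lambda>z. (v0 + of_int (idot n n)) * mode n z + (\<Sum>m\<in>set ms. V m * mode (n + m) z))"
    proof
      fix z
      have "of_real (Vf z) * wave n [] z - wave_xx n [] z - wave_yy n [] z =
        (v0 + ev vs z) * wave n [] z - (wave_xx n [] z + wave_yy n [] z)" by (simp add: Vf)
      also have "\<dots> = (v0 + of_int (idot n n)) * mode n z + (\<Sum>m\<in>set ms. V m * mode m z) * mode n z"
        unfolding lap by (simp add: w ev_vs transport_def algebra_simps)
      also have "(\<Sum>m\<in>set ms. V m * mode m z) * mode n z = (\<Sum>m\<in>set ms. V m * mode (n + m) z)"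
        unfolding sum_distrib_right by (intro sum.cong) (auto simp: mode_add)
      finally show "of_real (Vf z) * wave n [] z - wave_xx n [] z - wave_yy n [] z =
        (v0 + of_int (idot n n)) * mode n z + (\<Sum>m\<in>set ms. V m * mode (n + m) z)" .
    qed
    then have "E * J (mode n) = (v0 + of_int (idot n n)) * J (mode n) + (\<Sum>m\<in>set ms. V m * J (mode (n + m)))"
      using eq[of n "[]"] by (simp add: w Jadd continuous_intros Jscale Jsum)
    then show ?thesis by (simp add: algebra_simps)
  qed
  have quasi: "\<exists>q. cmod ((E - v0 - of_int (idot n n) - shift n) * q) \<le> 3 * M * C_rem / (Xm ^ 2 * Y ^ 4) \<and>
        cmod (q - J (mode n) - (\<Sum>m\<in>set ms. - V m / of_int (symb n m) * J (mode (n + m))))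
          \<le> M * (C_phase + 3 * C_phase\<^sup>2) / Xm\<^sup>2"
    if nr: "nonresonant n Xm Y" and Xm: "C_phase \<le> Xm" for n Xm Y
  proof (intro exI conjI)
    let ?w = "phase n" let ?q = "wave n (phase n)"
    have XY: "Xm \<ge> 1" "Y \<ge> 1" using nr by (auto simp: nonresonant_def)
    have w: "cmod (ev ?w z) \<le> C_phase / Xm" "cmod (ev ?w z) \<le> 1" for z
    proof -
      show 1: "cmod (ev ?w z) \<le> C_phase / Xm"
        using norm_ev_le[of ?w z] coeff_norm_phase(2)[OF nr] by linarith
      have "C_phase / Xm \<le> 1" using Xm XY by simp
      then show "cmod (ev ?w z) \<le> 1" using 1 by linarith
    qed
    have "exp \<bar>Re (ev ?w z)\<bar> \<le> 3" for z
    proof -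
      have "\<bar>Re (ev ?w z)\<bar> \<le> 1" using w(2)[of z] abs_Re_le_cmod order_trans by blast
      then have "exp \<bar>Re (ev ?w z)\<bar> \<le> exp 1" by simp
      then show ?thesis using exp_le by linarith
    qed
    note exp3 = this
    have q3: "cmod (?q z) \<le> 3" for z
    proof -
      have "cmod (?q z) = exp (Re (ev ?w z))" by (simp add: wave_def norm_mult)
      also have "\<dots> \<le> exp \<bar>Re (ev ?w z)\<bar>" by simp
      finally show ?thesis using exp3[of z] by linarith
    qed
    have "of_real (Vf z) * ?q z - wave_xx n ?w z - wave_yy n ?w z =
        (v0 + of_int (idot n n) + shift n) * ?q z - ?q z * ev (remainder n) z" for z
    proof -
      have "of_real (Vf z) * ?q z - wave_xx n ?w z - wave_yy n ?w z =
        (v0 + ev vs z) * ?q z - (wave_xx n ?w z + wave_yy n ?w z)" by (simp add: Vf)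
      then show ?thesis unfolding lap phase_equation[OF nr] by (simp add: algebra_simps)
    qed
    then have "E * J ?q = (v0 + of_int (idot n n) + shift n) * J ?q - J (\<lambda>z. ?q z * ev (remainder n) z)"
      using eq[of n ?w] by (simp add: Jdiff Jscale continuous_intros)
    then have "(E - v0 - of_int (idot n n) - shift n) * J ?q = - J (\<lambda>z. ?q z * ev (remainder n) z)"
      by (simp add: algebra_simps)
    then have "cmod ((E - v0 - of_int (idot n n) - shift n) * J ?q) = cmod (J (\<lambda>z. ?q z * ev (remainder n) z))"
      by simp
    also have "\<dots> \<le> M * (3 * (C_rem / (Xm ^ 2 * Y ^ 4)))"
    proof (rule Jbound)
      show "cmod (?q z * ev (remainder n) z) \<le> 3 * (C_rem / (Xm ^ 2 * Y ^ 4))" for z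
        unfolding norm_mult using q3[of z] norm_remainder[OF nr, of z] by (intro mult_mono) auto
    qed (intro continuous_intros)
    finally show "cmod ((E - v0 - of_int (idot n n) - shift n) * J ?q) \<le> 3 * M * C_rem / (Xm ^ 2 * Y ^ 4)"
      by (simp add: mult_ac)
    let ?r = "\<lambda>z. ?q z - mode n z - (\<Sum>m\<in>set ms. - V m / of_int (symb n m) * mode (n + m) z)"
    have "J ?r = J ?q - J (mode n) - (\<Sum>m\<in>set ms. - V m / of_int (symb n m) * J (mode (n + m)))"
    proof -
      have "J ?r = J (\<lambda>z. ?q z - mode n z) - J (\<lambda>z. \<Sum>m\<in>set ms. - V m / of_int (symb n m) * mode (n + m) z)"
        by (rule Jdiff) (intro continuous_intros)+
      also have "J (\<lambda>z. ?q z - mode n z) = J ?q - J (mode n)"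
        by (rule Jdiff) (intro continuous_intros)+
      finally show ?thesis by (simp only: Jsum)
    qed
    moreover have "cmod (J ?r) \<le> M * ((C_phase + 3 * C_phase\<^sup>2) / Xm\<^sup>2)"
    proof (rule Jbound)
      fix z
      define u where "u = ev ?w z"
      \<comment> \<open>The first-order part \<open>d1\<close> is only O(1 / Y) and is kept
        explicitly; what remains, \<open>exp u - 1 - u\<close> and \<open>d2 @ d3\<close>, is
        O(Xm^-2).\<close>
      have "(\<Sum>m\<in>set ms. - V m / of_int (symb n m) * mode (n + m) z) = mode n z * ev (d1 n) z"
        by (simp add: ev_d1 sum_distrib_left mode_add mult_ac)
      then have "?r z = mode n z * ((exp u - (1 + u)) + ev (d2 n @ d3 n) z)"
        by (simp add: wave_def u_def phase_def algebra_simps)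
      then have "cmod (?r z) = cmod ((exp u - (1 + u)) + ev (d2 n @ d3 n) z)" by (simp add: norm_mult)
      also have "\<dots> \<le> cmod (exp u - (1 + u)) + cmod (ev (d2 n @ d3 n) z)" by (rule norm_triangle_ineq)
      also have "cmod (ev (d2 n @ d3 n) z) \<le> C_phase / Xm\<^sup>2"
        using norm_ev_le[of "d2 n @ d3 n" z] coeff_norm_phase(1)[OF nr] by linarith
      also have "cmod (exp u - (1 + u)) \<le> 3 * (C_phase / Xm)\<^sup>2"
      proof -
        have "cmod (exp u - (\<Sum>k\<le>1. u ^ k / fact k)) \<le> exp \<bar>Re u\<bar> * cmod u ^ Suc 1 / fact 1"
          by (rule Taylor_exp)
        then have "cmod (exp u - (1 + u)) \<le> exp \<bar>Re u\<bar> * (cmod u)\<^sup>2" by (simp add: power2_eq_square)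
        also have "\<dots> \<le> 3 * (C_phase / Xm)\<^sup>2"
          using exp3[of z] w(1)[of z] by (intro mult_mono power_mono) (auto simp: u_def)
        finally show ?thesis .
      qed
      finally show "cmod (?r z) \<le> (C_phase + 3 * C_phase\<^sup>2) / Xm\<^sup>2"
        by (simp add: add_divide_distrib power_divide)
    qed (intro continuous_intros)
    ultimately show "cmod (J ?q - J (mode n) - (\<Sum>m\<in>set ms. - V m / of_int (symb n m) * J (mode (n + m))))
          \<le> M * (C_phase + 3 * C_phase\<^sup>2) / Xm\<^sup>2" by simp
  qed
  have "cmod (J (mode n)) \<le> M" for n
    using Jbound[of "mode n" 1] by (simp add: continuous_intros)
  then show ?thesis
    using M0 coeff quasi unfolding eigen_coeffs_def J_def by blast
qed

end

section \<open>From Fourier coefficients to a pointwise bound\<close>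

lemma square_lebesgue [simp]: "{-pi..pi} \<times> {-pi..pi} \<in> sets lebesgue"
  unfolding square_eq_cbox by (simp del: cbox_Pair_eq)

lemma integral_cis_period:
  assumes "j \<noteq> 0"
  shows "integral {-pi..pi} (\<lambda>x. cis (of_int j * x)) = 0"
proof -
  have "((\<lambda>x. cis (of_int j * x)) has_integral
      (cis (of_int j * pi) / (\<i> * of_int j) - cis (of_int j * (-pi)) / (\<i> * of_int j))) {-pi..pi}"
  proof (rule fundamental_theorem_of_calculus)
    fix x :: real
    have "((\<lambda>x. \<i> * of_real (of_int j * x)) has_vector_derivative (\<i> * of_int j)) (at x within {-pi..pi})"
      unfolding has_vector_derivative_def
      by (auto intro!: derivative_eq_intros simp: scaleR_conv_of_real)
    then have "((\<lambda>x. exp (\<i> * of_real (of_int j * x))) has_vector_derivative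
        (\<i> * of_int j * exp (\<i> * of_real (of_int j * x)))) (at x within {-pi..pi})"
      using field_vector_diff_chain_within[OF _ has_field_derivative_at_within[OF DERIV_exp]]
      by (auto simp: o_def)
    then have "((\<lambda>x. exp (\<i> * of_real (of_int j * x)) / (\<i> * of_int j)) has_vector_derivative
        (\<i> * of_int j * exp (\<i> * of_real (of_int j * x))) / (\<i> * of_int j)) (at x within {-pi..pi})"
      by (rule has_vector_derivative_divide)
    then show "((\<lambda>x. cis (of_int j * x) / (\<i> * of_int j)) has_vector_derivative cis (of_int j * x)) (at x within {-pi..pi})"
      using assms by (simp add: cis_conv_exp)
  qed simp
  moreover have "cis (of_int j * pi) = cis (of_int j * (-pi))"
  proof -
    have "cis (of_int j * (-pi)) * cis (2 * pi * of_int j) = cis (of_int j * pi)"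
      unfolding cis_mult by (rule arg_cong) (simp add: algebra_simps)
    then show ?thesis by simp
  qed
  ultimately show ?thesis by (simp add: integral_unique)
qed

lemma integrable_continuous_T2:
  fixes f :: "real \<times> real \<Rightarrow> complex"
  assumes "continuous_on UNIV f"
  shows "integrable T2 f"
  using integrable_mult_continuous[OF integrable_const_T2[of 1] assms] by simp

lemma integral_mode: "(LINT z|T2. mode n z) = (if n = 0 then (2 * pi)\<^sup>2 else 0)"
proof -
  have c: "continuous_on A (mode n)" for A by (rule continuous_mode)
  have "(LINT z|T2. mode n z) = integral ({-pi..pi} \<times> {-pi..pi}) (mode n)"
    by (rule lebesgue_integral_eq_integral[OF integrable_continuous_T2[OF c]]) (simp add: square_eq_cbox)
  also have "\<dots> = integral {-pi..pi} (\<lambda>x. integral {-pi..pi} (\<lambda>y. mode n (x, y)))"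
    unfolding square_eq_cbox using integral_prod_continuous[OF c, of "-pi" "-pi" pi pi] by (simp only: cbox_interval)
  also have "(\<lambda>x. integral {-pi..pi} (\<lambda>y. mode n (x, y))) =
      (\<lambda>x. cis (of_int (fst n) * x) * integral {-pi..pi} (\<lambda>y. cis (of_int (snd n) * y)))"
    by (simp add: mode_def cis_mult[symmetric] integral_mult_right)
  also have "integral {-pi..pi} (\<lambda>x. cis (of_int (fst n) * x) * integral {-pi..pi} (\<lambda>y. cis (of_int (snd n) * y))) =
      integral {-pi..pi} (\<lambda>x. cis (of_int (fst n) * x)) * integral {-pi..pi} (\<lambda>y. cis (of_int (snd n) * y))"
    by (rule integral_mult_left)
  also have "\<dots> = (if n = 0 then (2 * pi)\<^sup>2 else 0)"
  proof (cases "n = 0")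
    case True
    then show ?thesis by (simp add: power2_eq_square scaleR_conv_of_real)
  next
    case False
    then have "fst n \<noteq> 0 \<or> snd n \<noteq> 0" by (auto simp: prod_eq_iff)
    then show ?thesis using integral_cis_period False by auto
  qed
  finally show ?thesis .
qed

lemma integral_modes_sum:
  assumes "finite N"
  shows "(LINT z|T2. (\<Sum>m\<in>N. A m * mode m z) * mode (- n) z) = (if n \<in> N then A n * (2 * pi)\<^sup>2 else 0)"
proof -
  have "(LINT z|T2. (\<Sum>m\<in>N. A m * mode m z) * mode (- n) z) = (LINT z|T2. (\<Sum>m\<in>N. A m * mode (m - n) z))"
    by (simp add: sum_distrib_right mult.assoc mode_add[symmetric])
  also have "\<dots> = (\<Sum>m\<in>N. (LINT z|T2. A m * mode (m - n) z))"
    by (intro Bochner_Integration.integral_sum integrable_continuous_T2 continuous_intros)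
  also have "\<dots> = (\<Sum>m\<in>N. if m = n then A n * (2 * pi)\<^sup>2 else 0)"
    by (intro sum.cong) (auto simp: integral_mode)
  finally show ?thesis using assms by simp
qed

lemma fourier_coeff_mode: "fourier_coeff f n = (LINT z|T2. f z * mode (- n) z) / (2 * pi)\<^sup>2"
  by (cases n) (simp add: fourier_coeff_def mode_def case_prod_unfold algebra_simps)

text \<open>Merges repeated frequencies, after which orthogonality recovers each
  coefficient.\<close>

lemma ev_collect: "\<exists>N A. finite N \<and> (\<forall>z. ev xs z = (\<Sum>m\<in>N. A m * mode m z))"
proof (induction xs)
  case Nil
  show ?case by (intro exI[of _ "{}"]) simp
next
  case (Cons p xs)
  then obtain N A where N: "finite N" "\<And>z. ev xs z = (\<Sum>m\<in>N. A m * mode m z)" by auto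
  obtain a l where p: "p = (a, l)" by (cases p)
  define B where "B m = (if m \<in> N then A m else 0) + (if m = l then a else 0)" for m
  have "ev (p # xs) z = (\<Sum>m\<in>insert l N. B m * mode m z)" for z
  proof -
    have "(\<Sum>m\<in>insert l N. B m * mode m z) =
      (\<Sum>m\<in>insert l N. (if m \<in> N then A m * mode m z else 0)) + (\<Sum>m\<in>insert l N. (if m = l then a * mode m z else 0))"
      unfolding sum.distrib[symmetric] by (intro sum.cong) (auto simp: B_def distrib_right)
    also have "(\<Sum>m\<in>insert l N. (if m \<in> N then A m * mode m z else 0)) = (\<Sum>m\<in>N. A m * mode m z)"
      using N(1) by (intro sum.mono_neutral_cong_right) auto
    also have "(\<Sum>m\<in>insert l N. (if m = l then a * mode m z else 0)) = a * mode l z"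
      using N(1) by (subst sum.delta) auto
    finally show ?thesis using N(2) by (simp add: p)
  qed
  then show ?case using N(1) by (intro exI[of _ "insert l N"] exI[of _ B]) simp
qed

text \<open>The coefficients of a trigonometric polynomial are bounded by its L^1 norm, and those of
  \<open>\<phi>\<close> are summable; so the pairing is bounded in the dual form of a sup norm
  estimate for \<open>\<phi>\<close>.\<close>

lemma integral_trig_le:
  assumes int: "integrable T2 \<phi>"
    and C: "\<And>F. finite F \<Longrightarrow> (\<Sum>n\<in>F. cmod (LINT z|T2. \<phi> z * mode n z)) \<le> C"
  shows "cmod (LINT z|T2. \<phi> z * ev xs z) \<le> C / (2 * pi)\<^sup>2 * (LINT z|T2. cmod (ev xs z))"
proof -
  obtain N A where N: "finite N" "\<And>z. ev xs z = (\<Sum>m\<in>N. A m * mode m z)" using ev_collect by blast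
  define L where "L = (LINT z|T2. cmod (ev xs z))"
  have L: "cmod (A n) \<le> L / (2 * pi)\<^sup>2" if n: "n \<in> N" for n
  proof -
    have "A n * (2 * pi)\<^sup>2 = (LINT z|T2. ev xs z * mode (- n) z)"
      using integral_modes_sum[OF N(1), of A n] n by (simp add: N(2))
    then have "cmod (A n * (2 * pi)\<^sup>2) = cmod (LINT z|T2. ev xs z * mode (- n) z)" by simp
    also have "\<dots> \<le> L * 1" unfolding L_def
      by (rule norm_integral_mult_le[OF integrable_continuous_T2[OF continuous_ev] continuous_mode]) simp
    finally show ?thesis by (simp add: norm_mult field_simps norm_power)
  qed
  have "(LINT z|T2. \<phi> z * ev xs z) = (LINT z|T2. (\<Sum>m\<in>N. \<phi> z * (A m * mode m z)))"
    by (simp add: N(2) sum_distrib_left)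
  also have "\<dots> = (\<Sum>m\<in>N. (LINT z|T2. \<phi> z * (A m * mode m z)))"
    by (intro Bochner_Integration.integral_sum integrable_mult_continuous[OF int] continuous_intros)
  also have "\<dots> = (\<Sum>m\<in>N. A m * (LINT z|T2. \<phi> z * mode m z))"
    by (simp add: mult.left_commute)
  finally have "cmod (LINT z|T2. \<phi> z * ev xs z) = cmod (\<Sum>m\<in>N. A m * (LINT z|T2. \<phi> z * mode m z))" by simp
  also have "\<dots> \<le> (\<Sum>m\<in>N. L / (2 * pi)\<^sup>2 * cmod (LINT z|T2. \<phi> z * mode m z))"
  proof (rule order_trans[OF norm_sum], rule sum_mono)
    fix m assume "m \<in> N"
    then show "cmod (A m * (LINT z|T2. \<phi> z * mode m z)) \<le> L / (2 * pi)\<^sup>2 * cmod (LINT z|T2. \<phi> z * mode m z)"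
      unfolding norm_mult by (intro mult_right_mono L) auto
  qed
  also have "\<dots> = L / (2 * pi)\<^sup>2 * (\<Sum>m\<in>N. cmod (LINT z|T2. \<phi> z * mode m z))"
    by (simp add: sum_distrib_left)
  also have "\<dots> \<le> L / (2 * pi)\<^sup>2 * C"
    using C[OF N(1)] by (intro mult_left_mono) (auto simp: L_def)
  finally show ?thesis by (simp add: L_def mult.commute)
qed

section \<open>Duality: from trigonometric polynomials to indicator functions\<close>

definition trig_mult :: "trig \<Rightarrow> trig \<Rightarrow> trig" where
  "trig_mult xs ys = concat (map (\<lambda>p. map (\<lambda>q. (fst p * fst q, snd p + snd q)) ys) xs)"

lemma ev_trig_mult: "ev (trig_mult xs ys) z = ev xs z * ev ys z"
proof (induction xs)
  case (Cons p xs)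
  have "ev (map (\<lambda>q. (fst p * fst q, snd p + snd q)) ys) z = fst p * mode (snd p) z * ev ys z"
    by (induction ys) (auto simp: mode_add algebra_simps)
  with Cons show ?case by (simp add: trig_mult_def algebra_simps)
qed (simp add: trig_mult_def)

text \<open>Embeds the torus as a compact subset of a real vector space, on which continuous
  functions can be approximated by polynomials.\<close>

definition torus_map :: "real \<times> real \<Rightarrow> complex \<times> complex" where
  "torus_map z = (cis (fst z), cis (snd z))"

lemma continuous_torus_map [continuous_intros]: "continuous_on A torus_map"
  unfolding torus_map_def by (intro continuous_intros)

text \<open>A real-linear functional becomes a combination of \<open>cos\<close> and
  \<open>sin\<close> of the coordinates; trigonometric polynomials are closed under sums and
  products.\<close>

lemma polynomial_on_torus_trig:
  assumes "real_polynomial_function p"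
  shows "\<exists>xs. \<forall>z. complex_of_real (p (torus_map z)) = ev xs z"
  using assms
proof (induction rule: real_polynomial_function.induct)
  case (linear f)
  interpret bounded_linear f by fact
  have f: "f (u, v) = Re u * f (1, 0) + Im u * f (\<i>, 0) + Re v * f (0, 1) + Im v * f (0, \<i>)" for u v
  proof -
    have "(u, v) = Re u *\<^sub>R (1, 0) + Im u *\<^sub>R (\<i>, 0) + Re v *\<^sub>R (0, 1) + Im v *\<^sub>R (0, \<i>)"
      by (simp add: complex_eq_iff)
    then have "f (u, v) = f (Re u *\<^sub>R (1, 0) + Im u *\<^sub>R (\<i>, 0) + Re v *\<^sub>R (0, 1) + Im v *\<^sub>R (0, \<i>))" by (rule arg_cong)
    then show ?thesis by (simp only: add scale real_scaleR_def)
  qed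
  have cs: "complex_of_real (cos x) = (cis x + cis (- x)) / 2" "complex_of_real (sin x) = (cis x - cis (- x)) / (2 * \<i>)" for x
  proof -
    have "cis x + cis (- x) = of_real (cos x) * 2" by (simp add: complex_eq_iff)
    then show "complex_of_real (cos x) = (cis x + cis (- x)) / 2" by simp
    have "cis x - cis (- x) = of_real (sin x) * (2 * \<i>)" by (simp add: complex_eq_iff)
    then show "complex_of_real (sin x) = (cis x - cis (- x)) / (2 * \<i>)"
      unfolding eq_divide_eq by simp
  qed
  define al be ga de where "al = complex_of_real (f (1, 0))" and "be = complex_of_real (f (\<i>, 0))"
    and "ga = complex_of_real (f (0, 1))" and "de = complex_of_real (f (0, \<i>))"
  have "complex_of_real (f (torus_map z)) = ev
    [((al + be / \<i>) / 2, (1, 0)), ((al - be / \<i>) / 2, (-1, 0)), ((ga + de / \<i>) / 2, (0, 1)), ((ga - de / \<i>) / 2, (0, -1))] z" for z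
  proof -
    have "complex_of_real (f (torus_map z)) = of_real (cos (fst z)) * al + of_real (sin (fst z)) * be
       + of_real (cos (snd z)) * ga + of_real (sin (snd z)) * de"
      using f[of "cis (fst z)" "cis (snd z)"] by (simp add: torus_map_def al_def be_def ga_def de_def)
    also have "\<dots> = ((al + be / \<i>) / 2 * cis (fst z) + (al - be / \<i>) / 2 * cis (- fst z))
       + ((ga + de / \<i>) / 2 * cis (snd z) + (ga - de / \<i>) / 2 * cis (- snd z))"
    proof -
      have "(u + u') / 2 * a + (u - u') / (2 * \<i>) * b = (a + b / \<i>) / 2 * u + (a - b / \<i>) / 2 * u'"
        for u u' a b :: complex
      proof -
        define \<beta> where "\<beta> = b / \<i>"
        have "x / \<i> * b = x * \<beta>" for x
          by (simp only: \<beta>_def times_divide_eq_left times_divide_eq_right)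
        from this[of "(u - u') / 2"] have "(u - u') / (2 * \<i>) * b = (u - u') / 2 * \<beta>"
          by (simp only: divide_divide_eq_left)
        moreover have "(u + u') / 2 * a + (u - u') / 2 * \<beta> = (a + \<beta>) / 2 * u + (a - \<beta>) / 2 * u'"
          by (simp add: field_simps)
        ultimately show ?thesis by (simp only: \<beta>_def)
      qed
      from this[of "cis (fst z)" "cis (- fst z)" al be] this[of "cis (snd z)" "cis (- snd z)" ga de]
      show ?thesis unfolding cs by (simp only: add.assoc)
    qed
    finally show ?thesis by (simp add: mode_def)
  qed
  then show ?case by blast
next
  case (const c)
  have "complex_of_real c = ev [(of_real c, 0)] z" for z by simp
  then show ?case by blast
next
  case (add f g)
  then obtain xs ys where "\<And>z. complex_of_real (f (torus_map z)) = ev xs z" "\<And>z. complex_of_real (g (torus_map z)) = ev ys z"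
    by blast
  then have "complex_of_real (f (torus_map z) + g (torus_map z)) = ev (xs @ ys) z" for z by simp
  then show ?case by blast
next
  case (mult f g)
  then obtain xs ys where "\<And>z. complex_of_real (f (torus_map z)) = ev xs z" "\<And>z. complex_of_real (g (torus_map z)) = ev ys z"
    by blast
  then have "complex_of_real (f (torus_map z) * g (torus_map z)) = ev (trig_mult xs ys) z" for z
    by (simp add: ev_trig_mult)
  then show ?case by blast
qed

lemma integral_continuous_on_torus_le:
  assumes int: "integrable T2 \<phi>" and C0: "0 \<le> C"
    and C: "\<And>xs. cmod (LINT z|T2. \<phi> z * ev xs z) \<le> C * (LINT z|T2. cmod (ev xs z))"
    and G: "continuous_on UNIV (G :: complex \<times> complex \<Rightarrow> real)"
  shows "cmod (LINT z|T2. \<phi> z * of_real (G (torus_map z))) \<le> C * (LINT z|T2. \<bar>G (torus_map z)\<bar>)"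
proof (rule field_le_epsilon)
  fix e :: real assume e: "e > 0"
  define M where "M = (LINT z|T2. cmod (\<phi> z)) + C * (2 * pi)\<^sup>2 + 1"
  have M0: "(LINT z|T2. cmod (\<phi> z)) \<ge> 0" by simp
  then have M: "M > 0" using C0 unfolding M_def by (intro add_nonneg_pos add_nonneg_nonneg) auto
  define \<delta> where "\<delta> = e / M"
  have \<delta>: "\<delta> > 0" using e M by (simp add: \<delta>_def)
  have compact: "compact (range torus_map)"
  proof -
    have "range torus_map = sphere 0 1 \<times> sphere 0 1"
    proof
      show "range torus_map \<subseteq> sphere 0 1 \<times> sphere 0 1" by (auto simp: torus_map_def)
      show "sphere 0 1 \<times> sphere 0 1 \<subseteq> range torus_map"
      proof
        fix p :: "complex \<times> complex" assume "p \<in> sphere 0 1 \<times> sphere 0 1"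
        then have "cmod (fst p) = 1" "cmod (snd p) = 1" by auto
        then have "fst p = cis (Arg (fst p))" "snd p = cis (Arg (snd p))"
          by (metis complex_norm_eq_1_exp_eq cis_conv_exp)+
        then have "p = torus_map (Arg (fst p), Arg (snd p))" by (simp add: torus_map_def prod_eq_iff)
        then show "p \<in> range torus_map" by blast
      qed
    qed
    then show ?thesis by (simp add: compact_Times)
  qed
  obtain p where p: "real_polynomial_function p" "\<And>u. u \<in> range torus_map \<Longrightarrow> \<bar>G u - p u\<bar> < \<delta>"
    using Stone_Weierstrass_real_polynomial_function[OF compact continuous_on_subset[OF G] \<delta>] by blast
  obtain xs where xs: "\<And>z. complex_of_real (p (torus_map z)) = ev xs z"
    using polynomial_on_torus_trig[OF p(1)] by blast
  have Gc: "continuous_on UNIV (\<lambda>z. G (torus_map z))"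
    using continuous_on_compose[OF continuous_torus_map continuous_on_subset[OF G]] by (simp add: o_def)
  have Gc': "continuous_on UNIV (\<lambda>z. complex_of_real (G (torus_map z)))" by (intro continuous_intros Gc)
  have diff: "cmod (of_real (G (torus_map z)) - ev xs z) \<le> \<delta>" for z
  proof -
    have "of_real (G (torus_map z)) - ev xs z = of_real (G (torus_map z) - p (torus_map z))"
      by (simp add: xs[symmetric])
    then show ?thesis using p(2)[of "torus_map z"] by (simp only: norm_of_real) auto
  qed
  have "(LINT z|T2. \<phi> z * of_real (G (torus_map z))) =
      (LINT z|T2. \<phi> z * ev xs z) + (LINT z|T2. \<phi> z * (of_real (G (torus_map z)) - ev xs z))"
    using integrable_mult_continuous[OF int Gc'] integrable_mult_continuous[OF int continuous_ev[of UNIV xs]]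
    by (simp add: right_diff_distrib)
  then have "cmod (LINT z|T2. \<phi> z * of_real (G (torus_map z))) \<le>
      cmod (LINT z|T2. \<phi> z * ev xs z) + cmod (LINT z|T2. \<phi> z * (of_real (G (torus_map z)) - ev xs z))"
    by (simp add: norm_triangle_ineq)
  also have "\<dots> \<le> C * (LINT z|T2. cmod (ev xs z)) + (LINT z|T2. cmod (\<phi> z)) * \<delta>"
    by (intro add_mono C norm_integral_mult_le[OF int] diff continuous_intros Gc)
  also have "(LINT z|T2. cmod (ev xs z)) \<le> (LINT z|T2. \<bar>G (torus_map z)\<bar> + \<delta>)"
  proof (rule integral_mono)
    show "integrable T2 (\<lambda>z. cmod (ev xs z))"
      by (intro integrable_norm integrable_continuous_T2 continuous_ev)
    have "integrable T2 (\<lambda>z. cmod (of_real (G (torus_map z))))"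
      by (intro integrable_norm integrable_continuous_T2 Gc')
    then show "integrable T2 (\<lambda>z. \<bar>G (torus_map z)\<bar> + \<delta>)" by simp
    show "cmod (ev xs z) \<le> \<bar>G (torus_map z)\<bar> + \<delta>" for z
      using diff[of z] norm_triangle_ineq2[of "ev xs z" "of_real (G (torus_map z))"]
      by (simp add: norm_minus_commute)
  qed
  also have "(LINT z|T2. \<bar>G (torus_map z)\<bar> + \<delta>) = (LINT z|T2. \<bar>G (torus_map z)\<bar>) + \<delta> * (2 * pi)\<^sup>2"
  proof -
    have "integrable T2 (\<lambda>z. cmod (of_real (G (torus_map z))))"
      by (intro integrable_norm integrable_continuous_T2 Gc')
    then have "integrable T2 (\<lambda>z. \<bar>G (torus_map z)\<bar>)" by simp
    then have "(LINT z|T2. \<bar>G (torus_map z)\<bar> + \<delta>) = (LINT z|T2. \<bar>G (torus_map z)\<bar>) + (LINT z|T2. \<delta>)"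
      by (intro Bochner_Integration.integral_add integrable_const_T2)
    also have "(LINT z|T2. \<delta>) = \<delta> * (2 * pi)\<^sup>2"
      using measure_T2 by (simp only: lebesgue_integral_const real_scaleR_def mult.commute)
    finally show ?thesis .
  qed
  finally have "cmod (LINT z|T2. \<phi> z * of_real (G (torus_map z))) \<le>
      C * ((LINT z|T2. \<bar>G (torus_map z)\<bar>) + \<delta> * (2 * pi)\<^sup>2) + (LINT z|T2. cmod (\<phi> z)) * \<delta>"
    using C0 by (simp add: mult_left_mono)
  also have "\<dots> \<le> C * (LINT z|T2. \<bar>G (torus_map z)\<bar>) + M * \<delta>"
    using \<delta> by (simp add: M_def algebra_simps)
  also have "M * \<delta> = e" using M by (simp add: \<delta>_def)
  finally show "cmod (LINT z|T2. \<phi> z * of_real (G (torus_map z))) \<le> C * (LINT z|T2. \<bar>G (torus_map z)\<bar>) + e" .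
qed

text \<open>Opposite edges of the square have the same image, so one of the two points has to be
  interior.\<close>

lemma torus_map_inj:
  assumes "z \<in> {-pi..pi} \<times> {-pi..pi}" "z' \<in> {-pi<..<pi} \<times> {-pi<..<pi}" "torus_map z = torus_map z'"
  shows "z = z'"
proof -
  have inj: "x = x'" if "x \<in> {-pi..pi}" "x' \<in> {-pi<..<pi}" "cis x = cis x'" for x x'
  proof -
    have "sin x = sin x' \<and> cos x = cos x'" using that(3) by (simp add: complex_eq_iff)
    then obtain j :: int where j: "x = x' + 2 * pi * j" unfolding sin_cos_eq_iff by blast
    have "\<bar>x - x'\<bar> < 2 * pi" using that(1,2) by (auto simp: abs_if)
    then have "2 * pi * \<bar>real_of_int j\<bar> < 2 * pi * 1" unfolding j by (simp add: abs_mult)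
    then have "\<bar>real_of_int j\<bar> < 1" by (subst (asm) mult_less_cancel_left_pos) auto
    then have "j = 0" by linarith
    then show ?thesis using j by simp
  qed
  show ?thesis
    using assms inj by (auto simp: torus_map_def prod_eq_iff mem_Times_iff)
qed

text \<open>The functions \<open>G j\<close> of the distance to the image of \<open>K\<close>
  decrease to its indicator. As \<open>K\<close> avoids the edges, the pullback of that indicator to
  the square is the indicator of \<open>K\<close>, and dominated convergence applies.\<close>

lemma integral_compact_le:
  assumes int: "integrable T2 \<phi>" and C0: "0 \<le> C"
    and C: "\<And>xs. cmod (LINT z|T2. \<phi> z * ev xs z) \<le> C * (LINT z|T2. cmod (ev xs z))"
    and K: "compact K" "K \<noteq> {}" "K \<subseteq> {-pi<..<pi} \<times> {-pi<..<pi}"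
  shows "cmod (LINT z|T2. \<phi> z * indicator K z) \<le> C * (LINT z|T2. indicator K z)"
proof -
  define L where "L = torus_map ` K"
  have L: "closed L" "L \<noteq> {}"
    using K by (auto simp: L_def intro!: compact_imp_closed compact_continuous_image continuous_intros)
  define G where "G j u = max 0 (1 - real j * infdist u L)" for j u
  have Gc: "continuous_on UNIV (G j)" for j
    unfolding G_def by (intro continuous_intros)
  have G01: "0 \<le> G j u" "G j u \<le> 1" for j u
    using infdist_nonneg[of u L] by (auto simp: G_def)
  have G_lim: "(\<lambda>j. G j u) \<longlonglongrightarrow> indicator L u" for u
  proof (cases "u \<in> L")
    case True
    then show ?thesis using L by (simp add: G_def)
  next
    case False
    then have d: "infdist u L > 0" using L infdist_pos_not_in_closed by blast
    obtain j0 where j0: "real j0 > 1 / infdist u L" using reals_Archimedean2 by blast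
    have "eventually (\<lambda>j. G j u = 0) sequentially"
      using eventually_ge_at_top[of j0]
    proof eventually_elim
      case (elim j)
      have "1 = 1 / infdist u L * infdist u L" using d by simp
      also have "\<dots> \<le> real j * infdist u L" using j0 elim d by (intro mult_right_mono) auto
      finally show ?case by (simp add: G_def)
    qed
    then show ?thesis using False by (simp add: tendsto_eventually)
  qed
  have ind: "indicator L (torus_map z) = (indicator K z :: real)" if "z \<in> {-pi..pi} \<times> {-pi..pi}" for z
  proof -
    have "torus_map z \<in> L \<longleftrightarrow> z \<in> K"
      using torus_map_inj[OF that] K(3) by (auto simp: L_def)
    then show ?thesis by (simp add: indicator_def)
  qed
  have cG: "continuous_on UNIV (\<lambda>z. G j (torus_map z))" for j
    using continuous_on_compose[OF continuous_torus_map continuous_on_subset[OF Gc]] by (simp add: o_def)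
  have mG: "(\<lambda>z. G j (torus_map z)) \<in> borel_measurable T2" for j
    by (rule continuous_measurable_T2[OF cG])
  have mK: "(indicator K :: real \<times> real \<Rightarrow> real) \<in> borel_measurable T2"
  proof (rule borel_measurable_LIMSEQ_real)
    show "(\<lambda>j. G j (torus_map z)) \<longlonglongrightarrow> indicator K z" if "z \<in> space T2" for z
      using G_lim[of "torus_map z"] ind[of z] that by (simp only: space_T2)
  qed (rule mG)
  have mKc: "(\<lambda>z. complex_of_real (indicator K z)) \<in> borel_measurable T2" using mK by measurable
  have lim1: "(\<lambda>j. LINT z|T2. \<phi> z * of_real (G j (torus_map z))) \<longlonglongrightarrow> (LINT z|T2. \<phi> z * of_real (indicator K z))"
  proof (rule integral_dominated_convergence)
    show "integrable T2 (\<lambda>z. cmod (\<phi> z))" using int by simp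
    show "(\<lambda>z. \<phi> z * of_real (indicator K z)) \<in> borel_measurable T2"
      using int mKc by measurable
    show "(\<lambda>z. \<phi> z * of_real (G j (torus_map z))) \<in> borel_measurable T2" for j
      using int mG[of j] by measurable
    show "AE z in T2. (\<lambda>j. \<phi> z * of_real (G j (torus_map z))) \<longlonglongrightarrow> \<phi> z * of_real (indicator K z)"
    proof (intro AE_I2)
      fix z assume "z \<in> space T2"
      then have "(\<lambda>j. G j (torus_map z)) \<longlonglongrightarrow> indicator K z"
        using G_lim[of "torus_map z"] ind[of z] by (simp only: space_T2)
      then show "(\<lambda>j. \<phi> z * of_real (G j (torus_map z))) \<longlonglongrightarrow> \<phi> z * of_real (indicator K z)"
        by (intro tendsto_intros)
    qed
    show "AE z in T2. norm (\<phi> z * of_real (G j (torus_map z))) \<le> cmod (\<phi> z)" for j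
      using G01 by (intro AE_I2) (simp add: norm_mult mult_left_le)
  qed
  have lim2: "(\<lambda>j. LINT z|T2. \<bar>G j (torus_map z)\<bar>) \<longlonglongrightarrow> (LINT z|T2. indicator K z)"
  proof (rule integral_dominated_convergence)
    show "integrable T2 (\<lambda>z. 1 :: real)" by simp
    show "AE z in T2. (\<lambda>j. \<bar>G j (torus_map z)\<bar>) \<longlonglongrightarrow> indicator K z"
    proof (intro AE_I2)
      fix z assume "z \<in> space T2"
      then have "(\<lambda>j. G j (torus_map z)) \<longlonglongrightarrow> indicator K z"
        using G_lim[of "torus_map z"] ind[of z] by (simp only: space_T2)
      then show "(\<lambda>j. \<bar>G j (torus_map z)\<bar>) \<longlonglongrightarrow> indicator K z" using G01 by simp
    qed
    show "(\<lambda>z. \<bar>G j (torus_map z)\<bar>) \<in> borel_measurable T2" for j using mG[of j] by measurable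
    show "AE z in T2. norm \<bar>G j (torus_map z)\<bar> \<le> 1" for j using G01 by (intro AE_I2) simp
  qed (rule mK)
  have "cmod (LINT z|T2. \<phi> z * of_real (indicator K z)) \<le> C * (LINT z|T2. indicator K z)"
  proof (rule LIMSEQ_le[OF tendsto_norm[OF lim1] tendsto_mult_left[OF lim2]])
    show "\<exists>N. \<forall>j\<ge>N. cmod (LINT z|T2. \<phi> z * of_real (G j (torus_map z))) \<le> C * (LINT z|T2. \<bar>G j (torus_map z)\<bar>)"
      using integral_continuous_on_torus_le[OF int C0 C Gc] by blast
  qed
  moreover have "(\<lambda>z. \<phi> z * complex_of_real (indicator K z)) = (\<lambda>z. \<phi> z * indicator K z)"
    by (auto simp: indicator_def)
  ultimately show ?thesis by simp
qed

lemma AE_T2_interior: "AE z in T2. z \<in> {-pi<..<pi} \<times> {-pi<..<pi}"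
proof -
  have box: "{-pi<..<pi} \<times> {-pi<..<pi} = box (-pi, -pi) (pi, pi)"
    by (auto simp: box_def Basis_prod_def)
  have "negligible (cbox (-pi, -pi) (pi, pi) - box (-pi, -pi) (pi, pi :: real))"
    by (rule negligible_frontier_interval)
  then have "AE z in lebesgue. z \<notin> cbox (-pi, -pi) (pi, pi) - box (-pi, -pi) (pi, pi :: real)"
    unfolding negligible_iff_null_sets by (rule AE_not_in)
  then have "AE z in lebesgue. z \<in> cbox (-pi, -pi) (pi, pi) \<longrightarrow> z \<in> box (-pi, -pi) (pi, pi :: real)"
    by eventually_elim blast
  then show ?thesis
    unfolding box square_eq_cbox by (subst AE_restrict_space_iff) auto
qed

text \<open>If the set \<open>B\<close> had positive measure, a compact \<open>K\<close> of positive
  measure inside it would give \<open>(C + 1) |K| <= C |K|\<close>. The open square \<open>Q\<close>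
  keeps \<open>K\<close> away from the identified edges, whose measure is zero.\<close>

lemma AE_Re_le:
  assumes int: "integrable T2 \<phi>" and C0: "0 \<le> C"
    and C: "\<And>xs. cmod (LINT z|T2. \<phi> z * ev xs z) \<le> C * (LINT z|T2. cmod (ev xs z))"
    and a: "cmod a = 1"
  shows "AE z in T2. Re (a * \<phi> z) \<le> C + 1"
proof -
  define Q where "Q = {-pi<..<pi} \<times> {-pi<..<pi :: real}"
  define B where "B = {z \<in> space T2. Re (a * \<phi> z) > C + 1} \<inter> Q"
  have mR: "(\<lambda>z. Re (a * \<phi> z)) \<in> borel_measurable T2" using int by measurable
  have Qs: "Q \<subseteq> space T2" unfolding space_T2 Q_def by auto
  have Bs: "B \<in> sets lebesgue"
  proof -
    have "{z \<in> space T2. Re (a * \<phi> z) > C + 1} \<in> sets T2" using mR by measurable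
    then have "{z \<in> space T2. Re (a * \<phi> z) > C + 1} \<in> sets lebesgue"
      unfolding square_eq_cbox by (subst (asm) sets_restrict_space_iff) auto
    moreover have "Q \<in> sets lebesgue" unfolding Q_def by (intro sets_completionI_sets) (auto simp: open_Times)
    ultimately show ?thesis unfolding B_def by blast
  qed
  have null: "B \<in> null_sets lebesgue"
  proof (rule ccontr)
    assume "B \<notin> null_sets lebesgue"
    have fin: "B \<in> lmeasurable"
    proof (rule fmeasurableI2[OF _ _ Bs])
      show "cbox (-pi, -pi) (pi, pi :: real) \<in> lmeasurable" by (rule lmeasurable_cbox)
      show "B \<subseteq> cbox (-pi, -pi) (pi, pi)"
        unfolding B_def square_eq_cbox[symmetric] space_T2 by blast
    qed
    define b where "b = measure lebesgue B"
    have b1: "emeasure lebesgue B = ennreal b"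
      unfolding b_def by (rule emeasure_eq_measure2[OF fin])
    have "b \<noteq> 0"
    proof
      assume "b = 0"
      then have "emeasure lebesgue B = 0" using b1 by simp
      then show False using \<open>B \<notin> null_sets lebesgue\<close> Bs by (simp add: null_sets_def)
    qed
    moreover have "b \<ge> 0" by (simp add: b_def)
    ultimately have b2: "b > 0" by linarith
    \<comment> \<open>\<open>B - K\<close> has measure strictly below that of \<open>B\<close>,
      which forces \<open>K\<close> to have positive measure.\<close>
    obtain K where K: "closed K" "K \<subseteq> B" "B - K \<in> lmeasurable" "emeasure lebesgue (B - K) < ennreal b"
      using sets_lebesgue_inner_closed[OF Bs b2] by blast
    have Kne: "K \<noteq> {}" using K(4) b1 by auto
    have Kb: "bounded K"
    proof (rule bounded_subset)
      show "K \<subseteq> cbox (-pi, -pi) (pi, pi)"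
        using K(2) unfolding B_def square_eq_cbox[symmetric] space_T2 by blast
    qed (rule bounded_cbox)
    have Kc: "compact K" using K(1) Kb by (simp add: compact_eq_bounded_closed)
    have KQ: "K \<subseteq> Q" using K(2) by (auto simp: B_def)
    have Ks: "K \<in> sets lebesgue" using K(1) by auto
    have Kf: "K \<in> lmeasurable" by (rule fmeasurableI2[OF fin K(2) Ks])
    have mpos: "measure lebesgue K > 0"
    proof (rule ccontr)
      assume "\<not> measure lebesgue K > 0"
      then have "measure lebesgue K = 0" by (simp add: zero_less_measure_iff)
      then have K0: "emeasure lebesgue K = 0" using emeasure_eq_measure2[OF Kf] by simp
      have "emeasure lebesgue B \<le> emeasure lebesgue (K \<union> (B - K))"
        using Ks Bs by (intro emeasure_mono) auto
      also have "\<dots> \<le> emeasure lebesgue K + emeasure lebesgue (B - K)"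
        using Ks Bs by (intro emeasure_subadditive) auto
      also have "\<dots> < ennreal b" using K(4) by (simp add: K0)
      finally show False using b1 by simp
    qed
    have KT: "K \<in> sets T2"
      using Ks KQ Qs unfolding square_eq_cbox by (subst sets_restrict_space_iff) auto
    have intK: "(LINT z|T2. indicator K z) = measure lebesgue K"
    proof -
      have "(LINT z|T2. indicator K z) = measure T2 (K \<inter> space T2)" by simp
      also have "K \<inter> space T2 = K" using KQ Qs by auto
      also have "measure T2 K = measure lebesgue K"
        using KQ Qs unfolding square_eq_cbox by (subst measure_restrict_space) auto
      finally show ?thesis .
    qed
    have iK: "integrable T2 (\<lambda>z. \<phi> z * indicator K z)"
    proof -
      have "(\<lambda>z. \<phi> z * indicator K z) = (\<lambda>z. indicator K z *\<^sub>R \<phi> z)"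
        by (auto simp: indicator_def)
      then show ?thesis using integrable_mult_indicator[OF KT int] by simp
    qed
    have rK: "integrable T2 (indicator K :: real \<times> real \<Rightarrow> real)"
      using KT finite_measure.emeasure_finite[OF finite_measure_T2] by (simp add: top.not_eq_extremum)
    have "(C + 1) * measure lebesgue K = (LINT z|T2. (C + 1) * indicator K z)"
      by (simp only: intK[symmetric] integral_mult_right_zero)
    also have "\<dots> \<le> (LINT z|T2. Re (a * (\<phi> z * indicator K z)))"
    proof (rule integral_mono)
      show "integrable T2 (\<lambda>z. (C + 1) * indicator K z)" using rK by simp
      show "integrable T2 (\<lambda>z. Re (a * (\<phi> z * indicator K z)))" using iK by (intro integrable_Re) simp
      show "(C + 1) * indicator K z \<le> Re (a * (\<phi> z * indicator K z))" for z
        using K(2) by (auto simp: indicator_def B_def)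
    qed
    also have "\<dots> = Re (a * (LINT z|T2. \<phi> z * indicator K z))"
      using iK by (subst integral_Re) simp_all
    also have "\<dots> \<le> cmod (a * (LINT z|T2. \<phi> z * indicator K z))" by (rule complex_Re_le_cmod)
    also have "\<dots> = cmod (LINT z|T2. \<phi> z * indicator K z)" using a by (simp add: norm_mult)
    also have "\<dots> \<le> C * (LINT z|T2. indicator K z)"
      using integral_compact_le[OF int C0 C Kc Kne] KQ by (simp only: Q_def)
    also have "\<dots> = C * measure lebesgue K" by (simp only: intK)
    finally show False using mpos by (simp add: distrib_right)
  qed
  then have "AE z in lebesgue. z \<notin> B" by (rule AE_not_in)
  then have "AE z in T2. z \<notin> B"
    unfolding square_eq_cbox by (subst AE_restrict_space_iff) (auto elim: eventually_mono)
  moreover have "AE z in T2. z \<in> space T2" by (rule AE_space)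
  ultimately show ?thesis
    using AE_T2_interior
  proof eventually_elim
    case (elim z)
    then show ?case unfolding B_def Q_def by force
  qed
qed

text \<open>The directions 1, -1, i, -i control the real and the imaginary part, whence the factor
  2.\<close>

lemma AE_bounded:
  assumes "integrable T2 \<phi>" "0 \<le> C"
    and "\<And>F. finite F \<Longrightarrow> (\<Sum>n\<in>F. cmod (LINT z|T2. \<phi> z * mode n z)) \<le> C"
  shows "AE z in T2. cmod (\<phi> z) \<le> 2 * (C / (2 * pi)\<^sup>2 + 1)"
proof -
  define D where "D = C / (2 * pi)\<^sup>2"
  have C0: "0 \<le> D" using assms(2) by (simp add: D_def)
  note tr = integral_trig_le[OF assms(1,3), folded D_def]
  have "AE z in T2. Re (1 * \<phi> z) \<le> D + 1" "AE z in T2. Re (-1 * \<phi> z) \<le> D + 1"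
    "AE z in T2. Re (\<i> * \<phi> z) \<le> D + 1" "AE z in T2. Re (- \<i> * \<phi> z) \<le> D + 1"
    by (rule AE_Re_le[OF assms(1) C0 tr]; simp)+
  then show ?thesis unfolding D_def[symmetric]
  proof eventually_elim
    case (elim z)
    then have "\<bar>Re (\<phi> z)\<bar> \<le> D + 1" "\<bar>Im (\<phi> z)\<bar> \<le> D + 1" by auto
    then have "\<bar>Re (\<phi> z)\<bar> + \<bar>Im (\<phi> z)\<bar> \<le> (D + 1) + (D + 1)" by (rule add_mono)
    then have "cmod (\<phi> z) \<le> (D + 1) + (D + 1)" by (rule order_trans[OF cmod_le])
    then show ?case by simp
  qed
qed

lemma Lp_of_AE_bounded:
  assumes m: "\<phi> \<in> borel_measurable T2" and B: "AE z in T2. cmod (\<phi> z) \<le> B" and p: "p > 0" and B0: "B \<ge> 0"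
  shows "in_Lp p \<phi>" "Lp_norm p \<phi> < (B powr p * (2 * pi)\<^sup>2) powr (1 / p) + 1"
proof -
  have le: "AE z in T2. cmod (\<phi> z) powr p \<le> B powr p"
    using B by eventually_elim (use p in \<open>auto intro: powr_mono2\<close>)
  have int: "integrable T2 (\<lambda>z. cmod (\<phi> z) powr p)"
  proof (rule Bochner_Integration.integrable_bound[OF integrable_const_T2[of "B powr p"]])
    show "(\<lambda>z. cmod (\<phi> z) powr p) \<in> borel_measurable T2" using m by measurable
    show "AE z in T2. norm (cmod (\<phi> z) powr p) \<le> norm (B powr p)" using le by eventually_elim simp
  qed
  then show "in_Lp p \<phi>" using m by (simp add: in_Lp_def)
  have "(LINT z|T2. cmod (\<phi> z) powr p) \<le> (LINT z|T2. B powr p)"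
    by (rule integral_mono_AE[OF int integrable_const_T2 le])
  also have "\<dots> = B powr p * (2 * pi)\<^sup>2"
    using measure_T2 by (simp only: lebesgue_integral_const real_scaleR_def mult.commute)
  finally have "(LINT z|T2. cmod (\<phi> z) powr p) powr (1 / p) \<le> (B powr p * (2 * pi)\<^sup>2) powr (1 / p)"
    using p by (intro powr_mono2) auto
  then show "Lp_norm p \<phi> < (B powr p * (2 * pi)\<^sup>2) powr (1 / p) + 1"
    by (simp add: Lp_norm_def)
qed

section \<open>Frequencies of a generic potential and the uniform bound\<close>

text \<open>With an empty geometric support the first rational function vanishes, and
  \<open>resultant_condition\<close> excludes the zero numerator. Hence \<open>V\<close> has a
  nonzero frequency and the set of poles is not empty.\<close>

lemma generic_gsupp_nonempty:
  assumes "generic_coeffs k W"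
  shows "gsupp W \<noteq> {}"
proof
  assume "gsupp W = {}"
  then have "f_first k W = 0" by (simp add: f_first_def)
  then have "numerator (f_first k W) = 0" by (simp add: numerator_def)
  then show False using assms by (simp add: generic_coeffs_def resultant_condition_def)
qed

lemma eigenfunctions_bounded:
  assumes tp: "real_trig_polynomial k V" and gen: "generic k V"
  shows "\<exists>B\<ge>0. \<forall>\<phi>. eigenfunction V \<phi> \<and> Lp_norm 2 \<phi> = 1 \<longrightarrow> (AE z in T2. cmod (\<phi> z) \<le> B)"
proof -
  define W where "W = fourier_coeff (\<lambda>z. of_real (V z))"
  obtain c where c: "\<And>x y. complex_of_real (V (x, y)) =
       (\<Sum>a\<in>{- int k..int k}. \<Sum>b\<in>{- int k..int k}. c (a, b) * cis (of_int a * x + of_int b * y))"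
    using tp unfolding real_trig_polynomial_def by blast
  define N where "N = {- int k..int k} \<times> {- int k..int k}"
  have N: "finite N" by (simp add: N_def)
  have Vc: "complex_of_real (V z) = (\<Sum>m\<in>N. c m * mode m z)" for z
  proof -
    have "complex_of_real (V z) = (\<Sum>a\<in>{- int k..int k}. \<Sum>b\<in>{- int k..int k}. c (a, b) * mode (a, b) z)"
      using c[of "fst z" "snd z"] by (simp add: mode_def)
    then show ?thesis by (simp add: N_def sum.cartesian_product case_prod_unfold)
  qed
  have W: "W m = (if m \<in> N then c m else 0)" for m
    using integral_modes_sum[OF N, of c m] by (simp add: W_def fourier_coeff_mode Vc)
  have VW: "complex_of_real (V z) = (\<Sum>m\<in>N. W m * mode m z)" for z
    unfolding Vc by (intro sum.cong) (auto simp: W)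
  have W_cnj: "W (- m) = cnj (W m)" for m
  proof -
    have "cnj (mode n z) = mode (- n) z" for n z by (simp add: mode_def cis_cnj)
    moreover have "cnj (LINT z|T2. of_real (V z) * mode (- m) z) = (LINT z|T2. cnj (of_real (V z) * mode (- m) z))"
      by (rule Bochner_Integration.integral_cnj[symmetric])
    ultimately have "cnj (LINT z|T2. of_real (V z) * mode (- m) z) = (LINT z|T2. of_real (V z) * mode m z)"
      by simp
    then show ?thesis by (simp add: W_def fourier_coeff_mode)
  qed
  define D where "D = {m\<in>N. m \<noteq> 0 \<and> W m \<noteq> 0}"
  have "finite D" using N by (simp add: D_def)
  then obtain ms where ms: "set ms = D" "distinct ms" using finite_distinct_list by blast
  have "D \<noteq> {}"
  proof -
    obtain a b where "(a, b) \<in> gsupp W"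
      using generic_gsupp_nonempty[of k W] gen by (auto simp: generic_def W_def)
    then obtain s where s: "(a, b) \<noteq> (0, 0)" "s \<ge> 1" "W (s * a, s * b) \<noteq> 0"
      by (auto simp: gsupp_def supp_def)
    then have "(s * a, s * b) \<in> D" by (auto simp: D_def W zero_prod_def split: if_splits)
    then show ?thesis by blast
  qed
  interpret potential W ms "int k"
  proof
    show "distinct ms" by (rule ms)
    show "ms \<noteq> []" using ms \<open>D \<noteq> {}\<close> by auto
    show "0 \<notin> set ms" by (simp add: ms D_def)
    show "- m \<in> set ms" if "m \<in> set ms" for m
      using that unfolding ms(1) by (auto simp: D_def N_def W_cnj mem_Times_iff)
    show "W (- m) = cnj (W m)" for m by (rule W_cnj)
    show "W m \<noteq> 0" if "m \<in> set ms" for m using that unfolding ms(1) by (simp add: D_def)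
    show "\<bar>fst m\<bar> \<le> int k \<and> \<bar>snd m\<bar> \<le> int k" if "m \<in> set ms" for m
      using that unfolding ms(1) by (auto simp: D_def N_def mem_Times_iff)
  qed
  have Vvs: "complex_of_real (V z) = W 0 + ev vs z" for z
  proof -
    have "0 \<in> N" by (simp add: N_def zero_prod_def)
    have "(\<Sum>m\<in>N. W m * mode m z) = W 0 * mode 0 z + (\<Sum>m\<in>N - {0}. W m * mode m z)"
      by (rule sum.remove[OF N \<open>0 \<in> N\<close>])
    also have "(\<Sum>m\<in>N - {0}. W m * mode m z) = (\<Sum>m\<in>D. W m * mode m z)"
      using N by (intro sum.mono_neutral_right) (auto simp: D_def)
    finally show ?thesis by (simp add: VW ev_vs ms)
  qed
  \<comment> \<open>The L^1 bound common to all normalized eigenfunctions; so \<open>C\<close>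
    depends on the potential only.\<close>
  define M where "M = (2 * pi)\<^sup>2 + 1"
  from sum_eigen_coeffs_bounded[of M] obtain C where
    C: "\<forall>c E F. eigen_coeffs c E M \<longrightarrow> finite F \<longrightarrow> (\<Sum>n\<in>F. cmod (c n)) \<le> C" by blast
  show ?thesis
  proof (intro exI[of _ "2 * (max C 0 / (2 * pi)\<^sup>2 + 1)"] conjI allI impI)
    show "0 \<le> 2 * (max C 0 / (2 * pi)\<^sup>2 + 1)" by simp
    fix \<phi> assume "eigenfunction V \<phi> \<and> Lp_norm 2 \<phi> = 1"
    then obtain E where \<phi>: "in_Lp 2 \<phi>" "Lp_norm 2 \<phi> = 1" "schroedinger V \<phi> (\<lambda>z. E * \<phi> z)"
      unfolding eigenfunction_def by blast
    have ec: "eigen_coeffs (\<lambda>n. LINT z|T2. \<phi> z * mode n z) (E - W 0) M"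
      by (rule eigen_coeffs_of_eigenfunction[OF \<phi>(3,1) Vvs]) (use integral_cmod_le[OF \<phi>(1,2)] in \<open>simp add: M_def\<close>)
    show "AE z in T2. cmod (\<phi> z) \<le> 2 * (max C 0 / (2 * pi)\<^sup>2 + 1)"
    proof (rule AE_bounded[OF in_Lp_2_integrable(1)[OF \<phi>(1)]])
      show "(\<Sum>n\<in>F. cmod (LINT z|T2. \<phi> z * mode n z)) \<le> max C 0" if "finite F" for F
        using C ec that by (meson max.coboundedI1)
    qed simp
  qed
qed

theorem mainTheorem2:
  fixes V :: "real \<times> real \<Rightarrow> real" and k :: nat
  assumes "real_trig_polynomial k V"
    and "generic k V"
  shows "\<forall>p>0. \<exists>C. \<forall>\<phi>. eigenfunction V \<phi> \<and> Lp_norm 2 \<phi> = 1 \<longrightarrow>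
           in_Lp p \<phi> \<and> Lp_norm p \<phi> < C"
proof (intro allI impI)
  fix p :: real assume p: "p > 0"
  obtain B where B: "B \<ge> 0" "\<And>\<phi>. eigenfunction V \<phi> \<and> Lp_norm 2 \<phi> = 1 \<Longrightarrow> (AE z in T2. cmod (\<phi> z) \<le> B)"
    using eigenfunctions_bounded[OF assms] by blast
  show "\<exists>C. \<forall>\<phi>. eigenfunction V \<phi> \<and> Lp_norm 2 \<phi> = 1 \<longrightarrow> in_Lp p \<phi> \<and> Lp_norm p \<phi> < C"
  proof (intro exI allI impI)
    fix \<phi> assume \<phi>: "eigenfunction V \<phi> \<and> Lp_norm 2 \<phi> = 1"
    then have "\<phi> \<in> borel_measurable T2" by (simp add: eigenfunction_def in_Lp_def)
    from Lp_of_AE_bounded[OF this B(2)[OF \<phi>] p B(1)]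
    show "in_Lp p \<phi> \<and> Lp_norm p \<phi> < (B powr p * (2 * pi)\<^sup>2) powr (1 / p) + 1" by blast
  qed
qed

end
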